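(* Let $X=(X_t)_{t\ge 0}$ be a real-valued strong Markov process with $X_0=0$ on a filtered probability space $(\Omega,\mathcal F,(\mathcal F_t)_{t\ge 0},\mathbb P)$, let $r>0$ and $\alpha>0$, and for $v>0$ let $V=ve^{X}$. Assume: (i) $\mathbb P\left(\lim_{t\downarrow 0}X_t=X_0\right)=1$; (ii) the process $(e^{-rt+X_t},\ t\ge 0)$ is of class $D$; (iii) $\inf_{t\ge 0}e^{-rt}\,\mathbb E(e^{X_t})=0$; (iv) for every $t>0$, the support of the law of $X_t$ is $\mathbb R$. For $c>0$ put $f(x)=-\alpha x+c$ and consider the optimal stopping problem $$s(v)=\sup_{\tau\in\Delta}\mathbb E_v\left(e^{-r\tau}f(V_\tau)\right),\qquad v>0,$$ where $\Delta$ is the set of $\mathcal F^V$-stopping times. Then this problem admits at least one optimal stopping time. Moreover, for every $c>0$ there exists $b_c>0$ such that the smallest optimal stopping time of this problem is of the form $$\tau_{b_c}=\inf\{t\ge 0:\ V_t\le b_c\}.$$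
   Context: The process $V$ is $V=ve^{X}$, where $v>0$ is a constant, so $V_0=v$. When the starting point must be specified, one writes $V^v=ve^{X}$. $\mathbb E_v(\cdot)$ and $\mathbb P_v(\cdot)$ denote $\mathbb E(\cdot\mid V_0=v)$ and $\mathbb P(\cdot\mid V_0=v)$, so that $\mathbb E_v[g(V_\tau)]$ is computed with $V=V^v=ve^X$. $\mathcal F^V=(\mathcal F^V_t)_{t\ge0}$ is the completed right-continuous filtration generated by $V$, $\mathcal F^V_t=\sigma(V_s,\ s\le t)$; $\Delta$ is the set of all $\mathcal F^V$-stopping times. The function $f(x)=-\alpha x+c$ is a decreasing affine function with $\alpha>0$, $c>0$. A stopping time $\tau^*\in\Delta$ is optimal if it attains the supremum, i.e. $\mathbb E_v\left(e^{-r\tau^*}f(V_{\tau^*})\right)=\sup_{\tau\in\Delta}\mathbb E_v\left(e^{-r\tau}f(V_\tau)\right)$. A process is of class $D$ if the family of its values at all finite stopping times is uniformly integrable.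
   Formalization: The process X is also assumed separable in Doob's sense (automatic for right-continuous paths), without which the passage-time claim can fail; the strong Markov property is taken with X started at x being x+X, as V^v=ve^X suggests. *)

theory Defs
  imports "HOL-Probability.Probability"
begin

text \<open>
  Filtrations are indexed by \<^typ>\<open>ennreal\<close>, so that the library's \<^const>\<open>stopping_time\<close> and
  \<^const>\<open>filtration.pre_sigma\<close> cover stopping times that may be infinite; processes are indexed
  by the real numbers, and only times \<open>t \<ge> 0\<close> matter.
\<close>

text \<open>\<open>\<F>\<^bsub>t+\<^esub> = \<Inter>\<^bsub>s>t\<^esub> \<F>\<^bsub>s\<^esub>\<close>; the factor \<open>\<F>\<^bsub>\<infinity>\<^esub>\<close> only matters for \<open>t = \<infinity>\<close>.\<close>

definition right_limit_filtration ::
    "'a set \<Rightarrow> (ennreal \<Rightarrow> 'a measure) \<Rightarrow> ennreal \<Rightarrow> 'a measure" where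
  "right_limit_filtration \<Omega> F t = sigma \<Omega> (sets (F \<infinity>) \<inter> (\<Inter>s\<in>{t<..}. sets (F s)))"

text \<open>
  The completed right-continuous filtration generated by \<open>Z\<close>. The null sets are those of the
  completion of \<open>M\<close>, as \<open>M\<close> itself need not be complete; hence stopping times of this
  filtration are measurable for the completion, and expectations involving them are taken
  under it.
\<close>

definition completed_natural_filtration ::
    "'a measure \<Rightarrow> (real \<Rightarrow> 'a \<Rightarrow> real) \<Rightarrow> ennreal \<Rightarrow> 'a measure" where
  "completed_natural_filtration M Z t = sigma (space M)
     ({Z s -` B \<inter> space M | s B. 0 \<le> s \<and> ennreal s \<le> t \<and> B \<in> sets borel}
      \<union> null_sets (completion M))"

definition usual_natural_filtration ::
    "'a measure \<Rightarrow> (real \<Rightarrow> 'a \<Rightarrow> real) \<Rightarrow> ennreal \<Rightarrow> 'a measure" where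
  "usual_natural_filtration M Z =
     right_limit_filtration (space M) (completed_natural_filtration M Z)"

definition progressively_measurable ::
    "(ennreal \<Rightarrow> 'a measure) \<Rightarrow> (real \<Rightarrow> 'a \<Rightarrow> real) \<Rightarrow> bool" where
  "progressively_measurable F X \<longleftrightarrow>
     (\<forall>t\<ge>0. (\<lambda>(s, \<omega>). X s \<omega>) \<in> restrict_space borel {0..t} \<Otimes>\<^sub>M F (ennreal t) \<rightarrow>\<^sub>M borel)"

text \<open>
  Separability in the sense of Doob: outside a null set, the path is determined by its values
  on a fixed countable set of times.
\<close>

definition separable_process :: "'a measure \<Rightarrow> (real \<Rightarrow> 'a \<Rightarrow> real) \<Rightarrow> bool" where
  "separable_process M X \<longleftrightarrow>
     (\<exists>D. countable D \<and> D \<subseteq> {0..} \<and>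
       (AE \<omega> in M. \<forall>t\<ge>0. \<forall>e>0. \<exists>s\<in>D. \<bar>s - t\<bar> < e \<and> \<bar>X s \<omega> - X t \<omega>\<bar> < e))"

text \<open>
  Strong Markov process with transition function \<open>K\<close>. The Markov property is required at all
  optional times \<open>S\<close> (stopping times of \<open>\<F>\<^bsub>t+\<^esub>\<close>), conditionally on \<open>\<F>\<^bsub>S+\<^esub>\<close>.
  Progressive measurability makes \<open>X\<^bsub>S\<^esub>\<close> a random variable. Separability is the usual
  convention for events that depend on uncountably many times, such as level passage before
  a given time: such an event may change when the process is replaced by a progressively
  measurable modification equal to it at every stopping time (alter Brownian motion at the left
  endpoints of its excursions from a level).
\<close>

definition strong_markov_process ::
    "'a measure \<Rightarrow> (ennreal \<Rightarrow> 'a measure) \<Rightarrow> (real \<Rightarrow> real \<Rightarrow> real measure) \<Rightarrow>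
     (real \<Rightarrow> 'a \<Rightarrow> real) \<Rightarrow> bool" where
  "strong_markov_process M F K X \<longleftrightarrow>
     progressively_measurable F X \<and> separable_process M X \<and>
     (\<forall>t\<ge>0. K t \<in> borel \<rightarrow>\<^sub>M prob_algebra borel) \<and>
     (\<forall>S. stopping_time (right_limit_filtration (space M) F) S \<longrightarrow>
       (\<forall>t\<ge>0. \<forall>B\<in>sets borel. AE \<omega> in M. S \<omega> < \<infinity> \<longrightarrow>
          real_cond_exp M
            (filtration.pre_sigma (space M) (right_limit_filtration (space M) F) S)
            (\<lambda>\<omega>'. indicator B (X (enn2real (S \<omega>') + t) \<omega>')) \<omega>
          = measure (K t (X (enn2real (S \<omega>)) \<omega>)) B))"

text \<open>
  The law at time \<open>t\<close> of the process started at \<open>x\<close>, under the convention that \<open>V\<close> started at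
  \<open>v\<close> is \<open>v e\<^sup>X\<close>, i.e. that \<open>X\<close> started at \<open>x\<close> is \<open>x + X\<close>.
\<close>

definition shifted_law :: "'a measure \<Rightarrow> (real \<Rightarrow> 'a \<Rightarrow> real) \<Rightarrow> real \<Rightarrow> real \<Rightarrow> real measure" where
  "shifted_law M X t x = distr M borel (\<lambda>\<omega>. x + X t \<omega>)"

definition measure_support :: "real measure \<Rightarrow> real set" where
  "measure_support \<mu> = {x. \<forall>U. open U \<longrightarrow> x \<in> U \<longrightarrow> emeasure \<mu> U > 0}"

definition uniformly_integrable :: "'a measure \<Rightarrow> ('a \<Rightarrow> real) set \<Rightarrow> bool" where
  "uniformly_integrable M \<Y> \<longleftrightarrow> (\<forall>Y\<in>\<Y>. integrable M Y) \<and>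
     (\<forall>e>0. \<exists>k. \<forall>Y\<in>\<Y>. (LINT \<omega>|M. \<bar>Y \<omega>\<bar> * indicator {\<omega>. \<bar>Y \<omega>\<bar> > k} \<omega>) \<le> e)"

definition class_D ::
    "'a measure \<Rightarrow> (ennreal \<Rightarrow> 'a measure) \<Rightarrow> (real \<Rightarrow> 'a \<Rightarrow> real) \<Rightarrow> bool" where
  "class_D M G Y \<longleftrightarrow> uniformly_integrable (completion M)
     {\<lambda>\<omega>. Y (enn2real (\<tau> \<omega>)) \<omega> | \<tau>. stopping_time G \<tau> \<and> (\<forall>\<omega>\<in>space M. \<tau> \<omega> < \<infinity>)}"

definition exp_process :: "(real \<Rightarrow> 'a \<Rightarrow> real) \<Rightarrow> real \<Rightarrow> real \<Rightarrow> 'a \<Rightarrow> real" where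
  "exp_process X v t \<omega> = v * exp (X t \<omega>)"

definition admissible_times :: "'a measure \<Rightarrow> (real \<Rightarrow> 'a \<Rightarrow> real) \<Rightarrow> ('a \<Rightarrow> ennreal) set" where
  "admissible_times M V = {\<tau>. stopping_time (usual_natural_filtration M V) \<tau>}"

text \<open>The reward is \<open>0\<close> on the event that one never stops.\<close>

definition expected_reward ::
    "'a measure \<Rightarrow> real \<Rightarrow> (real \<Rightarrow> real) \<Rightarrow> (real \<Rightarrow> 'a \<Rightarrow> real) \<Rightarrow> ('a \<Rightarrow> ennreal) \<Rightarrow> real" where
  "expected_reward M r f V \<tau> = (LINT \<omega>|completion M.
     (if \<tau> \<omega> = \<infinity> then 0 else exp (- r * enn2real (\<tau> \<omega>)) * f (V (enn2real (\<tau> \<omega>)) \<omega>)))"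

definition value_of_problem ::
    "'a measure \<Rightarrow> real \<Rightarrow> (real \<Rightarrow> real) \<Rightarrow> (real \<Rightarrow> 'a \<Rightarrow> real) \<Rightarrow> ereal" where
  "value_of_problem M r f V = (SUP \<tau>\<in>admissible_times M V. ereal (expected_reward M r f V \<tau>))"

definition optimal_time ::
    "'a measure \<Rightarrow> real \<Rightarrow> (real \<Rightarrow> real) \<Rightarrow> (real \<Rightarrow> 'a \<Rightarrow> real) \<Rightarrow> ('a \<Rightarrow> ennreal) \<Rightarrow> bool" where
  "optimal_time M r f V \<tau> \<longleftrightarrow>
     \<tau> \<in> admissible_times M V \<and> ereal (expected_reward M r f V \<tau>) = value_of_problem M r f V"

definition smallest_optimal_time ::
    "'a measure \<Rightarrow> real \<Rightarrow> (real \<Rightarrow> real) \<Rightarrow> (real \<Rightarrow> 'a \<Rightarrow> real) \<Rightarrow> ('a \<Rightarrow> ennreal) \<Rightarrow> bool" where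
  "smallest_optimal_time M r f V \<tau> \<longleftrightarrow>
     optimal_time M r f V \<tau> \<and> (\<forall>\<sigma>. optimal_time M r f V \<sigma> \<longrightarrow> (AE \<omega> in M. \<tau> \<omega> \<le> \<sigma> \<omega>))"

definition passage_time :: "(real \<Rightarrow> 'a \<Rightarrow> real) \<Rightarrow> real \<Rightarrow> 'a \<Rightarrow> ennreal" where
  "passage_time V b \<omega> = Inf {ennreal t | t. 0 \<le> t \<and> V t \<omega> \<le> b}"

definition affine_payoff :: "real \<Rightarrow> real \<Rightarrow> real \<Rightarrow> real" where
  "affine_payoff \<alpha> c x = - \<alpha> * x + c"

end

theory Submission
  imports Defs
begin

text \<open>
  Write \<open>v = e\<^sup>x\<close> and let \<open>p(y) = (c - \<alpha> e\<^sup>y)\<^sup>+\<close>. Allowing one to stop only at the points of an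
  independent Poisson process of rate \<open>n\<close> gives the penalized equation
  \<open>w\<^sub>n(x) = n/(r+n) E max (w\<^sub>n, p)(x + X\<^bsub>\<epsilon>\<^esub>)\<close>, \<open>\<epsilon>\<close> exponential of rate \<open>r + n\<close>. By the resolvent
  equation \<open>w\<^sub>n\<close> is the \<open>r\<close>-potential of \<open>n (p - w\<^sub>n)\<^sup>+\<close>, so the strong Markov property turns
  \<open>E e\<^bsup>-rS\<^esup> w\<^sub>n(x + X\<^sub>S)\<close> into an integral over the times after \<open>S\<close>: it is at most \<open>w\<^sub>n(x)\<close>, with equality
  as long as the path stays where \<open>w\<^sub>n \<ge> p\<close>. The functions \<open>w\<^sub>n\<close> increase to the value function \<open>w\<close>.

  No regularity of the paths beyond separability is needed, because \<open>E e\<^bsup>-rS\<^esup> G(X\<^sub>S)\<close> is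
  continuous along convergent sequences of optional times \<open>S\<close> for bounded Lipschitz \<open>G\<close>: up to a
  uniformly small error \<open>G\<close> is a potential. This yields both \<open>X\<^bsub>\<tau>\<^esub> \<le> b\<close> at the passage time \<open>\<tau>\<close>
  and the martingale property of \<open>w\<close> up to \<open>\<tau>\<close>.

  The stopping region is a half-line because \<open>(c - w(x)) e\<^bsup>-x\<^esup>\<close> is nonincreasing, a property that
  passes through maxima and averages. It is nonempty, for otherwise waiting for \<open>X\<close> to fall below
  \<open>-k\<close> would be harmless for every \<open>k\<close>, although the discount at these times tends to \<open>0\<close>.
\<close>

section \<open>Penalized fixed points for averages over a law on the real line\<close>

text \<open>Replacing the affine reward by its positive part \<open>p\<close> makes every function
  in sight bounded and Lipschitz, and it costs nothing: never stopping earns 0, the value is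
  positive, and so the reward is positive wherever stopping turns out to be optimal.

  Two obstacles shape the rest. The infimum that defines the passage time runs over uncountably many
  times and need not be attained, so it is not visibly a stopping time. It is recovered, up to a
  null set, as the supremum of crossing times of levels slightly above the threshold, each an
  infimum over a countable separating set. Moreover, admissible times belong to the completed
  filtration of the price, whereas the strong Markov property is available at optional times of
  \<open>F\<close>; every admissible time is a.s. equal to such a time.

  The bounds in \<open>payoff_class\<close> all carry the constant \<open>c\<close>, since the put
  has slope at most \<open>c\<close> up to the point where it vanishes. Being uniform in the
  penalization, they pass to the value function under mere pointwise convergence.\<close>

definition payoff_class :: "real \<Rightarrow> (real \<Rightarrow> real) \<Rightarrow> bool" where
  "payoff_class c g \<longleftrightarrow> (\<forall>x. 0 \<le> g x \<and> g x \<le> c) \<and> (\<forall>x y. \<bar>g x - g y\<bar> \<le> c * \<bar>x - y\<bar>) \<and>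
     (\<forall>x y. x \<le> y \<longrightarrow> c - g y \<le> exp (y - x) * (c - g x))"

lemma payoff_classD:
  assumes "payoff_class c g"
  shows "0 \<le> g x" "g x \<le> c" "\<bar>g x - g y\<bar> \<le> c * \<bar>x - y\<bar>"
    "x \<le> y \<Longrightarrow> c - g y \<le> exp (y - x) * (c - g x)"
  using assms by (auto simp: payoff_class_def)

lemma payoff_class_nonneg: "payoff_class c g \<Longrightarrow> 0 \<le> c"
  using payoff_classD(1,2)[of c g 0] by linarith

lemma borel_measurable_lipschitz:
  fixes g :: "real \<Rightarrow> real"
  assumes "\<And>x y. \<bar>g x - g y\<bar> \<le> c * \<bar>x - y\<bar>"
  shows "g \<in> borel_measurable borel"
proof -
  have "0 \<le> c" using assms[of 0 1] by simp
  then have "c-lipschitz_on UNIV g"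
    using assms by (auto simp: lipschitz_on_def dist_real_def)
  then show ?thesis
    by (intro borel_measurable_continuous_onI lipschitz_on_continuous_on)
qed

lemma payoff_class_measurable: "payoff_class c g \<Longrightarrow> g \<in> borel_measurable borel"
  by (rule borel_measurable_lipschitz[of g c]) (rule payoff_classD)

lemma abs_exp_diff_le:
  fixes u v m :: real
  assumes "u \<le> m" "v \<le> m"
  shows "\<bar>exp u - exp v\<bar> \<le> exp m * \<bar>u - v\<bar>"
proof -
  have *: "exp v - exp u \<le> exp m * (v - u)" if "u \<le> v" "v \<le> m" for u v :: real
  proof -
    have "1 + (u - v) \<le> exp (u - v)" by (rule exp_ge_add_one_self)
    then have "exp v * (1 - exp (u - v)) \<le> exp v * (v - u)"
      by (intro mult_left_mono) (linarith, simp)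
    also have "\<dots> \<le> exp m * (v - u)" using that by (intro mult_right_mono) auto
    finally show ?thesis by (simp add: algebra_simps flip: exp_add)
  qed
  have mono: "exp a \<le> exp b" if "a \<le> b" for a b :: real using that by simp
  show ?thesis
  proof (cases "u \<le> v")
    case True
    then show ?thesis using *[OF True assms(2)] mono[OF True] by (simp add: abs_if)
  next
    case False
    then show ?thesis using *[of v u] assms mono[of v u] by (simp add: abs_if)
  qed
qed

lemma payoff_class_put:
  assumes "c > 0" "\<alpha> > 0"
  shows "payoff_class c (\<lambda>x. max 0 (c - \<alpha> * exp x))"
proof -
  \<comment> \<open>\<open>m\<close> is the zero of the affine payoff. Freezing the exponent at
    \<open>m\<close> absorbs the positive part into one formula, whose slope is at most \<alpha> e^m
    = c.\<close>
  define m where "m = ln (c / \<alpha>)"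
  have m: "\<alpha> * exp m = c" using assms by (simp add: m_def)
  have eq: "max 0 (c - \<alpha> * exp x) = c - \<alpha> * exp (min x m)" for x
  proof (cases "x \<le> m")
    case True
    then have "\<alpha> * exp x \<le> \<alpha> * exp m" using assms by simp
    then show ?thesis using True m by simp
  next
    case False
    then have "\<alpha> * exp m \<le> \<alpha> * exp x" using assms by simp
    then show ?thesis using False m by (simp add: min_def max_def)
  qed
  have 1: "\<bar>(c - \<alpha> * exp (min x m)) - (c - \<alpha> * exp (min y m))\<bar> \<le> c * \<bar>x - y\<bar>" for x y
  proof -
    have "\<bar>(c - \<alpha> * exp (min x m)) - (c - \<alpha> * exp (min y m))\<bar> = \<alpha> * \<bar>exp (min x m) - exp (min y m)\<bar>"
      using assms by (simp add: abs_mult abs_minus_commute flip: right_diff_distrib)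
    also have "\<dots> \<le> \<alpha> * (exp m * \<bar>min x m - min y m\<bar>)"
      using assms by (intro mult_left_mono abs_exp_diff_le) auto
    also have "\<dots> = c * \<bar>min x m - min y m\<bar>" using m by (simp add: mult.assoc[symmetric])
    also have "\<dots> \<le> c * \<bar>x - y\<bar>" using assms by (intro mult_left_mono) auto
    finally show ?thesis .
  qed
  have 2: "\<alpha> * exp (min y m) \<le> exp (y - x) * (\<alpha> * exp (min x m))" if "x \<le> y" for x y
  proof -
    have "exp (min y m) \<le> exp ((y - x) + min x m)" using that by auto
    then show ?thesis using assms by (simp add: exp_add mult.left_commute)
  qed
  have 3: "\<alpha> * exp (min x m) \<le> c" for x
    using m assms by (metis exp_le_cancel_iff min.cobounded2 mult_le_cancel_left_pos)
  show ?thesis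
    unfolding payoff_class_def eq using 1 2 3 assms by auto
qed

lemma payoff_class_max:
  assumes "payoff_class c g" "payoff_class c h"
  shows "payoff_class c (\<lambda>x. max (g x) (h x))"
proof -
  have 1: "\<bar>max (g x) (h x) - max (g y) (h y)\<bar> \<le> c * \<bar>x - y\<bar>" for x y
    using payoff_classD(3)[OF assms(1), of x y] payoff_classD(3)[OF assms(2), of x y] by linarith
  have 2: "c - max (g y) (h y) \<le> exp (y - x) * (c - max (g x) (h x))" if "x \<le> y" for x y
    using payoff_classD(4)[OF assms(1) that] payoff_classD(4)[OF assms(2) that] by (auto simp: max_def)
  show ?thesis
    unfolding payoff_class_def
    using 1 2 payoff_classD(1,2)[OF assms(1)] payoff_classD(1,2)[OF assms(2)]
    by (auto simp: max.coboundedI1)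
qed

lemma payoff_class_lim:
  assumes g: "\<And>n. payoff_class c (g n)" and lim: "\<And>x. (\<lambda>n. g n x) \<longlonglongrightarrow> h x"
  shows "payoff_class c h"
  unfolding payoff_class_def
proof (intro conjI allI impI)
  fix x y
  show "0 \<le> h x"
    by (rule LIMSEQ_le_const[OF lim]) (use payoff_classD(1)[OF g] in auto)
  show "h x \<le> c"
    by (rule LIMSEQ_le_const2[OF lim]) (use payoff_classD(2)[OF g] in auto)
  show "\<bar>h x - h y\<bar> \<le> c * \<bar>x - y\<bar>"
    by (rule LIMSEQ_le_const2[where X="\<lambda>n. \<bar>g n x - g n y\<bar>"])
      (use payoff_classD(3)[OF g] in \<open>auto intro!: tendsto_intros lim\<close>)
  assume "x \<le> y"
  then show "c - h y \<le> exp (y - x) * (c - h x)"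
    by (intro LIMSEQ_le[where X="\<lambda>n. c - g n y" and Y="\<lambda>n. exp (y - x) * (c - g n x)"])
      (use payoff_classD(4)[OF g] in \<open>auto intro!: tendsto_intros lim\<close>)
qed

section \<open>Averaging operators of a law on the line and their fixed points\<close>

locale real_law = prob_space Q for Q :: "real measure" +
  assumes sets_Q [measurable_cong, simp]: "sets Q = sets borel"
begin

lemma space_Q [simp]: "space Q = UNIV"
  using sets_eq_imp_space_eq[OF sets_Q] by simp

lemma prob_UNIV [simp]: "prob UNIV = 1"
  using prob_space by simp

lemma integrable_bounded:
  fixes g :: "real \<Rightarrow> real"
  assumes "g \<in> borel_measurable borel" "\<And>x. \<bar>g x\<bar> \<le> B"
  shows "integrable Q (\<lambda>y. g (x + y))"
  using assms by (intro integrable_const_bound[where B=B]) auto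

lemma integrable_class: "payoff_class c g \<Longrightarrow> integrable Q (\<lambda>y. g (x + y))"
  using payoff_classD(1,2)[of c g]
  by (intro integrable_bounded[where B=c] payoff_class_measurable) (auto simp: abs_of_nonneg)

lemma payoff_class_average:
  assumes g: "payoff_class c g" and k: "0 \<le> k" "k \<le> 1"
  shows "payoff_class c (\<lambda>x. k * (LINT y|Q. g (x + y)))"
proof -
  note int [simp] = integrable_class[OF g]
  have c: "0 \<le> c" using g by (rule payoff_class_nonneg)
  have nonneg: "0 \<le> (LINT y|Q. g (x + y))" for x
    using payoff_classD(1)[OF g] by (intro integral_nonneg_AE) auto
  have le: "(LINT y|Q. g (x + y)) \<le> c" for x
    using payoff_classD(2)[OF g] by (intro integral_le_const) auto
  have 1: "k * (LINT y|Q. g (x + y)) \<le> c" for x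
    using mult_mono[OF k(2) le[of x]] c nonneg[of x] k by simp
  have 2: "\<bar>k * (LINT y|Q. g (x + y)) - k * (LINT y|Q. g (x' + y))\<bar> \<le> c * \<bar>x - x'\<bar>" for x x'
  proof -
    have "\<bar>(LINT y|Q. g (x + y)) - (LINT y|Q. g (x' + y))\<bar> = \<bar>LINT y|Q. g (x + y) - g (x' + y)\<bar>"
      by simp
    also have "\<dots> \<le> (LINT y|Q. \<bar>g (x + y) - g (x' + y)\<bar>)"
      by (rule integral_abs_bound)
    also have "\<dots> \<le> c * \<bar>x - x'\<bar>"
    proof (rule integral_le_const)
      show "AE y in Q. \<bar>g (x + y) - g (x' + y)\<bar> \<le> c * \<bar>x - x'\<bar>"
      proof (rule AE_I2)
        fix y show "\<bar>g (x + y) - g (x' + y)\<bar> \<le> c * \<bar>x - x'\<bar>"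
          using payoff_classD(3)[OF g, of "x + y" "x' + y"] by simp
      qed
    qed auto
    finally have *: "\<bar>(LINT y|Q. g (x + y)) - (LINT y|Q. g (x' + y))\<bar> \<le> c * \<bar>x - x'\<bar>" .
    have "\<bar>k * (LINT y|Q. g (x + y)) - k * (LINT y|Q. g (x' + y))\<bar>
        = k * \<bar>(LINT y|Q. g (x + y)) - (LINT y|Q. g (x' + y))\<bar>"
      using k by (simp add: abs_mult flip: right_diff_distrib)
    also have "\<dots> \<le> 1 * \<bar>(LINT y|Q. g (x + y)) - (LINT y|Q. g (x' + y))\<bar>"
      using k by (intro mult_right_mono) auto
    finally show ?thesis using * by simp
  qed
  have 3: "c - k * (LINT y|Q. g (x' + y)) \<le> exp (x' - x) * (c - k * (LINT y|Q. g (x + y)))"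
    if "x \<le> x'" for x x'
  proof -
    have "c - (LINT y|Q. g (x' + y)) = (LINT y|Q. c - g (x' + y))" by (simp add: prob_space)
    also have "\<dots> \<le> (LINT y|Q. exp (x' - x) * (c - g (x + y)))"
    proof (rule integral_mono)
      fix y show "c - g (x' + y) \<le> exp (x' - x) * (c - g (x + y))"
        using payoff_classD(4)[OF g, of "x + y" "x' + y"] that by simp
    qed auto
    also have "\<dots> = exp (x' - x) * (c - (LINT y|Q. g (x + y)))" by (simp add: prob_space)
    finally have "k * (c - (LINT y|Q. g (x' + y))) \<le> k * (exp (x' - x) * (c - (LINT y|Q. g (x + y))))"
      using k by (intro mult_left_mono)
    \<comment> \<open>Split c - k A = k (c - A) + (1 - k) c: the mass lost to the factor
      \<open>k\<close> contributes a nonnegative constant, which satisfies the exponential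
      inequality because x \<le> x'.\<close>
    moreover have "(1 - k) * c \<le> exp (x' - x) * ((1 - k) * c)"
      using that k c mult_right_mono[of 1 "exp (x' - x)" "(1 - k) * c"] by simp
    ultimately show ?thesis by (simp add: algebra_simps)
  qed
  show ?thesis
    unfolding payoff_class_def using 1 2 3 nonneg k by auto
qed

text \<open>Comparison of a subsolution with a supersolution. The map g -> k E max (g, p) is
  monotone and shrinks one-sided differences by the factor \<open>k < 1\<close>, so the trivial
  bound u - w \<le> c improves to k^j c for every j.\<close>

lemma average_max_le:
  assumes u: "payoff_class c u" and w: "payoff_class c w" and p: "payoff_class c p"
    and sub: "\<And>x. u x \<le> k * (LINT y|Q. max (u (x + y)) (p (x + y)))"
    and sup: "\<And>x. k * (LINT y|Q. max (w (x + y)) (p (x + y))) \<le> w x"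
    and k: "0 \<le> k" "k < 1"
  shows "u x \<le> w x"
proof -
  have c: "0 \<le> c" using u by (rule payoff_class_nonneg)
  note int [simp] = integrable_class[OF payoff_class_max[OF u p]] integrable_class[OF payoff_class_max[OF w p]]
  have "u x - w x \<le> k ^ j * c" for j x
  proof (induction j arbitrary: x)
    case 0
    then show ?case using payoff_classD(2)[OF u, of x] payoff_classD(1)[OF w, of x] by simp
  next
    case (Suc j)
    have "u x - w x \<le> k * (LINT y|Q. max (u (x + y)) (p (x + y)) - max (w (x + y)) (p (x + y)))"
      using sub[of x] sup[of x] by (simp add: right_diff_distrib)
    also have "\<dots> \<le> k * (k ^ j * c)"
    proof (intro mult_left_mono integral_le_const AE_I2)
      fix y
      have "0 \<le> k ^ j * c" using k c by simp
      then show "max (u (x + y)) (p (x + y)) - max (w (x + y)) (p (x + y)) \<le> k ^ j * c"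
        using Suc[of "x + y"] by linarith
    qed (use k in auto)
    finally show ?case by simp
  qed
  moreover have "(\<lambda>j. k ^ j * c) \<longlonglongrightarrow> 0 * c"
    using k by (intro tendsto_intros LIMSEQ_realpow_zero) auto
  ultimately have "u x - w x \<le> 0"
    by (intro LIMSEQ_le_const[where X="\<lambda>j. k ^ j * c"]) auto
  then show ?thesis by simp
qed

text \<open>Monotone iteration from 0: the iterates increase and stay in the class, and dominated
  convergence turns their limit into a fixed point, which therefore inherits all bounds of the
  class.\<close>

lemma penalized_value_exists:
  assumes p: "payoff_class c p" and k: "0 \<le> k" "k \<le> 1"
  shows "\<exists>w. payoff_class c w \<and> (\<forall>x. w x = k * (LINT y|Q. max (w (x + y)) (p (x + y))))"
proof -
  define T where "T g x = k * (LINT y|Q. max (g (x + y)) (p (x + y)))" for g :: "real \<Rightarrow> real" and x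
  have T: "payoff_class c (T g)" if "payoff_class c g" for g
    unfolding T_def using payoff_class_average[OF payoff_class_max[OF that p] k] .
  have c: "0 \<le> c" using p by (rule payoff_class_nonneg)
  have zero: "payoff_class c (\<lambda>_. 0)"
    using c by (auto simp: payoff_class_def mult_le_cancel_right1)
  define g where "g j = (T ^^ j) (\<lambda>_. 0)" for j
  have g: "payoff_class c (g j)" for j
    by (induction j) (auto simp: g_def zero T)
  have step: "g j x \<le> g (Suc j) x" for j x
  proof (induction j arbitrary: x)
    case 0
    show ?case using payoff_classD(1)[OF g, of 1 x] by (simp add: g_def)
  next
    case (Suc j)
    have "T (g j) x \<le> T (g (Suc j)) x"
      unfolding T_def
    proof (intro mult_left_mono integral_mono)
      fix y show "max (g j (x + y)) (p (x + y)) \<le> max (g (Suc j) (x + y)) (p (x + y))"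
        using Suc[of "x + y"] by linarith
    qed (use k integrable_class[OF payoff_class_max[OF g p]] in auto)
    then show ?case by (simp add: g_def)
  qed
  have "convergent (\<lambda>j. g j x)" for x
  proof (rule Bseq_mono_convergent)
    show "Bseq (\<lambda>j. g j x)"
      using payoff_classD(1,2)[OF g] by (intro BseqI'[where K=c]) simp
    show "\<forall>m n. m \<le> n \<longrightarrow> g m x \<le> g n x"
      using lift_Suc_mono_le[of "\<lambda>j. g j x"] step by auto
  qed
  then obtain w where w: "\<And>x. (\<lambda>j. g j x) \<longlonglongrightarrow> w x"
    unfolding convergent_def by metis
  have "(\<lambda>j. g (Suc j) x) \<longlonglongrightarrow> T w x" for x
  proof -
    have "(\<lambda>j. LINT y|Q. max (g j (x + y)) (p (x + y))) \<longlonglongrightarrow> (LINT y|Q. max (w (x + y)) (p (x + y)))"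
    proof (rule integral_dominated_convergence[where w="\<lambda>_. c"])
      have m: "payoff_class c w" using payoff_class_lim[OF g w] .
      show "(\<lambda>y. max (w (x + y)) (p (x + y))) \<in> borel_measurable Q"
        using integrable_class[OF payoff_class_max[OF m p]] by blast
      show "(\<lambda>y. max (g j (x + y)) (p (x + y))) \<in> borel_measurable Q" for j
        using integrable_class[OF payoff_class_max[OF g p]] by blast
      show "AE y in Q. norm (max (g j (x + y)) (p (x + y))) \<le> c" for j
        using payoff_classD(1,2)[OF payoff_class_max[OF g p]] by auto
    qed (auto intro!: tendsto_max w)
    then show ?thesis unfolding g_def by (simp add: T_def tendsto_mult_left)
  qed
  then have "w x = T w x" for x
    using LIMSEQ_unique LIMSEQ_Suc[OF w] by blast
  then show ?thesis
    using payoff_class_lim[OF g w] unfolding T_def by blast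
qed

text \<open>The truncated distance min 1 |y| is integrable under every law, and
  \<open>exp_law_concentrates\<close> will make its mean small. The estimate is uniform in
  \<open>x\<close>.\<close>

lemma average_diff_le:
  fixes G :: "real \<Rightarrow> real"
  assumes G: "G \<in> borel_measurable borel" "\<And>x. \<bar>G x\<bar> \<le> L" and lip: "\<And>x y. \<bar>G x - G y\<bar> \<le> L * min 1 \<bar>x - y\<bar>"
  shows "\<bar>(LINT y|Q. G (x + y)) - G x\<bar> \<le> L * (LINT y|Q. min 1 \<bar>y\<bar>)"
proof -
  note int [simp] = integrable_bounded[OF G]
  have i1: "integrable Q (\<lambda>y. min 1 \<bar>y\<bar>)"
    by (intro integrable_const_bound[where B=1]) auto
  have "\<bar>(LINT y|Q. G (x + y)) - G x\<bar> = \<bar>LINT y|Q. G (x + y) - G x\<bar>"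
    by (simp add: prob_space)
  also have "\<dots> \<le> (LINT y|Q. \<bar>G (x + y) - G x\<bar>)"
    by (rule integral_abs_bound)
  also have "\<dots> \<le> (LINT y|Q. L * min 1 \<bar>y\<bar>)"
    using lip[of "x + y" x for y] i1 by (intro integral_mono) auto
  finally show ?thesis by simp
qed

end

section \<open>Optional times of a right-continuous filtration and the strong Markov property\<close>

lemma sets_right_limit_filtration:
  assumes "filtration \<Omega> F"
  shows "sets (right_limit_filtration \<Omega> F t) = sets (F \<infinity>) \<inter> (\<Inter>s\<in>{t<..}. sets (F s))"
proof -
  interpret filtration \<Omega> F by fact
  let ?A = "sets (F \<infinity>) \<inter> (\<Inter>s\<in>{t<..}. sets (F s))"
  have "sigma_algebra \<Omega> ?A"
    unfolding sigma_algebra_iff2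
  proof (intro conjI ballI allI impI)
    show "?A \<subseteq> Pow \<Omega>" using sets.space_closed[of "F \<infinity>"] by (auto simp: space_F)
    show "\<Omega> - s \<in> ?A" if "s \<in> ?A" for s
      using that sets.compl_sets[of s "F i" for i] by (auto simp: space_F)
  qed auto
  then show ?thesis
    unfolding right_limit_filtration_def by (rule sigma_algebra.sets_measure_of_eq)
qed

lemma space_right_limit_filtration:
  assumes "filtration \<Omega> F"
  shows "space (right_limit_filtration \<Omega> F t) = \<Omega>"
proof -
  interpret filtration \<Omega> F by fact
  show ?thesis
    unfolding right_limit_filtration_def
    using sets.space_closed[of "F \<infinity>"] by (intro space_measure_of) (auto simp: space_F)
qed

lemma filtration_right_limit:
  assumes "filtration \<Omega> F"
  shows "filtration \<Omega> (right_limit_filtration \<Omega> F)"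
  by standard (auto simp: sets_right_limit_filtration[OF assms] space_right_limit_filtration[OF assms])

lemma sets_right_limit_filtrationI:
  assumes F: "filtration \<Omega> F" and t: "t < \<infinity>" and A: "\<And>s. t < s \<Longrightarrow> A \<in> sets (F s)"
  shows "A \<in> sets (right_limit_filtration \<Omega> F t)"
  unfolding sets_right_limit_filtration[OF F] using A t by auto

text \<open>{S \<le> t} is a decreasing intersection of events {S < q} with q tending to t from
  above, and these q can be kept below or at any prescribed s > t. Hence strict inequalities at
  finite times suffice.\<close>

lemma stopping_time_right_limitI:
  fixes F :: "ennreal \<Rightarrow> 'a measure"
  assumes F: "filtration \<Omega> F"
    and S: "\<And>q::real. q > 0 \<Longrightarrow> {\<omega>\<in>\<Omega>. S \<omega> < ennreal q} \<in> sets (F (ennreal q))"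
  shows "stopping_time (right_limit_filtration \<Omega> F) S"
proof
  fix t
  interpret filtration \<Omega> F by fact
  have "{\<omega>\<in>\<Omega>. S \<omega> \<le> t} \<in> sets (right_limit_filtration \<Omega> F t)"
  proof (cases "t = \<infinity>")
    case True
    then show ?thesis
      using sets.top[of "right_limit_filtration \<Omega> F t"] by (simp add: space_right_limit_filtration[OF F])
  next
    case False
    then obtain t' where t': "t = ennreal t'" "0 \<le> t'" by (cases t rule: ennreal_cases) auto
    show ?thesis
    proof (rule sets_right_limit_filtrationI[OF F])
      show "t < \<infinity>" using False by (simp add: less_top)
      fix s assume s: "t < s"
      obtain d where d: "d > 0" "ennreal (t' + d) \<le> s"
      proof (cases s rule: ennreal_cases)
        case (real s')
        then have "t' < s'" using s t' by (simp add: ennreal_less_iff)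
        then show ?thesis using that[of "s' - t'"] real by simp
      qed (use that[of 1] in auto)
      let ?q = "\<lambda>n::nat. t' + d / (real n + 1)"
      have q: "?q n > 0" "ennreal (?q n) \<le> s" for n
      proof -
        show "?q n > 0" using d t' by (intro add_nonneg_pos divide_pos_pos) auto
        have "d / (real n + 1) \<le> d" using d by (simp add: field_simps)
        then have "ennreal (?q n) \<le> ennreal (t' + d)" by (intro ennreal_leI) simp
        then show "ennreal (?q n) \<le> s" using d(2) by (rule order_trans)
      qed
      have "{\<omega>\<in>\<Omega>. S \<omega> \<le> t} = (\<Inter>n. {\<omega>\<in>\<Omega>. S \<omega> < ennreal (?q n)})"
      proof (intro set_eqI iffI)
        fix \<omega> assume "\<omega> \<in> {\<omega>\<in>\<Omega>. S \<omega> \<le> t}"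
        moreover have "t < ennreal (?q n)" for n
          using d t' by (simp add: ennreal_less_iff add_nonneg_pos)
        ultimately show "\<omega> \<in> (\<Inter>n. {\<omega>\<in>\<Omega>. S \<omega> < ennreal (?q n)})"
          by (auto intro: le_less_trans)
      next
        fix \<omega> assume \<omega>: "\<omega> \<in> (\<Inter>n. {\<omega>\<in>\<Omega>. S \<omega> < ennreal (?q n)})"
        have "(\<lambda>n. ennreal (?q n)) \<longlonglongrightarrow> ennreal (t' + 0)"
          by (intro tendsto_ennrealI tendsto_add tendsto_const) real_asymp
        then have "S \<omega> \<le> ennreal (t' + 0)"
          using \<omega> by (intro LIMSEQ_le_const) (auto intro: less_imp_le)
        then show "\<omega> \<in> {\<omega>\<in>\<Omega>. S \<omega> \<le> t}" using \<omega> t' by auto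
      qed
      also have "\<dots> \<in> sets (F s)"
        using S[OF q(1)] sets_F_mono[OF q(2)] by (intro sets.countable_INT) auto
      finally show "{\<omega>\<in>\<Omega>. S \<omega> \<le> t} \<in> sets (F s)" .
    qed
  qed
  then show "Measurable.pred (right_limit_filtration \<Omega> F t) (\<lambda>x. S x \<le> t)"
    by (simp add: pred_def space_right_limit_filtration[OF F])
qed

lemma stopping_time_SUP:
  fixes S :: "nat \<Rightarrow> 'a \<Rightarrow> 't::{complete_linorder}"
  assumes "\<And>k. stopping_time F (S k)"
  shows "stopping_time F (\<lambda>\<omega>. SUP k. S k \<omega>)"
  using assms unfolding stopping_time_def SUP_le_iff by (auto intro!: pred_intros_countable)

text \<open>Countably many times and the strict inequality make {S < q} a countable union of events
  at times before \<open>q\<close>, whatever the paths look like. The infimum over the empty set is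
  infinity.\<close>

definition crossing_time :: "(real \<Rightarrow> 'a \<Rightarrow> real) \<Rightarrow> real set \<Rightarrow> real \<Rightarrow> 'a \<Rightarrow> ennreal" where
  "crossing_time X D a \<omega> = (INF t\<in>{t\<in>D. X t \<omega> < a}. ennreal t)"

text \<open>The filtration is arbitrary because two are in play: \<open>F\<close>, where the strong
  Markov property holds, and the completed filtration generated by the price, where admissibility is
  decided.\<close>

lemma stopping_time_crossing:
  assumes F: "filtration \<Omega> F" and D: "countable D" "D \<subseteq> {0..}"
    and X: "\<And>t. t \<ge> 0 \<Longrightarrow> X t \<in> borel_measurable (F (ennreal t))"
  shows "stopping_time (right_limit_filtration \<Omega> F) (crossing_time X D a)"
proof (rule stopping_time_right_limitI[OF F])
  interpret filtration \<Omega> F by fact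
  fix q :: real assume "q > 0"
  have "{\<omega>\<in>\<Omega>. crossing_time X D a \<omega> < ennreal q} = (\<Union>t\<in>{t\<in>D. t < q}. {\<omega>\<in>space (F (ennreal t)). X t \<omega> < a})"
    using D(2) \<open>q > 0\<close> unfolding crossing_time_def INF_less_iff space_F
    by (auto simp: ennreal_less_iff subset_eq)
  also have "\<dots> \<in> sets (F (ennreal q))"
  proof (intro sets.countable_UN'')
    show "countable {t \<in> D. t < q}" using D(1) by (rule countable_subset[rotated]) auto
    fix t assume t: "t \<in> {t \<in> D. t < q}"
    then have [measurable]: "X t \<in> borel_measurable (F (ennreal t))" using X D(2) by auto
    have "{\<omega>\<in>space (F (ennreal t)). X t \<omega> < a} \<in> sets (F (ennreal t))" by measurable
    moreover have "sets (F (ennreal t)) \<subseteq> sets (F (ennreal q))"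
      using t by (intro sets_F_mono ennreal_leI) simp
    ultimately show "{\<omega>\<in>space (F (ennreal t)). X t \<omega> < a} \<in> sets (F (ennreal q))" by blast
  qed
  finally show "{\<omega>\<in>\<Omega>. crossing_time X D a \<omega> < ennreal q} \<in> sets (F (ennreal q))" .
qed

text \<open>The value 0 at infinity is the reward of never stopping. For a = 0 this is the indicator
  of finite times, which lets deterministic times enter the same formulas undiscounted.\<close>

definition disc :: "real \<Rightarrow> ennreal \<Rightarrow> real" where
  "disc a s = (if s = \<infinity> then 0 else exp (- a * enn2real s))"

lemma disc_nonneg [simp]: "0 \<le> disc a s" and disc_le_1: "0 \<le> a \<Longrightarrow> disc a s \<le> 1"
  by (auto simp: disc_def)

lemma disc_measurable [measurable]: "disc a \<in> borel_measurable borel"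
  unfolding disc_def[abs_def] by measurable

text \<open>With \<open>shifted_law\<close> as transition function, the strong Markov property makes
  X at S + t, given the past of S, a copy of X at t translated by X at S. Increments are stationary
  and independent of the past, whence the name.\<close>

locale strong_levy = prob_space M + filtration "space M" F
  for M :: "'a measure" and F :: "ennreal \<Rightarrow> 'a measure" +
  fixes X :: "real \<Rightarrow> 'a \<Rightarrow> real"
  assumes sub: "\<And>t. sets (F t) \<subseteq> sets M"
    and strong_markov: "strong_markov_process M F (shifted_law M X) X"
    and start: "AE \<omega> in M. X 0 \<omega> = 0"
    and right_cont_0: "AE \<omega> in M. ((\<lambda>t. X t \<omega>) \<longlongrightarrow> X 0 \<omega>) (at_right 0)"
begin

abbreviation optional_time :: "('a \<Rightarrow> ennreal) \<Rightarrow> bool" where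
  "optional_time S \<equiv> stopping_time (right_limit_filtration (space M) F) S"

text \<open>On \<open>S = \<infinity>\<close> this is the junk value \<open>X\<^sub>0\<close>, which the factor \<open>disc r S = 0\<close> annihilates.\<close>

definition XS :: "('a \<Rightarrow> ennreal) \<Rightarrow> 'a \<Rightarrow> real" where
  "XS S \<omega> = X (enn2real (S \<omega>)) \<omega>"

lemma filt: "filtration (space M) F" ..

lemma filt_right: "filtration (space M) (right_limit_filtration (space M) F)"
  by (rule filtration_right_limit[OF filt])

lemma sets_right_sub: "sets (right_limit_filtration (space M) F t) \<subseteq> sets M"
  unfolding sets_right_limit_filtration[OF filt] using sub by auto

lemma optional_measurable: "optional_time S \<Longrightarrow> S \<in> borel_measurable M"
  by (rule measurable_stopping_time[OF _ sets_right_sub]) (auto simp: space_right_limit_filtration[OF filt])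

lemma progressive: "t \<ge> 0 \<Longrightarrow>
    (\<lambda>(s, \<omega>). X s \<omega>) \<in> restrict_space borel {0..t} \<Otimes>\<^sub>M F (ennreal t) \<rightarrow>\<^sub>M borel"
  using strong_markov unfolding strong_markov_process_def progressively_measurable_def by blast

lemma adapted: "t \<ge> 0 \<Longrightarrow> X t \<in> borel_measurable (F (ennreal t))"
proof -
  assume t: "t \<ge> 0"
  have "(\<lambda>\<omega>. (t, \<omega>)) \<in> F (ennreal t) \<rightarrow>\<^sub>M restrict_space borel {0..t} \<Otimes>\<^sub>M F (ennreal t)"
    using t by (intro measurable_Pair measurable_ident measurable_const) (auto simp: space_restrict_space)
  from measurable_compose[OF this progressive[OF t]] show ?thesis by simp
qed

lemma X_measurable: "t \<ge> 0 \<Longrightarrow> X t \<in> borel_measurable M"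
  using adapted[of t] sub[of "ennreal t"] by (auto simp: measurable_def space_F)

text \<open>Progressive measurability concerns bounded time intervals, so time is cut off at
  \<open>n\<close>; at each point the cut-off is eventually inactive. The \<open>max 0\<close>
  extends the process to the whole line, over which times are integrated later.\<close>

lemma joint_measurable: "(\<lambda>(s, \<omega>). X (max 0 s) \<omega>) \<in> borel_measurable (borel \<Otimes>\<^sub>M M)"
proof -
  have *: "(\<lambda>z. X (min (real n) (max 0 (fst z))) (snd z)) \<in> borel_measurable (borel \<Otimes>\<^sub>M M)" for n :: nat
  proof -
    have "(\<lambda>z. (min (real n) (max 0 (fst z)), snd z)) \<in> borel \<Otimes>\<^sub>M M
        \<rightarrow>\<^sub>M restrict_space borel {0..real n} \<Otimes>\<^sub>M F (ennreal (real n))"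
    proof (intro measurable_Pair measurable_restrict_space2)
      have "(\<lambda>\<omega>. \<omega>) \<in> M \<rightarrow>\<^sub>M F (ennreal (real n))"
        using sub by (auto simp: measurable_def space_F dest: sets.sets_into_space)
      then have "(\<lambda>z. (\<lambda>\<omega>. \<omega>) (snd z)) \<in> (borel :: real measure) \<Otimes>\<^sub>M M \<rightarrow>\<^sub>M F (ennreal (real n))"
        by (rule measurable_compose[OF measurable_snd])
      then show "snd \<in> (borel :: real measure) \<Otimes>\<^sub>M M \<rightarrow>\<^sub>M F (ennreal (real n))" by simp
    qed auto
    from measurable_compose[OF this progressive[of "real n"]] show ?thesis by (simp add: comp_def)
  qed
  have "(\<lambda>z. X (max 0 (fst z)) (snd z)) \<in> borel_measurable (borel \<Otimes>\<^sub>M M)"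
  proof (rule borel_measurable_LIMSEQ_real[OF _ *])
    fix z :: "real \<times> 'a"
    obtain N :: nat where N: "max 0 (fst z) \<le> real N" using real_arch_simple by blast
    have "min (real n) (max 0 (fst z)) = max 0 (fst z)" if "n \<ge> N" for n
      using order_trans[OF N, of "real n"] that by (intro min_absorb2) simp
    then show "(\<lambda>n. X (min (real n) (max 0 (fst z))) (snd z)) \<longlonglongrightarrow> X (max 0 (fst z)) (snd z)"
      by (intro tendsto_eventually eventually_sequentiallyI[of N]) simp
  qed
  then show ?thesis by (simp add: case_prod_beta')
qed

lemma X_compose_measurable:
  assumes [measurable]: "f \<in> borel_measurable N" "g \<in> N \<rightarrow>\<^sub>M M" 
  shows "(\<lambda>z. X (max 0 (f z)) (g z)) \<in> borel_measurable N"
  using measurable_compose[OF measurable_Pair[OF assms] joint_measurable] by simp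

lemma XS_measurable: "optional_time S \<Longrightarrow> XS S \<in> borel_measurable M"
proof -
  assume "optional_time S"
  note [measurable] = optional_measurable[OF this]
  have "(\<lambda>\<omega>. X (max 0 (enn2real (S \<omega>))) \<omega>) \<in> borel_measurable M"
    by (rule X_compose_measurable) auto
  then show ?thesis by (simp add: XS_def[abs_def])
qed

text \<open>Two laws are compared, which takes the property from indicators to all nonnegative
  functions: under the measure weighted with the discount, X at S + t is distributed like X at S
  plus an independent copy of X at t. The weight removes the event S = infinity, about which the
  Markov property is silent.\<close>

lemma strong_markov_nn_integral:
  assumes S: "optional_time S" and t: "0 \<le> t" and a: "0 \<le> a" and [measurable]: "\<psi> \<in> borel_measurable borel"
  shows "(\<integral>\<^sup>+\<omega>. ennreal (disc a (S \<omega>)) * \<psi> (X (enn2real (S \<omega>) + t) \<omega>) \<partial>M)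
    = (\<integral>\<^sup>+\<omega>. ennreal (disc a (S \<omega>)) * (\<integral>\<^sup>+\<omega>'. \<psi> (XS S \<omega> + X t \<omega>') \<partial>M) \<partial>M)"
proof -
  let ?G = "filtration.pre_sigma (space M) (right_limit_filtration (space M) F) S"
  interpret R: filtration "space M" "right_limit_filtration (space M) F" by (rule filt_right)
  have subalg: "subalgebra M ?G"
    unfolding subalgebra_def
  proof (intro conjI subsetI)
    fix A assume "A \<in> sets ?G"
    then have "{\<omega>\<in>A. S \<omega> \<le> \<infinity>} \<in> sets (right_limit_filtration (space M) F \<infinity>)"
      by (rule R.sets_pre_sigmaD[OF S])
    then show "A \<in> sets M" using sets_right_sub by auto
  qed (simp add: R.space_pre_sigma)
  interpret C: finite_measure_subalgebra M ?G
    by standard (rule subalg)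
  note [measurable] = optional_measurable[OF S] XS_measurable[OF S] X_measurable[OF t]
  have SG: "S \<in> borel_measurable ?G" by (rule R.measurable_stopping_time_pre_sigma[OF S])
  have ZG: "(\<lambda>\<omega>. disc a (S \<omega>)) \<in> borel_measurable ?G"
    by (rule measurable_compose[OF SG disc_measurable])
  define Y where "Y \<omega> = X (enn2real (S \<omega>) + t) \<omega>" for \<omega>
  have [measurable]: "Y \<in> borel_measurable M"
  proof -
    have "(\<lambda>\<omega>. X (max 0 (enn2real (S \<omega>) + t)) \<omega>) \<in> borel_measurable M"
      by (rule X_compose_measurable) auto
    then show ?thesis using t by (simp add: Y_def[abs_def])
  qed
  define N where "N = density M (\<lambda>\<omega>. ennreal (disc a (S \<omega>)))"
  have [measurable_cong]: "sets N = sets M" by (simp add: N_def)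
  have "distr N borel Y = distr (N \<Otimes>\<^sub>M M) borel (\<lambda>(\<omega>, \<omega>'). XS S \<omega> + X t \<omega>')"
  proof (rule measure_eqI)
    fix B assume "B \<in> sets (distr N borel Y)"
    then have B [measurable]: "B \<in> sets borel" by simp
    have law: "measure (shifted_law M X t x) B = measure M ((\<lambda>\<omega>'. x + X t \<omega>') -` B \<inter> space M)" for x
      unfolding shifted_law_def by (subst measure_distr) auto
    have law_meas [measurable]: "(\<lambda>x. measure M ((\<lambda>\<omega>'. x + X t \<omega>') -` B \<inter> space M)) \<in> borel_measurable borel"
    proof -
      have "(\<lambda>x. enn2real (emeasure M (Pair x -` {z\<in>space (borel \<Otimes>\<^sub>M M). fst z + X t (snd z) \<in> B})))
          \<in> borel_measurable borel"
        by (intro measurable_compose[OF measurable_emeasure_Pair borel_measurable_enn2real]) measurable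
      moreover have "Pair x -` {z\<in>space (borel \<Otimes>\<^sub>M M). fst z + X t (snd z) \<in> B}
          = (\<lambda>\<omega>'. x + X t \<omega>') -` B \<inter> space M" for x :: real
        by (auto simp: space_pair_measure)
      ultimately show ?thesis by (simp add: measure_def)
    qed
    have "AE \<omega> in M. S \<omega> < \<infinity> \<longrightarrow>
          real_cond_exp M ?G (\<lambda>\<omega>'. indicator B (Y \<omega>')) \<omega> = measure (shifted_law M X t (XS S \<omega>)) B"
      using strong_markov S t B unfolding strong_markov_process_def XS_def Y_def by blast
    then have ae: "AE \<omega> in M. disc a (S \<omega>) * real_cond_exp M ?G (\<lambda>\<omega>'. indicator B (Y \<omega>')) \<omega>
        = disc a (S \<omega>) * measure M ((\<lambda>\<omega>'. XS S \<omega> + X t \<omega>') -` B \<inter> space M)"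
      unfolding law by (rule AE_mp) (auto simp: disc_def less_top)
    have int1: "integrable M (\<lambda>\<omega>. disc a (S \<omega>) * indicator B (Y \<omega>))"
      using a by (intro integrable_const_bound[where B=1]) (auto simp: disc_le_1 indicator_def)
    have int2: "integrable M (\<lambda>\<omega>. disc a (S \<omega>) * measure M ((\<lambda>\<omega>'. XS S \<omega> + X t \<omega>') -` B \<inter> space M))"
      using a by (intro integrable_const_bound[where B=1]) (auto simp: disc_le_1 mult_le_one)
    have "emeasure (distr N borel Y) B = (\<integral>\<^sup>+\<omega>. ennreal (disc a (S \<omega>)) * indicator B (Y \<omega>) \<partial>M)"
      by (simp add: emeasure_distr N_def emeasure_density) (auto intro!: nn_integral_cong simp: indicator_def)
    also have "\<dots> = (\<integral>\<^sup>+\<omega>. ennreal (disc a (S \<omega>) * indicator B (Y \<omega>)) \<partial>M)"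
      by (intro nn_integral_cong) (auto simp: indicator_def)
    also have "\<dots> = ennreal (LINT \<omega>|M. disc a (S \<omega>) * indicator B (Y \<omega>))"
      using int1 by (intro nn_integral_eq_integral) auto
    also have "(LINT \<omega>|M. disc a (S \<omega>) * indicator B (Y \<omega>))
        = (LINT \<omega>|M. disc a (S \<omega>) * real_cond_exp M ?G (\<lambda>\<omega>'. indicator B (Y \<omega>')) \<omega>)"
      using int1 ZG by (intro C.real_cond_exp_intg(2)[symmetric]) auto
    also have "\<dots> = (LINT \<omega>|M. disc a (S \<omega>) * measure M ((\<lambda>\<omega>'. XS S \<omega> + X t \<omega>') -` B \<inter> space M))"
      using ae by (intro integral_cong_AE) auto
    also have "ennreal \<dots> = (\<integral>\<^sup>+\<omega>. ennreal (disc a (S \<omega>) * measure M ((\<lambda>\<omega>'. XS S \<omega> + X t \<omega>') -` B \<inter> space M)) \<partial>M)"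
      using int2 by (intro nn_integral_eq_integral[symmetric]) auto
    also have "\<dots> = (\<integral>\<^sup>+\<omega>. emeasure M ((\<lambda>\<omega>'. XS S \<omega> + X t \<omega>') -` B \<inter> space M) \<partial>N)"
      unfolding N_def by (subst nn_integral_density) (auto simp: emeasure_eq_measure ennreal_mult)
    also have "\<dots> = emeasure (distr (N \<Otimes>\<^sub>M M) borel (\<lambda>(\<omega>, \<omega>'). XS S \<omega> + X t \<omega>')) B"
      by (subst emeasure_distr, measurable, subst emeasure_pair_measure_alt, measurable)
        (auto intro!: nn_integral_cong arg_cong[where f="emeasure M"] simp: space_pair_measure N_def)
    finally show "emeasure (distr N borel Y) B
        = emeasure (distr (N \<Otimes>\<^sub>M M) borel (\<lambda>(\<omega>, \<omega>'). XS S \<omega> + X t \<omega>')) B" .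
  qed simp
  then have "nn_integral (distr N borel Y) \<psi>
      = nn_integral (distr (N \<Otimes>\<^sub>M M) borel (\<lambda>(\<omega>, \<omega>'). XS S \<omega> + X t \<omega>')) \<psi>" by simp
  also have "nn_integral (distr N borel Y) \<psi> = (\<integral>\<^sup>+\<omega>. ennreal (disc a (S \<omega>)) * \<psi> (Y \<omega>) \<partial>M)"
    by (simp add: nn_integral_distr N_def nn_integral_density)
  also have "nn_integral (distr (N \<Otimes>\<^sub>M M) borel (\<lambda>(\<omega>, \<omega>'). XS S \<omega> + X t \<omega>')) \<psi>
      = (\<integral>\<^sup>+z. \<psi> (XS S (fst z) + X t (snd z)) \<partial>(N \<Otimes>\<^sub>M M))"
    by (simp add: nn_integral_distr case_prod_beta')
  also have "\<dots> = (\<integral>\<^sup>+\<omega>. (\<integral>\<^sup>+\<omega>'. \<psi> (XS S \<omega> + X t \<omega>') \<partial>M) \<partial>N)"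
    by (subst nn_integral_fst[symmetric]) auto
  also have "\<dots> = (\<integral>\<^sup>+\<omega>. ennreal (disc a (S \<omega>)) * (\<integral>\<^sup>+\<omega>'. \<psi> (XS S \<omega> + X t \<omega>') \<partial>M) \<partial>M)"
    unfolding N_def by (subst nn_integral_density) auto
  finally show ?thesis by (simp add: Y_def)
qed

end

section \<open>The process at an independent exponential time\<close>

lemma exponential_density_nn_shift:
  assumes q: "q > 0" and p [measurable]: "p \<in> borel_measurable borel"
  shows "(\<integral>\<^sup>+t. ennreal (exponential_density q t) * p (s + t) \<partial>lborel)
    = (\<integral>\<^sup>+u. ennreal (exponential_density q (u - s)) * p u \<partial>lborel)"
  by (subst (2) nn_integral_real_affine[where c=1 and t=s]) (auto simp: ac_simps)

text \<open>The density of a sum of two independent exponential times of rates r and r + l. On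
  [0, u] the integrand is a constant times e^(l s).\<close>

lemma exponential_density_convolution:
  assumes r: "r > 0" and l: "l > 0" and u: "u \<ge> 0"
  shows "(\<integral>\<^sup>+s. ennreal (exponential_density r s) * ennreal (exponential_density (r + l) (u - s)) \<partial>lborel)
    = ennreal (r * (r + l) * (exp (- r * u) - exp (- (r + l) * u)) / l)"
proof -
  let ?q = "r + l"
  have "(\<integral>\<^sup>+s. ennreal (exponential_density r s) * ennreal (exponential_density ?q (u - s)) \<partial>lborel)
      = (\<integral>\<^sup>+s. ennreal (r * ?q * exp (- ?q * u) * exp (l * s)) * indicator {0..u} s \<partial>lborel)"
    using r l by (intro nn_integral_cong)
      (auto simp: exponential_density_def indicator_def algebra_simps simp flip: exp_add ennreal_mult)
  also have "\<dots> = ennreal (r * ?q * exp (- ?q * u) * exp (l * u) / l - r * ?q * exp (- ?q * u) * exp (l * 0) / l)"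
    using r l u by (intro nn_integral_FTC_Icc) (auto intro!: derivative_eq_intros simp: field_simps)
  also have "r * ?q * exp (- ?q * u) * exp (l * u) / l - r * ?q * exp (- ?q * u) * exp (l * 0) / l
      = r * ?q * (exp (- r * u) - exp (- ?q * u)) / l"
  proof -
    have "exp (- ?q * u) * exp (l * u) = exp (- r * u)"
      by (simp add: algebra_simps flip: exp_add)
    then show ?thesis by (simp add: diff_divide_distrib right_diff_distrib mult.assoc)
  qed
  finally show ?thesis .
qed

text \<open>The resolvent equation U_r = U_(r+l) + l U_r U_(r+l) for translations of the half-line,
  multiplied by r (r + l) because exponential densities have mass 1. The form without subtraction
  makes sense in \<open>ennreal\<close>.\<close>

lemma exponential_resolvent:
  assumes r: "r > 0" and l: "l > 0" and p [measurable]: "p \<in> borel_measurable borel"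
  shows "ennreal l * (\<integral>\<^sup>+s. ennreal (exponential_density r s) *
        (\<integral>\<^sup>+t. ennreal (exponential_density (r + l) t) * p (s + t) \<partial>lborel) \<partial>lborel)
      + ennreal r * (\<integral>\<^sup>+u. ennreal (exponential_density (r + l) u) * p u \<partial>lborel)
    = ennreal (r + l) * (\<integral>\<^sup>+u. ennreal (exponential_density r u) * p u \<partial>lborel)"
proof -
  let ?q = "r + l"
  let ?e = "\<lambda>a t. ennreal (exponential_density a t)"
  have q: "?q > 0" using r l by simp
  let ?C = "\<lambda>u. \<integral>\<^sup>+s. ?e r s * ?e ?q (u - s) \<partial>lborel"
  \<comment> \<open>The identity already holds between the densities that multiply
    \<open>p u\<close>.\<close>
  have C: "ennreal l * ?C u + ennreal r * ?e ?q u = ennreal ?q * ?e r u" for u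
  proof (cases "u \<ge> 0")
    case True
    have "exp (- ?q * u) \<le> exp (- r * u)" using True r l by (simp add: algebra_simps)
    define E1 E2 where "E1 = exp (- r * u)" and "E2 = exp (- ?q * u)"
    define A where "A = r * ?q * (E1 - E2) / l"
    have A: "0 \<le> A" using \<open>exp (- ?q * u) \<le> exp (- r * u)\<close> r l by (simp add: A_def E1_def E2_def)
    have "?C u = ennreal A"
      unfolding A_def E1_def E2_def by (rule exponential_density_convolution[OF r l True])
    then have "ennreal l * ?C u + ennreal r * ?e ?q u = ennreal (l * A + r * exponential_density ?q u)"
      using A r l q by (simp add: ennreal_mult ennreal_plus exponential_density_nonneg)
    also have "l * A + r * exponential_density ?q u = ?q * exponential_density r u"
    proof -
      have "exponential_density ?q u = ?q * E2" "exponential_density r u = r * E1"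
        using True by (simp_all add: exponential_density_def E1_def E2_def algebra_simps)
      moreover have "l * A = r * ?q * (E1 - E2)" using l by (simp add: A_def)
      ultimately show ?thesis by (simp add: algebra_simps)
    qed
    finally show ?thesis using r l by (simp add: ennreal_mult exponential_density_nonneg)
  next
    case False
    then have "?C u = (\<integral>\<^sup>+s. 0 \<partial>(lborel :: real measure))"
      by (intro nn_integral_cong) (auto simp: exponential_density_def)
    then show ?thesis using False by (simp add: exponential_density_def)
  qed
  have "(\<integral>\<^sup>+s. ?e r s * (\<integral>\<^sup>+t. ?e ?q t * p (s + t) \<partial>lborel) \<partial>lborel)
      = (\<integral>\<^sup>+s. (\<integral>\<^sup>+u. ?e r s * (?e ?q (u - s) * p u) \<partial>lborel) \<partial>lborel)"
    unfolding exponential_density_nn_shift[OF q p] by (subst nn_integral_cmult) auto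
  also have "\<dots> = (\<integral>\<^sup>+u. (\<integral>\<^sup>+s. ?e r s * (?e ?q (u - s) * p u) \<partial>lborel) \<partial>lborel)"
    by (rule lborel_pair.Fubini') measurable
  also have "\<dots> = (\<integral>\<^sup>+u. ?C u * p u \<partial>lborel)"
    by (intro nn_integral_cong) (simp add: nn_integral_multc flip: mult.assoc)
  finally have "ennreal l * (\<integral>\<^sup>+s. ?e r s * (\<integral>\<^sup>+t. ?e ?q t * p (s + t) \<partial>lborel) \<partial>lborel)
      + ennreal r * (\<integral>\<^sup>+u. ?e ?q u * p u \<partial>lborel)
      = (\<integral>\<^sup>+u. (ennreal l * ?C u + ennreal r * ?e ?q u) * p u \<partial>lborel)"
    by (simp add: nn_integral_add nn_integral_cmult distrib_right mult.assoc)
  then show ?thesis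
    unfolding C by (simp add: nn_integral_cmult mult.assoc)
qed

context strong_levy
begin

text \<open>Averaging over this law is \<open>q\<close> times the \<open>q\<close>-resolvent of X.
  The \<open>max 0\<close> is harmless, the density being 0 at negative times.\<close>

definition exp_law :: "real \<Rightarrow> real measure" where
  "exp_law q = distr (density lborel (exponential_density q) \<Otimes>\<^sub>M M) borel (\<lambda>(t, \<omega>). X (max 0 t) \<omega>)"

lemma real_law_exp_law: "q > 0 \<Longrightarrow> real_law (exp_law q)"
proof -
  assume "q > 0"
  then interpret E: prob_space "density lborel (exponential_density q)"
    by (rule prob_space_exponential_density)
  interpret P: pair_prob_space "density lborel (exponential_density q)" M ..
  have "(\<lambda>(t, \<omega>). X (max 0 t) \<omega>) \<in> borel_measurable (density lborel (exponential_density q) \<Otimes>\<^sub>M M)"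
    using joint_measurable by (rule measurable_cong_sets[THEN equalityD1, THEN subsetD, rotated 2])
      (auto intro!: sets_pair_measure_cong)
  then show ?thesis
    unfolding exp_law_def by (intro real_law.intro P.prob_space_distr real_law_axioms.intro) auto
qed

lemma sets_exp_law [measurable_cong, simp]: "sets (exp_law q) = sets borel"
  by (simp add: exp_law_def)

lemma space_exp_law [simp]: "space (exp_law q) = UNIV"
  by (simp add: exp_law_def)

lemma nn_integral_exp_law:
  assumes q: "q > 0" and [measurable]: "\<psi> \<in> borel_measurable borel"
  shows "(\<integral>\<^sup>+y. \<psi> y \<partial>exp_law q)
    = (\<integral>\<^sup>+t. ennreal (exponential_density q t) * (\<integral>\<^sup>+\<omega>. \<psi> (X (max 0 t) \<omega>) \<partial>M) \<partial>lborel)"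
proof -
  note [measurable] = joint_measurable
  have sets: "sets (density lborel (exponential_density q) \<Otimes>\<^sub>M M) = sets (borel \<Otimes>\<^sub>M M)"
    by (intro sets_pair_measure_cong) auto
  have [measurable]: "(\<lambda>(t, \<omega>). X (max 0 t) \<omega>) \<in> borel_measurable (density lborel (exponential_density q) \<Otimes>\<^sub>M M)"
    unfolding measurable_cong_sets[OF sets refl] by measurable
  have [measurable]: "(\<lambda>z. X (max 0 (fst z)) (snd z)) \<in> borel_measurable (borel \<Otimes>\<^sub>M M)"
    using joint_measurable by (simp add: case_prod_beta')
  have "(\<integral>\<^sup>+y. \<psi> y \<partial>exp_law q)
      = (\<integral>\<^sup>+z. \<psi> (X (max 0 (fst z)) (snd z)) \<partial>(density lborel (exponential_density q) \<Otimes>\<^sub>M M))"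
    unfolding exp_law_def by (subst nn_integral_distr) (auto simp: case_prod_beta')
  also have "\<dots> = (\<integral>\<^sup>+t. (\<integral>\<^sup>+\<omega>. \<psi> (X (max 0 t) \<omega>) \<partial>M) \<partial>density lborel (exponential_density q))"
    by (subst nn_integral_fst[symmetric]) (auto simp: measurable_cong_sets[OF sets refl])
  also have "\<dots> = (\<integral>\<^sup>+t. ennreal (exponential_density q t) * (\<integral>\<^sup>+\<omega>. \<psi> (X (max 0 t) \<omega>) \<partial>M) \<partial>lborel)"
    by (subst nn_integral_density) auto
  finally show ?thesis .
qed

text \<open>On the left an independent copy is averaged, on the right the path of X itself after
  \<open>S\<close>. The strong Markov property is applied at each fixed delay \<open>t\<close> and
  integrated over \<open>t\<close>, with Fubini before and after.\<close>

lemma strong_markov_exp_law: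
  assumes S: "optional_time S" and a: "0 \<le> a" and q: "0 < q" and [measurable]: "\<psi> \<in> borel_measurable borel"
  shows "(\<integral>\<^sup>+\<omega>. ennreal (disc a (S \<omega>)) * (\<integral>\<^sup>+y. \<psi> (XS S \<omega> + y) \<partial>exp_law q) \<partial>M)
    = (\<integral>\<^sup>+\<omega>. ennreal (disc a (S \<omega>)) *
        (\<integral>\<^sup>+t. ennreal (exponential_density q t) * \<psi> (X (enn2real (S \<omega>) + max 0 t) \<omega>) \<partial>lborel) \<partial>M)"
proof -
  note [measurable] = optional_measurable[OF S] XS_measurable[OF S]
  interpret P: pair_sigma_finite lborel M ..
  let ?d = "\<lambda>\<omega>. ennreal (disc a (S \<omega>))" and ?e = "\<lambda>t. ennreal (exponential_density q t)"
  have X1 [measurable]: "(\<lambda>z. X (max 0 (fst z)) (snd (snd z))) \<in> borel_measurable (borel \<Otimes>\<^sub>M M \<Otimes>\<^sub>M M)"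
    by (rule X_compose_measurable) auto
  have X2: "(\<lambda>z. X (max 0 (enn2real (S (snd z)) + max 0 (fst z))) (snd z)) \<in> borel_measurable (borel \<Otimes>\<^sub>M M)"
    by (rule X_compose_measurable) auto
  have X2 [measurable]: "(\<lambda>z. X (enn2real (S (snd z)) + max 0 (fst z)) (snd z)) \<in> borel_measurable (borel \<Otimes>\<^sub>M M)"
    using X2 by (simp add: max_absorb2)
  have X3 [measurable]: "(\<lambda>z. X (max 0 (snd (fst z))) (snd z)) \<in> borel_measurable ((M \<Otimes>\<^sub>M borel) \<Otimes>\<^sub>M M)"
    by (rule X_compose_measurable) auto
  have X4 [measurable]: "(\<lambda>z. X (max 0 (fst (fst z))) (snd z)) \<in> borel_measurable ((borel \<Otimes>\<^sub>M M) \<Otimes>\<^sub>M M)"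
    by (rule X_compose_measurable) auto
  have "(\<integral>\<^sup>+\<omega>. ?d \<omega> * (\<integral>\<^sup>+y. \<psi> (XS S \<omega> + y) \<partial>exp_law q) \<partial>M)
      = (\<integral>\<^sup>+\<omega>. (\<integral>\<^sup>+t. ?d \<omega> * (?e t * (\<integral>\<^sup>+\<omega>'. \<psi> (XS S \<omega> + X (max 0 t) \<omega>') \<partial>M)) \<partial>lborel) \<partial>M)"
  proof (rule nn_integral_cong)
    fix \<omega> assume \<omega> [measurable]: "\<omega> \<in> space M"
    have "(\<lambda>t. \<integral>\<^sup>+\<omega>'. \<psi> (XS S \<omega> + X (max 0 t) \<omega>') \<partial>M) \<in> borel_measurable borel"
      using joint_measurable by (intro borel_measurable_nn_integral) (simp add: case_prod_beta')
    then show "?d \<omega> * (\<integral>\<^sup>+y. \<psi> (XS S \<omega> + y) \<partial>exp_law q)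
        = (\<integral>\<^sup>+t. ?d \<omega> * (?e t * (\<integral>\<^sup>+\<omega>'. \<psi> (XS S \<omega> + X (max 0 t) \<omega>') \<partial>M)) \<partial>lborel)"
      by (subst nn_integral_exp_law[OF q]) (auto simp: nn_integral_cmult)
  qed
  also have "\<dots> = (\<integral>\<^sup>+t. (\<integral>\<^sup>+\<omega>. ?d \<omega> * (?e t * (\<integral>\<^sup>+\<omega>'. \<psi> (XS S \<omega> + X (max 0 t) \<omega>') \<partial>M)) \<partial>M) \<partial>lborel)"
    by (rule P.Fubini') measurable
  also have "\<dots> = (\<integral>\<^sup>+t. (\<integral>\<^sup>+\<omega>. ?d \<omega> * (?e t * \<psi> (X (enn2real (S \<omega>) + max 0 t) \<omega>)) \<partial>M) \<partial>lborel)"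
  proof (rule nn_integral_cong)
    fix t :: real
    have [measurable]: "X (max 0 t) \<in> borel_measurable M" by (rule X_measurable) simp
    have X5 [measurable]: "(\<lambda>\<omega>. X (enn2real (S \<omega>) + max 0 t) \<omega>) \<in> borel_measurable M"
      using X_compose_measurable[of "\<lambda>\<omega>. enn2real (S \<omega>) + max 0 t" M "\<lambda>\<omega>. \<omega>"] by (simp add: max_absorb2)
    have "(\<integral>\<^sup>+\<omega>. ?d \<omega> * (?e t * (\<integral>\<^sup>+\<omega>'. \<psi> (XS S \<omega> + X (max 0 t) \<omega>') \<partial>M)) \<partial>M)
        = ?e t * (\<integral>\<^sup>+\<omega>. ?d \<omega> * (\<integral>\<^sup>+\<omega>'. \<psi> (XS S \<omega> + X (max 0 t) \<omega>') \<partial>M) \<partial>M)"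
      by (subst nn_integral_cmult[symmetric]) (auto simp: mult.left_commute)
    also have "\<dots> = ?e t * (\<integral>\<^sup>+\<omega>. ?d \<omega> * \<psi> (X (enn2real (S \<omega>) + max 0 t) \<omega>) \<partial>M)"
      by (subst strong_markov_nn_integral[OF S _ a]) auto
    also have "\<dots> = (\<integral>\<^sup>+\<omega>. ?d \<omega> * (?e t * \<psi> (X (enn2real (S \<omega>) + max 0 t) \<omega>)) \<partial>M)"
      by (subst nn_integral_cmult[symmetric]) (auto simp: mult.left_commute)
    finally show "(\<integral>\<^sup>+\<omega>. ?d \<omega> * (?e t * (\<integral>\<^sup>+\<omega>'. \<psi> (XS S \<omega> + X (max 0 t) \<omega>') \<partial>M)) \<partial>M)
        = (\<integral>\<^sup>+\<omega>. ?d \<omega> * (?e t * \<psi> (X (enn2real (S \<omega>) + max 0 t) \<omega>)) \<partial>M)" .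
  qed
  also have "\<dots> = (\<integral>\<^sup>+\<omega>. (\<integral>\<^sup>+t. ?d \<omega> * (?e t * \<psi> (X (enn2real (S \<omega>) + max 0 t) \<omega>)) \<partial>lborel) \<partial>M)"
    by (rule P.Fubini'[symmetric]) measurable
  also have "\<dots> = (\<integral>\<^sup>+\<omega>. ?d \<omega> * (\<integral>\<^sup>+t. ?e t * \<psi> (X (enn2real (S \<omega>) + max 0 t) \<omega>) \<partial>lborel) \<partial>M)"
  proof (rule nn_integral_cong)
    fix \<omega> assume \<omega> [measurable]: "\<omega> \<in> space M"
    have [measurable]: "(\<lambda>t. X (enn2real (S \<omega>) + max 0 t) \<omega>) \<in> borel_measurable borel"
      using X_compose_measurable[of "\<lambda>t. enn2real (S \<omega>) + max 0 t" borel "\<lambda>_. \<omega>"] \<omega> by (simp add: max_absorb2)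
    show "(\<integral>\<^sup>+t. ?d \<omega> * (?e t * \<psi> (X (enn2real (S \<omega>) + max 0 t) \<omega>)) \<partial>lborel)
        = ?d \<omega> * (\<integral>\<^sup>+t. ?e t * \<psi> (X (enn2real (S \<omega>) + max 0 t) \<omega>) \<partial>lborel)"
      by (subst nn_integral_cmult) auto
  qed
  finally show ?thesis .
qed

lemma nn_integral_X_measurable [measurable]:
  assumes [measurable]: "\<psi> \<in> borel_measurable borel"
  shows "(\<lambda>t. \<integral>\<^sup>+\<omega>. \<psi> (X (max 0 t) \<omega>) \<partial>M) \<in> borel_measurable borel"
proof -
  have [measurable]: "(\<lambda>z. X (max 0 (fst z)) (snd z)) \<in> borel_measurable (borel \<Otimes>\<^sub>M M)"
    using joint_measurable by (simp add: case_prod_beta')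
  show ?thesis by measurable
qed

text \<open>The Markov property at a fixed time \<open>s\<close> turns the inner average into one of
  p (s + t), where p u is the mean of \<psi> at X u; what remains is
  \<open>exponential_resolvent\<close>.\<close>

lemma exp_law_resolvent:
  assumes r: "r > 0" and l: "l > 0" and [measurable]: "\<psi> \<in> borel_measurable borel"
  shows "ennreal l * (\<integral>\<^sup>+y. (\<integral>\<^sup>+z. \<psi> (y + z) \<partial>exp_law (r + l)) \<partial>exp_law r)
      + ennreal r * (\<integral>\<^sup>+y. \<psi> y \<partial>exp_law (r + l)) = ennreal (r + l) * (\<integral>\<^sup>+y. \<psi> y \<partial>exp_law r)"
proof -
  have q: "r + l > 0" using r l by simp
  interpret Q: real_law "exp_law (r + l)" by (rule real_law_exp_law[OF q])
  let ?e = "\<lambda>a t. ennreal (exponential_density a t)"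
  define p where "p u = (\<integral>\<^sup>+\<omega>. \<psi> (X (max 0 u) \<omega>) \<partial>M)" for u
  have p [measurable]: "p \<in> borel_measurable borel" unfolding p_def[abs_def] by measurable
  interpret P: pair_sigma_finite lborel M ..
  have "(\<integral>\<^sup>+y. (\<integral>\<^sup>+z. \<psi> (y + z) \<partial>exp_law (r + l)) \<partial>exp_law r)
      = (\<integral>\<^sup>+s. ?e r s * (\<integral>\<^sup>+\<omega>. (\<integral>\<^sup>+z. \<psi> (X (max 0 s) \<omega> + z) \<partial>exp_law (r + l)) \<partial>M) \<partial>lborel)"
    by (subst nn_integral_exp_law[OF r]) measurable
  also have "\<dots> = (\<integral>\<^sup>+s. ?e r s * (\<integral>\<^sup>+t. ?e (r + l) t * p (s + t) \<partial>lborel) \<partial>lborel)"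
  proof (rule nn_integral_cong)
    fix s :: real
    show "?e r s * (\<integral>\<^sup>+\<omega>. (\<integral>\<^sup>+z. \<psi> (X (max 0 s) \<omega> + z) \<partial>exp_law (r + l)) \<partial>M)
        = ?e r s * (\<integral>\<^sup>+t. ?e (r + l) t * p (s + t) \<partial>lborel)"
    proof (cases "s \<ge> 0")
      case True
      \<comment> \<open>A deterministic time is used with a = 0, for which the discount factor is
        1.\<close>
      have "(\<integral>\<^sup>+\<omega>. (\<integral>\<^sup>+z. \<psi> (X s \<omega> + z) \<partial>exp_law (r + l)) \<partial>M)
          = (\<integral>\<^sup>+\<omega>. (\<integral>\<^sup>+t. ?e (r + l) t * \<psi> (X (s + max 0 t) \<omega>) \<partial>lborel) \<partial>M)"
        using strong_markov_exp_law[OF stopping_time_const[of _ "ennreal s"] order_refl q, of \<psi>] True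
        by (simp add: disc_def XS_def)
      also have "\<dots> = (\<integral>\<^sup>+t. (\<integral>\<^sup>+\<omega>. ?e (r + l) t * \<psi> (X (s + max 0 t) \<omega>) \<partial>M) \<partial>lborel)"
      proof (rule P.Fubini')
        have "(\<lambda>z. X (max 0 (s + max 0 (fst z))) (snd z)) \<in> borel_measurable (borel \<Otimes>\<^sub>M M)"
          by (rule X_compose_measurable) auto
        then have [measurable]: "(\<lambda>z. X (s + max 0 (fst z)) (snd z)) \<in> borel_measurable (borel \<Otimes>\<^sub>M M)"
          using True by (simp add: max_absorb2)
        show "(\<lambda>(t, \<omega>). ?e (r + l) t * \<psi> (X (s + max 0 t) \<omega>)) \<in> borel_measurable (lborel \<Otimes>\<^sub>M M)"
          by measurable
      qed
      also have "\<dots> = (\<integral>\<^sup>+t. ?e (r + l) t * p (s + t) \<partial>lborel)"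
      proof (rule nn_integral_cong)
        fix t :: real
        have [measurable]: "X (s + max 0 t) \<in> borel_measurable M" using True by (intro X_measurable) simp
        have "(\<integral>\<^sup>+\<omega>. ?e (r + l) t * \<psi> (X (s + max 0 t) \<omega>) \<partial>M)
            = ?e (r + l) t * (\<integral>\<^sup>+\<omega>. \<psi> (X (s + max 0 t) \<omega>) \<partial>M)"
          by (rule nn_integral_cmult) measurable
        then show "(\<integral>\<^sup>+\<omega>. ?e (r + l) t * \<psi> (X (s + max 0 t) \<omega>) \<partial>M) = ?e (r + l) t * p (s + t)"
          using True by (cases "t \<ge> 0") (auto simp: p_def exponential_density_def max_absorb2)
      qed
      finally show ?thesis using True by (simp add: max_absorb2)
    qed (simp add: exponential_density_def)
  qed
  finally show ?thesis
    unfolding nn_integral_exp_law[OF r, of \<psi>, simplified] nn_integral_exp_law[OF q, of \<psi>, simplified]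
    using exponential_resolvent[OF r l p] by (simp add: p_def)
qed

text \<open>Full support enters here: every lower half-line is charged at each time t > 0, hence at
  an exponential time. This is what makes the value function positive everywhere.\<close>

lemma exp_law_neg:
  assumes supp: "\<And>t. t > 0 \<Longrightarrow> measure_support (distr M borel (X t)) = UNIV" and q: "q > 0"
  shows "emeasure (exp_law q) {..<a} > 0"
proof -
  have pos: "(\<integral>\<^sup>+\<omega>. indicator {..<a} (X t \<omega>) \<partial>M) > 0" if "t > 0" for t
  proof -
    have "a - 1 \<in> measure_support (distr M borel (X t))" using supp[OF that] by simp
    then have "emeasure (distr M borel (X t)) {..<a} > 0"
      unfolding measure_support_def by (auto dest!: spec[of _ "{..<a}"])
    moreover have [measurable]: "X t \<in> borel_measurable M" using that by (intro X_measurable) simp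
    moreover have "(\<integral>\<^sup>+\<omega>. indicator {..<a} (X t \<omega>) \<partial>M) = (\<integral>\<^sup>+y. indicator {..<a} y \<partial>distr M borel (X t))"
      by (subst nn_integral_distr) auto
    ultimately show ?thesis by simp
  qed
  have "emeasure (exp_law q) {..<a}
      = (\<integral>\<^sup>+t. ennreal (exponential_density q t) * (\<integral>\<^sup>+\<omega>. indicator {..<a} (X (max 0 t) \<omega>) \<partial>M) \<partial>lborel)"
    using nn_integral_exp_law[OF q, of "indicator {..<a}"] by simp
  moreover have "\<dots> \<noteq> 0"
  proof
    assume "(\<integral>\<^sup>+t. ennreal (exponential_density q t) * (\<integral>\<^sup>+\<omega>. indicator {..<a} (X (max 0 t) \<omega>) \<partial>M) \<partial>lborel) = 0"
    then have "AE t in lborel. ennreal (exponential_density q t) * (\<integral>\<^sup>+\<omega>. indicator {..<a} (X (max 0 t) \<omega>) \<partial>M) = 0"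
      by (subst (asm) nn_integral_0_iff_AE) measurable
    then have "AE t in lborel. t \<notin> {0<..<1::real}"
    proof (rule AE_mp, intro AE_I2 impI notI)
      fix t :: real
      assume "t \<in> {0<..<1}" "ennreal (exponential_density q t) * (\<integral>\<^sup>+\<omega>. indicator {..<a} (X (max 0 t) \<omega>) \<partial>M) = 0"
      then show False using pos[of t] q by (auto simp: exponential_density_def)
    qed
    then have "emeasure lborel {0<..<1::real} = 0"
      by (subst (asm) AE_iff_measurable[of "{0<..<1}"]) auto
    then show False by simp
  qed
  ultimately show ?thesis by (simp add: zero_less_iff_neq_zero)
qed

text \<open>Path continuity at time 0 enters here. After the time change t = s / q n the weight is
  the fixed density of rate 1 and X is evaluated at times tending to 0, so dominated convergence
  applies.\<close>

lemma exp_law_concentrates: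
  assumes q: "\<And>n. q n > 0" and lim: "filterlim q at_top sequentially"
  shows "(\<lambda>n. LINT y|exp_law (q n). min 1 \<bar>y\<bar>) \<longlonglongrightarrow> 0"
proof -
  define P where "P t = (\<integral>\<^sup>+\<omega>. ennreal (min 1 \<bar>X (max 0 t) \<omega>\<bar>) \<partial>M)" for t
  have P_meas [measurable]: "P \<in> borel_measurable borel" unfolding P_def[abs_def] by measurable
  have P_le: "P t \<le> 1" for t
    unfolding P_def using nn_integral_mono[of M "\<lambda>\<omega>. ennreal (min 1 \<bar>X (max 0 t) \<omega>\<bar>)" "\<lambda>_. 1"]
    by (simp add: emeasure_space_1)
  have P_lim: "(\<lambda>n. P (s / q n)) \<longlonglongrightarrow> 0" if "s > 0" for s
  proof -
    have "filterlim (\<lambda>n. s / q n) (at_right 0) sequentially"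
      unfolding filterlim_at
    proof (intro conjI always_eventually allI)
      show "(\<lambda>n. s / q n) \<longlonglongrightarrow> 0"
        by (rule tendsto_divide_0[OF tendsto_const filterlim_at_top_imp_at_infinity[OF lim]])
      show "s / q n \<in> {0<..}" "s / q n \<noteq> 0" for n using q[of n] that by auto
    qed
    note lim0 = this
    have conv: "(\<lambda>n. X (s / q n) \<omega>) \<longlonglongrightarrow> X 0 \<omega>" if "((\<lambda>t. X t \<omega>) \<longlongrightarrow> X 0 \<omega>) (at_right 0)" for \<omega>
      by (rule filterlim_compose[OF that lim0])
    have [measurable]: "X (s / q n) \<in> borel_measurable M" for n
      using q[of n] that by (intro X_measurable) simp
    have "(\<lambda>n. \<integral>\<^sup>+\<omega>. ennreal (min 1 \<bar>X (s / q n) \<omega>\<bar>) \<partial>M) \<longlonglongrightarrow> (\<integral>\<^sup>+\<omega>. 0 \<partial>M)"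
    proof (rule nn_integral_dominated_convergence[where w="\<lambda>_. 1"])
      show "AE \<omega> in M. (\<lambda>n. ennreal (min 1 \<bar>X (s / q n) \<omega>\<bar>)) \<longlonglongrightarrow> 0"
        using start right_cont_0
      proof eventually_elim
        case (elim \<omega>)
        have "(\<lambda>n. ennreal (min 1 \<bar>X (s / q n) \<omega>\<bar>)) \<longlonglongrightarrow> ennreal (min 1 \<bar>0\<bar>)"
          using conv[OF elim(2)] elim(1) by (intro tendsto_intros) auto
        then show ?case by simp
      qed
    qed (auto simp: emeasure_space_1)
    moreover have "P (s / q n) = (\<integral>\<^sup>+\<omega>. ennreal (min 1 \<bar>X (s / q n) \<omega>\<bar>) \<partial>M)" for n
      using q[of n] that by (simp add: P_def max_absorb2)
    ultimately show ?thesis by simp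
  qed
  have eq: "(\<integral>\<^sup>+y. ennreal (min 1 \<bar>y\<bar>) \<partial>exp_law (q n))
      = (\<integral>\<^sup>+s. ennreal (exponential_density 1 s) * P (s / q n) \<partial>lborel)" for n
  proof -
    have "(\<integral>\<^sup>+y. ennreal (min 1 \<bar>y\<bar>) \<partial>exp_law (q n)) = (\<integral>\<^sup>+t. ennreal (exponential_density (q n) t) * P t \<partial>lborel)"
      unfolding P_def by (rule nn_integral_exp_law[OF q]) measurable
    also have "\<dots> = ennreal (1 / q n) *
        (\<integral>\<^sup>+s. ennreal (exponential_density (q n) (s / q n)) * P (s / q n) \<partial>lborel)"
      using q[of n] by (subst nn_integral_real_affine[where c="1 / q n" and t=0]) auto
    also have "\<dots> = (\<integral>\<^sup>+s. ennreal (exponential_density 1 s) * P (s / q n) \<partial>lborel)"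
      using q[of n] by (subst nn_integral_cmult[symmetric])
        (auto intro!: nn_integral_cong simp: exponential_density_def divide_less_0_iff simp flip: mult.assoc ennreal_mult)
    finally show ?thesis .
  qed
  have total: "(\<integral>\<^sup>+s. ennreal (exponential_density 1 s) \<partial>lborel) = 1"
    using prob_space.emeasure_space_1[OF prob_space_exponential_density[of 1]]
    by (simp add: emeasure_density)
  have "(\<lambda>n. \<integral>\<^sup>+s. ennreal (exponential_density 1 s) * P (s / q n) \<partial>lborel) \<longlonglongrightarrow> (\<integral>\<^sup>+s. 0 \<partial>(lborel :: real measure))"
  proof (rule nn_integral_dominated_convergence[where w="\<lambda>s. ennreal (exponential_density 1 s)"])
    show "AE s in lborel. ennreal (exponential_density 1 s) * P (s / q n) \<le> ennreal (exponential_density 1 s)" for n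
      using mult_left_mono[OF P_le] by (intro AE_I2) (metis mult.right_neutral zero_le)
    have "AE s in lborel. s \<noteq> (0::real)" by (rule AE_lborel_singleton)
    then show "AE s in lborel. (\<lambda>n. ennreal (exponential_density 1 s) * P (s / q n)) \<longlonglongrightarrow> 0"
    proof eventually_elim
      case (elim s)
      show ?case
      proof (cases "s > 0")
        case True
        have "(\<lambda>n. ennreal (exponential_density 1 s) * P (s / q n)) \<longlonglongrightarrow> ennreal (exponential_density 1 s) * 0"
          by (intro ennreal_tendsto_cmult P_lim True) simp
        then show ?thesis by simp
      qed (use elim in \<open>simp add: exponential_density_def\<close>)
    qed
  qed (auto simp: total)
  then have "(\<lambda>n. \<integral>\<^sup>+y. ennreal (min 1 \<bar>y\<bar>) \<partial>exp_law (q n)) \<longlonglongrightarrow> 0"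
    by (simp add: eq)
  moreover have "(\<integral>\<^sup>+y. ennreal (min 1 \<bar>y\<bar>) \<partial>exp_law (q n)) = ennreal (LINT y|exp_law (q n). min 1 \<bar>y\<bar>)" for n
  proof -
    interpret Q: real_law "exp_law (q n)" by (rule real_law_exp_law[OF q])
    show ?thesis by (intro nn_integral_eq_integral Q.integrable_const_bound[where B=1]) auto
  qed
  ultimately have "(\<lambda>n. ennreal (LINT y|exp_law (q n). min 1 \<bar>y\<bar>)) \<longlonglongrightarrow> ennreal 0" by simp
  then show ?thesis
    by (subst (asm) tendsto_ennreal_iff) (auto intro!: always_eventually integral_nonneg_AE)
qed

end

section \<open>Potentials and continuity of discounted expectations along stopping times\<close>

lemma disc_tendsto:
  assumes r: "r > 0" and S: "(\<lambda>n. S n) \<longlonglongrightarrow> s"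
  shows "(\<lambda>n. disc r (S n)) \<longlonglongrightarrow> disc r s"
proof (cases "s = \<infinity>")
  case True
  show ?thesis
    unfolding True disc_def[of r \<infinity>]
  proof (simp, rule LIMSEQ_I)
    fix e :: real assume e: "e > 0"
    \<comment> \<open>Beyond \<open>K\<close> the discount is below \<open>e\<close>; the maximum
      keeps \<open>K\<close> positive, so that \<open>ennreal\<close> does not truncate it.\<close>
    define K where "K = max 0 (- ln e / r) + 1"
    have K: "K > 0" by (simp add: K_def)
    have "- ln e / r < K" by (simp add: K_def)
    then have "- r * K < ln e" using r by (simp add: field_simps)
    then have Ke: "exp (- r * K) < e" using e by (metis exp_less_mono exp_ln)
    have "eventually (\<lambda>n. ennreal K < S n) sequentially"
      using S unfolding True by (rule order_tendstoD) simp
    then obtain N where N: "\<And>n. n \<ge> N \<Longrightarrow> ennreal K < S n" by (auto simp: eventually_sequentially)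
    have "norm (disc r (S n) - 0) < e" if "n \<ge> N" for n
    proof (cases "S n = \<infinity>")
      case False
      then have "K < enn2real (S n)"
        using N[OF that] K by (cases "S n" rule: ennreal_cases) (auto simp: ennreal_less_iff)
      then have "exp (- r * enn2real (S n)) \<le> exp (- r * K)" using r by simp
      then have "exp (- r * enn2real (S n)) < e" using Ke by (rule le_less_trans)
      then show ?thesis using False by (simp add: disc_def)
    qed (use e in \<open>simp add: disc_def\<close>)
    then show "\<exists>N. \<forall>n\<ge>N. norm (disc r (S n) - 0) < e" by blast
  qed
next
  case False
  then have fin: "s < top" by (simp add: less_top)
  have "eventually (\<lambda>n. S n < top) sequentially"
    using S fin by (rule order_tendstoD)
  then have ev: "eventually (\<lambda>n. exp (- r * enn2real (S n)) = disc r (S n)) sequentially"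
    by eventually_elim (simp add: disc_def)
  have "(\<lambda>n. exp (- r * enn2real (S n))) \<longlonglongrightarrow> exp (- r * enn2real s)"
    using S fin by (intro tendsto_intros tendsto_enn2real) auto
  then show ?thesis
    using False tendsto_cong[OF ev] by (simp add: disc_def)
qed

text \<open>Over a finite time set the infimum is a minimum, so the strict inequality holds at the
  crossing time itself. For infinite sets this can fail, and a weak inequality is recovered in the
  limit by \<open>crossing_level\<close>.\<close>

lemma crossing_time_attained:
  assumes D: "finite D" "D \<subseteq> {0..}" and fin: "crossing_time X D a \<omega> < \<infinity>"
  shows "X (enn2real (crossing_time X D a \<omega>)) \<omega> < a"
proof -
  let ?A = "{t\<in>D. X t \<omega> < a}"
  have "?A \<noteq> {}"
  proof
    assume "?A = {}"
    then show False using fin by (simp only: crossing_time_def) simp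
  qed
  then have "crossing_time X D a \<omega> \<in> ennreal ` ?A"
    unfolding crossing_time_def using D(1) by (subst Min_Inf[symmetric]) (auto intro!: Min_in)
  then show ?thesis using D(2) by auto
qed

lemma crossing_time_finite_approx:
  assumes D: "countable D" "D \<noteq> {}"
  shows "(\<lambda>m. crossing_time X (from_nat_into D ` {..m}) a \<omega>) \<longlonglongrightarrow> crossing_time X D a \<omega>"
proof -
  let ?D = "\<lambda>m. from_nat_into D ` {..m}"
  have "(\<lambda>m. crossing_time X (?D m) a \<omega>) \<longlonglongrightarrow> (INF m. crossing_time X (?D m) a \<omega>)"
    by (intro LIMSEQ_INF decseq_SucI) (auto simp: crossing_time_def intro!: INF_superset_mono)
  also have "(INF m. crossing_time X (?D m) a \<omega>) = crossing_time X D a \<omega>"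
  proof (rule antisym)
    show "(INF m. crossing_time X (?D m) a \<omega>) \<le> crossing_time X D a \<omega>"
      unfolding crossing_time_def[of X D]
    proof (rule INF_greatest)
      fix t assume t: "t \<in> {t \<in> D. X t \<omega> < a}"
      then obtain m where "t = from_nat_into D m"
        using from_nat_into_surj[OF D(1)] by (metis mem_Collect_eq)
      then have "crossing_time X (?D m) a \<omega> \<le> ennreal t"
        using t unfolding crossing_time_def by (intro INF_lower) auto
      then show "(INF m. crossing_time X (?D m) a \<omega>) \<le> ennreal t" by (rule INF_lower2[OF UNIV_I])
    qed
    show "crossing_time X D a \<omega> \<le> (INF m. crossing_time X (?D m) a \<omega>)"
      using from_nat_into[OF D(2)] by (intro INF_greatest) (auto simp: crossing_time_def intro!: INF_superset_mono)
  qed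
  finally show ?thesis .
qed

context strong_levy
begin

definition expected_disc :: "real \<Rightarrow> ('a \<Rightarrow> ennreal) \<Rightarrow> (real \<Rightarrow> real) \<Rightarrow> real" where
  "expected_disc r S G = (LINT \<omega>|M. disc r (S \<omega>) * G (XS S \<omega>))"

lemma integrable_disc:
  assumes S: "optional_time S" and r: "r > 0" and G: "G \<in> borel_measurable borel" "\<And>x. \<bar>G x\<bar> \<le> B"
  shows "integrable M (\<lambda>\<omega>. disc r (S \<omega>) * G (XS S \<omega>))"
proof -
  note [measurable] = optional_measurable[OF S] XS_measurable[OF S] G(1)
  have "0 \<le> B" using G(2)[of 0] by linarith
  then have "disc r s * \<bar>G x\<bar> \<le> 1 * B" for s x
    using G(2) r by (intro mult_mono) (auto simp: disc_le_1)
  then show ?thesis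
    by (intro integrable_const_bound[where B=B]) (auto simp: abs_mult)
qed

lemma expected_disc_nonneg: "(\<And>x. 0 \<le> G x) \<Longrightarrow> 0 \<le> expected_disc r S G"
  unfolding expected_disc_def by (intro integral_nonneg_AE) auto

lemma ennreal_expected_disc:
  assumes S: "optional_time S" and r: "r > 0" and G: "G \<in> borel_measurable borel" "\<And>x. 0 \<le> G x" "\<And>x. G x \<le> B"
  shows "ennreal (expected_disc r S G) = (\<integral>\<^sup>+\<omega>. ennreal (disc r (S \<omega>)) * ennreal (G (XS S \<omega>)) \<partial>M)"
proof -
  have "integrable M (\<lambda>\<omega>. disc r (S \<omega>) * G (XS S \<omega>))"
    using G by (intro integrable_disc[OF S r G(1), of B]) (simp add: abs_of_nonneg)
  then show ?thesis
    unfolding expected_disc_def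
    by (subst nn_integral_eq_integral[symmetric]) (auto simp: G ennreal_mult)
qed

lemma expected_disc_mono:
  assumes S: "optional_time S" and r: "r > 0"
    and G: "G \<in> borel_measurable borel" "\<And>x. \<bar>G x\<bar> \<le> B"
    and H: "H \<in> borel_measurable borel" "\<And>x. \<bar>H x\<bar> \<le> B'"
    and le: "AE \<omega> in M. S \<omega> < \<infinity> \<longrightarrow> G (XS S \<omega>) \<le> H (XS S \<omega>)"
  shows "expected_disc r S G \<le> expected_disc r S H"
  unfolding expected_disc_def
  using le by (intro integral_mono_AE integrable_disc[OF S r G] integrable_disc[OF S r H])
    (auto simp: disc_def less_top intro!: mult_left_mono)

lemma expected_disc_le:
  assumes S: "optional_time S" and r: "r > 0"
    and G: "G \<in> borel_measurable borel" "\<And>x. \<bar>G x\<bar> \<le> B"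
    and le: "AE \<omega> in M. S \<omega> < \<infinity> \<longrightarrow> G (XS S \<omega>) \<le> b" and b: "0 \<le> b"
  shows "expected_disc r S G \<le> b"
proof -
  have "expected_disc r S G \<le> (LINT \<omega>|M. b)"
    unfolding expected_disc_def
  proof (rule integral_mono_AE[OF integrable_disc[OF S r G]])
    show "AE \<omega> in M. disc r (S \<omega>) * G (XS S \<omega>) \<le> b"
      using le
    proof eventually_elim
      case (elim \<omega>)
      show ?case
      proof (cases "S \<omega> = \<infinity>")
        case False
        then have "disc r (S \<omega>) * G (XS S \<omega>) \<le> disc r (S \<omega>) * b"
          using elim by (intro mult_left_mono) (auto simp: less_top)
        also have "\<dots> \<le> 1 * b" using r b by (intro mult_right_mono) (auto simp: disc_le_1)
        finally show ?thesis by simp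
      qed (simp add: disc_def b)
    qed
  qed simp
  then show ?thesis by (simp add: prob_space)
qed

lemma expected_disc_eq_0D:
  assumes S: "optional_time S" and r: "r > 0"
    and G: "G \<in> borel_measurable borel" "\<And>x. 0 \<le> G x" "\<And>x. G x \<le> B"
    and zero: "expected_disc r S G = 0"
  shows "AE \<omega> in M. S \<omega> < \<infinity> \<longrightarrow> G (XS S \<omega>) = 0"
proof -
  have "AE \<omega> in M. disc r (S \<omega>) * G (XS S \<omega>) = 0"
    using zero unfolding expected_disc_def
    by (subst (asm) integral_nonneg_eq_0_iff_AE)
      (use G in \<open>auto intro!: integrable_disc[OF S r G(1), of B] simp: abs_of_nonneg\<close>)
  then show ?thesis by (rule AE_mp) (auto simp: disc_def)
qed

text \<open>\<open>r\<close> times the expected integral of e^(-r u) \<psi>(X u) over u \<ge> S, on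
  the absolute time axis: \<open>S\<close> enters only through the range of integration, and S =
  infinity contributes 0.\<close>

definition potential :: "real \<Rightarrow> ('a \<Rightarrow> ennreal) \<Rightarrow> (real \<Rightarrow> ennreal) \<Rightarrow> ennreal" where
  "potential r S \<psi> = (\<integral>\<^sup>+\<omega>. (\<integral>\<^sup>+u. ennreal (exponential_density r u) * indicator {u. S \<omega> \<le> ennreal u} u
     * \<psi> (X (max 0 u) \<omega>) \<partial>lborel) \<partial>M)"

lemma path_measurable: "\<omega> \<in> space M \<Longrightarrow> (\<lambda>u. X (max 0 u) \<omega>) \<in> borel_measurable borel"
  using X_compose_measurable[of "\<lambda>u. u" borel "\<lambda>_. \<omega>"] by simp

text \<open>Substitute u = S + t: the discount at \<open>S\<close> and the exponential density at
  \<open>t\<close> multiply to the density at \<open>u\<close>.\<close>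

lemma nn_integral_exp_law_potential:
  assumes S: "optional_time S" and r: "r > 0" and [measurable]: "\<psi> \<in> borel_measurable borel"
  shows "(\<integral>\<^sup>+\<omega>. ennreal (disc r (S \<omega>)) * (\<integral>\<^sup>+y. \<psi> (XS S \<omega> + y) \<partial>exp_law r) \<partial>M) = potential r S \<psi>"
proof -
  have "(\<integral>\<^sup>+\<omega>. ennreal (disc r (S \<omega>)) * (\<integral>\<^sup>+y. \<psi> (XS S \<omega> + y) \<partial>exp_law r) \<partial>M)
    = (\<integral>\<^sup>+\<omega>. ennreal (disc r (S \<omega>)) *
        (\<integral>\<^sup>+t. ennreal (exponential_density r t) * \<psi> (X (enn2real (S \<omega>) + max 0 t) \<omega>) \<partial>lborel) \<partial>M)"
    using r by (intro strong_markov_exp_law[OF S]) auto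
  also have "\<dots> = potential r S \<psi>"
    unfolding potential_def
  proof (rule nn_integral_cong)
    fix \<omega> assume \<omega>: "\<omega> \<in> space M"
    note [measurable] = path_measurable[OF \<omega>]
    show "ennreal (disc r (S \<omega>)) *
        (\<integral>\<^sup>+t. ennreal (exponential_density r t) * \<psi> (X (enn2real (S \<omega>) + max 0 t) \<omega>) \<partial>lborel)
      = (\<integral>\<^sup>+u. ennreal (exponential_density r u) * indicator {u. S \<omega> \<le> ennreal u} u * \<psi> (X (max 0 u) \<omega>) \<partial>lborel)"
    proof (cases "S \<omega> = \<infinity>")
      case True
      then show ?thesis by (simp add: disc_def top_unique)
    next
      case False
      then obtain s where s: "S \<omega> = ennreal s" "0 \<le> s" by (cases "S \<omega>" rule: ennreal_cases) auto
      have meas: "(\<lambda>t. X (s + max 0 t) \<omega>) \<in> borel_measurable borel"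
        using X_compose_measurable[of "\<lambda>t. s + max 0 t" borel "\<lambda>_. \<omega>"] \<omega> s by (simp add: max_absorb2)
      note [measurable] = meas
      have "(\<integral>\<^sup>+u. ennreal (exponential_density r u) * indicator {u. S \<omega> \<le> ennreal u} u * \<psi> (X (max 0 u) \<omega>) \<partial>lborel)
          = (\<integral>\<^sup>+t. ennreal (exponential_density r (s + t)) * indicator {u. S \<omega> \<le> ennreal u} (s + t)
              * \<psi> (X (max 0 (s + t)) \<omega>) \<partial>lborel)"
        by (subst nn_integral_real_affine[where c=1 and t=s]) auto
      also have "\<dots> = (\<integral>\<^sup>+t. ennreal (disc r (S \<omega>)) * (ennreal (exponential_density r t) * \<psi> (X (s + max 0 t) \<omega>)) \<partial>lborel)"
      proof (rule nn_integral_cong_AE, rule AE_I2)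
        fix t :: real
        show "ennreal (exponential_density r (s + t)) * indicator {u. S \<omega> \<le> ennreal u} (s + t) * \<psi> (X (max 0 (s + t)) \<omega>)
          = ennreal (disc r (S \<omega>)) * (ennreal (exponential_density r t) * \<psi> (X (s + max 0 t) \<omega>))"
        proof (cases "t \<ge> 0")
          case True
          have "exponential_density r (s + t) = exp (- r * s) * exponential_density r t"
            using True s by (simp add: exponential_density_def algebra_simps flip: exp_add)
          then show ?thesis
            using True s r by (simp add: disc_def ennreal_mult exponential_density_nonneg max_absorb2 mult.assoc)
        next
          case False
          then have "s + t < 0 \<or> (0 \<le> s + t \<and> s + t < s)" by auto
          then show ?thesis using False s by (auto simp: exponential_density_def ennreal_le_iff)
        qed
      qed
      also have "\<dots> = ennreal (disc r (S \<omega>)) *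
          (\<integral>\<^sup>+t. ennreal (exponential_density r t) * \<psi> (X (s + max 0 t) \<omega>) \<partial>lborel)"
        by (rule nn_integral_cmult) measurable
      finally show ?thesis using s by simp
    qed
  qed
  finally show ?thesis .
qed

lemma potential_antimono:
  assumes "\<And>\<omega>. \<omega> \<in> space M \<Longrightarrow> S \<omega> \<le> T \<omega>"
  shows "potential r T \<psi> \<le> potential r S \<psi>"
  unfolding potential_def
  by (intro nn_integral_mono mult_right_mono mult_left_mono)
    (use assms in \<open>auto simp: indicator_def intro: order_trans\<close>)

lemma potential_eq_0:
  assumes "AE \<omega> in M. \<forall>u\<ge>0. ennreal u < S \<omega> \<longrightarrow> \<psi> (X u \<omega>) = 0"
  shows "potential r S \<psi> = potential r (\<lambda>_. 0) \<psi>"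
  unfolding potential_def
proof (rule nn_integral_cong_AE)
  show "AE \<omega> in M. (\<integral>\<^sup>+u. ennreal (exponential_density r u) * indicator {u. S \<omega> \<le> ennreal u} u * \<psi> (X (max 0 u) \<omega>) \<partial>lborel)
    = (\<integral>\<^sup>+u. ennreal (exponential_density r u) * indicator {u. 0 \<le> ennreal u} u * \<psi> (X (max 0 u) \<omega>) \<partial>lborel)"
    using assms
  proof eventually_elim
    case (elim \<omega>)
    show ?case
    proof (rule nn_integral_cong_AE, rule AE_I2)
      fix u :: real
      show "ennreal (exponential_density r u) * indicator {u. S \<omega> \<le> ennreal u} u * \<psi> (X (max 0 u) \<omega>)
        = ennreal (exponential_density r u) * indicator {u. 0 \<le> ennreal u} u * \<psi> (X (max 0 u) \<omega>)"
        using elim by (cases "u \<ge> 0") (auto simp: exponential_density_def indicator_def not_le max_absorb2)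
    qed
  qed
qed

text \<open>Both sides are potentials of the same nonnegative function, integrated from
  \<open>S\<close> and from 0 respectively. Starting later can only lose mass, and loses none if the
  function vanishes along the path before \<open>S\<close>. This is optional stopping in integral
  form.\<close>

lemma
  assumes S: "optional_time S" and r: "r > 0"
    and G: "G \<in> borel_measurable borel" "\<And>x. 0 \<le> G x" "\<And>x. G x \<le> B"
    and w: "\<And>x. w x = (LINT y|exp_law r. G (x + y)) / r"
  shows expected_disc_potential_le: "expected_disc r S (\<lambda>y. w (x + y)) \<le> w x"
    and expected_disc_potential_eq:
      "(AE \<omega> in M. \<forall>u\<ge>0. ennreal u < S \<omega> \<longrightarrow> G (x + X u \<omega>) = 0) \<Longrightarrow> expected_disc r S (\<lambda>y. w (x + y)) = w x"
proof -
  interpret Q: real_law "exp_law r" by (rule real_law_exp_law[OF r])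
  note [measurable] = G(1)
  have int: "integrable (exp_law r) (\<lambda>y. G (x + y))" for x
    using G by (intro Q.integrable_bounded[where B=B]) (auto simp: abs_of_nonneg)
  have w0: "0 \<le> w x" for x
    unfolding w using G r by (intro divide_nonneg_pos integral_nonneg_AE) auto
  have wB: "w x \<le> B / r" for x
    unfolding w using G r int by (intro divide_right_mono Q.integral_le_const) auto
  have w_nn: "ennreal (w x) = (\<integral>\<^sup>+y. ennreal (G (x + y) / r) \<partial>exp_law r)" for x
    unfolding w using int[of x] G(2) r
    by (subst nn_integral_eq_integral) auto
  have wm [measurable]: "w \<in> borel_measurable borel"
    unfolding w[abs_def] by measurable
  define \<psi> where "\<psi> y = ennreal (G (x + y) / r)" for y
  have \<psi> [measurable]: "\<psi> \<in> borel_measurable borel" unfolding \<psi>_def by measurable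
  have pot: "ennreal (expected_disc r T (\<lambda>y. w (x + y))) = potential r T \<psi>" if T: "optional_time T" for T
  proof -
    have "ennreal (expected_disc r T (\<lambda>y. w (x + y)))
        = (\<integral>\<^sup>+\<omega>. ennreal (disc r (T \<omega>)) * ennreal (w (x + XS T \<omega>)) \<partial>M)"
      using w0 wB by (intro ennreal_expected_disc[OF T r]) auto
    also have "\<dots> = (\<integral>\<^sup>+\<omega>. ennreal (disc r (T \<omega>)) * (\<integral>\<^sup>+y. \<psi> (XS T \<omega> + y) \<partial>exp_law r) \<partial>M)"
      by (simp add: w_nn \<psi>_def add.assoc)
    also have "\<dots> = potential r T \<psi>"
      by (rule nn_integral_exp_law_potential[OF T r]) measurable
    finally show ?thesis .
  qed
  have zero: "expected_disc r (\<lambda>_. 0) (\<lambda>y. w (x + y)) = w x"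
  proof -
    have [measurable]: "X 0 \<in> borel_measurable M" by (rule X_measurable) simp
    have "expected_disc r (\<lambda>_. 0) (\<lambda>y. w (x + y)) = (LINT \<omega>|M. w (x + X 0 \<omega>))"
      by (simp add: expected_disc_def disc_def XS_def)
    also have "\<dots> = (LINT \<omega>|M. w x)"
      using start by (intro integral_cong_AE) auto
    finally show ?thesis by (simp add: prob_space)
  qed
  have opt0: "optional_time (\<lambda>_. 0)" by (rule stopping_time_const)
  have nonneg: "0 \<le> expected_disc r S (\<lambda>y. w (x + y))" by (rule expected_disc_nonneg) (rule w0)
  show "expected_disc r S (\<lambda>y. w (x + y)) \<le> w x"
    using potential_antimono[of "\<lambda>_. 0" S r \<psi>] pot[OF S] pot[OF opt0] zero w0[of x]
    by (metis ennreal_le_iff zero_le)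
  assume "AE \<omega> in M. \<forall>u\<ge>0. ennreal u < S \<omega> \<longrightarrow> G (x + X u \<omega>) = 0"
  then have "AE \<omega> in M. \<forall>u\<ge>0. ennreal u < S \<omega> \<longrightarrow> \<psi> (X u \<omega>) = 0"
    by (rule AE_mp) (auto simp: \<psi>_def)
  from potential_eq_0[OF this, of r] show "expected_disc r S (\<lambda>y. w (x + y)) = w x"
    using pot[OF S] pot[OF opt0] zero w0[of x] nonneg by (metis ennreal_inj)
qed

text \<open>Smoothing moves the stopping time from the path to a density: by the strong Markov
  property the expectation is that of the discount times I, where \<open>I s\<close> integrates the
  path against an exponential density translated by \<open>s\<close>. Translates of an integrable
  density vary continuously, however irregular the path.\<close>

lemma expected_disc_exp_law_tendsto:
  assumes S: "\<And>n. optional_time (S n)" "optional_time T" and lim: "\<And>\<omega>. \<omega> \<in> space M \<Longrightarrow> (\<lambda>n. S n \<omega>) \<longlonglongrightarrow> T \<omega>"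
    and r: "r > 0" and q: "q > 0"
    and G: "G \<in> borel_measurable borel" "\<And>x. 0 \<le> G x" "\<And>x. G x \<le> B"
  shows "(\<lambda>n. expected_disc r (S n) (\<lambda>x. LINT y|exp_law q. G (x + y)))
     \<longlonglongrightarrow> expected_disc r T (\<lambda>x. LINT y|exp_law q. G (x + y))"
proof -
  interpret Q: real_law "exp_law q" by (rule real_law_exp_law[OF q])
  note [measurable] = G(1)
  have B: "0 \<le> B" using G(2,3) order_trans by blast
  have int: "integrable (exp_law q) (\<lambda>y. G (x + y))" for x
    using G by (intro Q.integrable_bounded[where B=B]) (auto simp: abs_of_nonneg)
  define H where "H x = (LINT y|exp_law q. G (x + y))" for x
  have H0: "0 \<le> H x" and HB: "H x \<le> B" for x
    unfolding H_def using G int by (auto intro!: integral_nonneg_AE Q.integral_le_const)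
  have Hm [measurable]: "H \<in> borel_measurable borel" unfolding H_def[abs_def] by measurable
  have H_nn: "ennreal (H x) = (\<integral>\<^sup>+y. ennreal (G (x + y)) \<partial>exp_law q)" for x
    unfolding H_def using int[of x] G(2) by (subst nn_integral_eq_integral) auto
  let ?e = "\<lambda>t. ennreal (exponential_density q t)"
  define I where "I s \<omega> = (\<integral>\<^sup>+t. ?e t * ennreal (G (X (s + max 0 t) \<omega>)) \<partial>lborel)" for s \<omega>
  have total: "(\<integral>\<^sup>+t. ?e t \<partial>lborel) = 1"
    using prob_space.emeasure_space_1[OF prob_space_exponential_density[OF q]]
    by (simp add: emeasure_density)
  have IB: "I s \<omega> \<le> ennreal B" for s \<omega>
  proof -
    have "I s \<omega> \<le> (\<integral>\<^sup>+t. ?e t * ennreal B \<partial>lborel)"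
      unfolding I_def using G(3) by (intro nn_integral_mono mult_left_mono ennreal_leI) auto
    then show ?thesis by (simp add: nn_integral_multc total)
  qed
  have val: "ennreal (expected_disc r U H) = (\<integral>\<^sup>+\<omega>. ennreal (disc r (U \<omega>)) * I (enn2real (U \<omega>)) \<omega> \<partial>M)"
    if U: "optional_time U" for U
  proof -
    have "ennreal (expected_disc r U H) = (\<integral>\<^sup>+\<omega>. ennreal (disc r (U \<omega>)) * ennreal (H (XS U \<omega>)) \<partial>M)"
      using H0 HB by (intro ennreal_expected_disc[OF U r]) auto
    then show ?thesis
      unfolding H_nn I_def using r by (subst (asm) strong_markov_exp_law[OF U _ q]) auto
  qed
  have meas: "(\<lambda>\<omega>. ennreal (disc r (U \<omega>)) * I (enn2real (U \<omega>)) \<omega>) \<in> borel_measurable M"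
    if U: "optional_time U" for U
  proof -
    note [measurable] = optional_measurable[OF U]
    have "(\<lambda>z. X (max 0 (enn2real (U (fst z)) + max 0 (snd z))) (fst z)) \<in> borel_measurable (M \<Otimes>\<^sub>M borel)"
      by (rule X_compose_measurable) auto
    then have [measurable]: "(\<lambda>z. X (enn2real (U (fst z)) + max 0 (snd z)) (fst z)) \<in> borel_measurable (M \<Otimes>\<^sub>M borel)"
      by (simp add: max_absorb2)
    show ?thesis unfolding I_def by measurable
  qed
  have I_cont: "(\<lambda>n. I (s n) \<omega>) \<longlonglongrightarrow> I s' \<omega>"
    if \<omega>: "\<omega> \<in> space M" and s: "s \<longlonglongrightarrow> s'" "\<And>n. 0 \<le> s n" "0 \<le> s'" for s s' \<omega>
  proof -
    note [measurable] = path_measurable[OF \<omega>]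
    obtain K where K: "\<And>n. s n \<le> K"
      using convergent_imp_Bseq[of s] s(1) unfolding Bseq_def convergent_def
      by (metis abs_le_D1 real_norm_def)
    have I_eq: "I a \<omega> = (\<integral>\<^sup>+u. ?e (u - a) * ennreal (G (X (max 0 u) \<omega>)) \<partial>lborel)" if a: "0 \<le> a" for a
    proof -
      have "I a \<omega> = (\<integral>\<^sup>+t. ?e t * ennreal (G (X (max 0 (a + t)) \<omega>)) \<partial>lborel)"
        unfolding I_def using a
        by (intro nn_integral_cong) (auto simp: exponential_density_def max_def)
      also have "\<dots> = (\<integral>\<^sup>+u. ?e (u - a) * ennreal (G (X (max 0 u) \<omega>)) \<partial>lborel)"
        by (rule exponential_density_nn_shift[OF q, where p="\<lambda>u. ennreal (G (X (max 0 u) \<omega>))"]) measurable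
      finally show ?thesis .
    qed
    have "(\<lambda>n. \<integral>\<^sup>+u. ?e (u - s n) * ennreal (G (X (max 0 u) \<omega>)) \<partial>lborel)
        \<longlonglongrightarrow> (\<integral>\<^sup>+u. ?e (u - s') * ennreal (G (X (max 0 u) \<omega>)) \<partial>lborel)"
    proof (rule nn_integral_dominated_convergence[where w="\<lambda>u. ennreal (exp (q * K) * B) * ?e u"])
      have K0: "0 \<le> K" using K[of 0] s(2)[of 0] by linarith
      show "AE u in lborel. ?e (u - s n) * ennreal (G (X (max 0 u) \<omega>)) \<le> ennreal (exp (q * K) * B) * ?e u" for n
      proof (rule AE_I2)
        fix u :: real
        \<comment> \<open>Source of the dominating function: delaying an exponential time by s n
          \<le> K raises its density by at most the factor e^(q K).\<close>
        have "exponential_density q (u - s n) \<le> exp (q * K) * exponential_density q u"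
        proof (cases "u - s n < 0")
          case True
          then show ?thesis using q exponential_density_nonneg[OF q, of u] by (simp add: exponential_density_def)
        next
          case False
          then have "u \<ge> 0" using s(2)[of n] by linarith
          have "exp (- (u - s n) * q) \<le> exp (q * K + - u * q)"
            using mult_left_mono[OF K[of n], of q] q by (simp add: algebra_simps)
          then have "exp (- (u - s n) * q) \<le> exp (q * K) * exp (- u * q)"
            by (simp only: exp_add)
          then have "q * exp (- (u - s n) * q) \<le> q * (exp (q * K) * exp (- u * q))"
            using q by (intro mult_left_mono) auto
          then show ?thesis using False \<open>u \<ge> 0\<close>
            by (simp add: exponential_density_def mult.left_commute)
        qed
        then have "exponential_density q (u - s n) * G (X (max 0 u) \<omega>) \<le> (exp (q * K) * exponential_density q u) * B"
          using G(2,3) exponential_density_nonneg[OF q] by (intro mult_mono) auto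
        then have "ennreal (exponential_density q (u - s n) * G (X (max 0 u) \<omega>))
            \<le> ennreal ((exp (q * K) * B) * exponential_density q u)"
          by (intro ennreal_leI) (simp add: ac_simps)
        then show "?e (u - s n) * ennreal (G (X (max 0 u) \<omega>)) \<le> ennreal (exp (q * K) * B) * ?e u"
          using G(2) B exponential_density_nonneg[OF q] by (simp add: ennreal_mult)
      qed
      \<comment> \<open>The exponential density jumps where its argument is 0, so convergence can
        fail only at u = s'.\<close>
      have "AE u in lborel. u \<noteq> s'" by (rule AE_lborel_singleton)
      then show "AE u in lborel. (\<lambda>n. ?e (u - s n) * ennreal (G (X (max 0 u) \<omega>))) \<longlonglongrightarrow> ?e (u - s') * ennreal (G (X (max 0 u) \<omega>))"
      proof eventually_elim
        case (elim u)
        have "(\<lambda>n. exponential_density q (u - s n)) \<longlonglongrightarrow> exponential_density q (u - s')"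
        proof (cases "u < s'")
          case True
          then have "eventually (\<lambda>n. u < s n) sequentially" by (rule order_tendstoD(1)[OF s(1)])
          then have "eventually (\<lambda>n. exponential_density q (u - s n) = 0) sequentially"
            by eventually_elim (simp add: exponential_density_def)
          then have "(\<lambda>n. exponential_density q (u - s n)) \<longlonglongrightarrow> 0" by (rule tendsto_eventually)
          then show ?thesis using True by (simp add: exponential_density_def)
        next
          case False
          then have "s' < u" using elim by simp
          then have "eventually (\<lambda>n. s n < u) sequentially" by (rule order_tendstoD(2)[OF s(1)])
          then have ev: "eventually (\<lambda>n. q * exp (- (u - s n) * q) = exponential_density q (u - s n)) sequentially"
            by eventually_elim (simp add: exponential_density_def)
          have "(\<lambda>n. q * exp (- (u - s n) * q)) \<longlonglongrightarrow> q * exp (- (u - s') * q)"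
            by (intro tendsto_intros s(1))
          then show ?thesis using \<open>s' < u\<close> tendsto_cong[OF ev] by (simp add: exponential_density_def)
        qed
        then show ?case
          by (intro tendsto_mult_ennreal tendsto_const tendsto_ennrealI) auto
      qed
    qed (auto simp: nn_integral_cmult total ennreal_mult_less_top)
    then show ?thesis using I_eq s(2,3) by simp
  qed
  have "(\<lambda>n. \<integral>\<^sup>+\<omega>. ennreal (disc r (S n \<omega>)) * I (enn2real (S n \<omega>)) \<omega> \<partial>M)
      \<longlonglongrightarrow> (\<integral>\<^sup>+\<omega>. ennreal (disc r (T \<omega>)) * I (enn2real (T \<omega>)) \<omega> \<partial>M)"
  proof (rule nn_integral_dominated_convergence[where w="\<lambda>_. ennreal B"])
    show "AE \<omega> in M. ennreal (disc r (S n \<omega>)) * I (enn2real (S n \<omega>)) \<omega> \<le> ennreal B" for n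
      using r mult_mono[of "ennreal (disc r (S n \<omega>))" 1 "I (enn2real (S n \<omega>)) \<omega>" "ennreal B" for \<omega>] IB
      by (auto simp: disc_le_1)
    show "AE \<omega> in M. (\<lambda>n. ennreal (disc r (S n \<omega>)) * I (enn2real (S n \<omega>)) \<omega>)
        \<longlonglongrightarrow> ennreal (disc r (T \<omega>)) * I (enn2real (T \<omega>)) \<omega>"
    proof (rule AE_I2)
      fix \<omega> assume \<omega>: "\<omega> \<in> space M"
      have d: "(\<lambda>n. ennreal (disc r (S n \<omega>))) \<longlonglongrightarrow> ennreal (disc r (T \<omega>))"
        by (intro tendsto_ennrealI disc_tendsto r lim \<omega>)
      show "(\<lambda>n. ennreal (disc r (S n \<omega>)) * I (enn2real (S n \<omega>)) \<omega>)
          \<longlonglongrightarrow> ennreal (disc r (T \<omega>)) * I (enn2real (T \<omega>)) \<omega>"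
      proof (cases "T \<omega> = \<infinity>")
        \<comment> \<open>Continuity of \<open>I\<close> says nothing here, since the times run off
          to infinity; the vanishing discount and the bound \<open>B\<close> on \<open>I\<close>
          suffice.\<close>
        case True
        have "(\<lambda>n. ennreal (disc r (S n \<omega>)) * ennreal B) \<longlonglongrightarrow> ennreal (disc r (T \<omega>)) * ennreal B"
          by (intro tendsto_mult_ennreal d tendsto_const) auto
        then have up: "(\<lambda>n. ennreal (disc r (S n \<omega>)) * ennreal B) \<longlonglongrightarrow> 0" by (simp add: True disc_def)
        have "(\<lambda>n. ennreal (disc r (S n \<omega>)) * I (enn2real (S n \<omega>)) \<omega>) \<longlonglongrightarrow> 0"
          by (rule tendsto_sandwich[OF _ _ tendsto_const up])
            (auto intro!: always_eventually mult_left_mono IB)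
        then show ?thesis by (simp add: True disc_def)
      next
        case False
        then have "(\<lambda>n. enn2real (S n \<omega>)) \<longlonglongrightarrow> enn2real (T \<omega>)"
          using lim[OF \<omega>] by (intro tendsto_enn2real) (auto simp: less_top)
        from I_cont[OF \<omega> this] have "(\<lambda>n. I (enn2real (S n \<omega>)) \<omega>) \<longlonglongrightarrow> I (enn2real (T \<omega>)) \<omega>" by simp
        moreover have "I (enn2real (T \<omega>)) \<omega> \<noteq> top" using IB[of "enn2real (T \<omega>)" \<omega>] by (auto simp: top_unique)
        ultimately show ?thesis by (intro tendsto_mult_ennreal d) auto
      qed
    qed
  qed (auto simp: emeasure_space_1 meas S)
  then have "(\<lambda>n. ennreal (expected_disc r (S n) H)) \<longlonglongrightarrow> ennreal (expected_disc r T H)"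
    by (simp add: val S)
  then have "(\<lambda>n. expected_disc r (S n) H) \<longlonglongrightarrow> expected_disc r T H"
    by (subst (asm) tendsto_ennreal_iff) (auto intro!: always_eventually expected_disc_nonneg H0)
  then show ?thesis by (simp add: H_def[abs_def])
qed

text \<open>Any pointwise convergence of times is allowed: decreasing limits will give the position
  at crossing times, increasing ones act as a substitute for quasi-left-continuity. \<open>L\<close>
  is both bound and Lipschitz constant, so differences of \<open>G\<close> are at most L min 1 |x -
  y|.\<close>

lemma expected_disc_tendsto:
  assumes S: "\<And>n. optional_time (S n)" "optional_time T" and lim: "\<And>\<omega>. \<omega> \<in> space M \<Longrightarrow> (\<lambda>n. S n \<omega>) \<longlonglongrightarrow> T \<omega>"
    and r: "r > 0"
    and G: "\<And>x. 0 \<le> G x" "\<And>x. G x \<le> L" and lip: "\<And>x y. \<bar>G x - G y\<bar> \<le> L * \<bar>x - y\<bar>"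
  shows "(\<lambda>n. expected_disc r (S n) G) \<longlonglongrightarrow> expected_disc r T G"
proof (rule LIMSEQ_I)
  fix e :: real assume e: "e > 0"
  have L: "0 \<le> L" using G order_trans by blast
  have Gm: "G \<in> borel_measurable borel" using lip by (rule borel_measurable_lipschitz)
  have GL: "\<bar>G x\<bar> \<le> L" for x using G[of x] by simp
  have lip1: "\<bar>G x - G y\<bar> \<le> L * min 1 \<bar>x - y\<bar>" for x y
    using lip[of x y] G[of x] G[of y] by (auto simp: min_def)
  have "(\<lambda>n. L * (LINT y|exp_law (real n + 1). min 1 \<bar>y\<bar>)) \<longlonglongrightarrow> L * 0"
    by (intro tendsto_mult_left exp_law_concentrates) (simp, real_asymp)
  then have "eventually (\<lambda>n. L * (LINT y|exp_law (real n + 1). min 1 \<bar>y\<bar>) < e / 4) sequentially"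
    using e by (intro order_tendstoD(2)) auto
  then obtain m :: nat where m: "L * (LINT y|exp_law (real m + 1). min 1 \<bar>y\<bar>) < e / 4"
    using eventually_happens'[OF sequentially_bot] by blast
  define q where "q = real m + 1"
  have q: "q > 0" by (simp add: q_def)
  interpret Q: real_law "exp_law q" by (rule real_law_exp_law[OF q])
  define H where "H x = (LINT y|exp_law q. G (x + y))" for x
  have int: "integrable (exp_law q) (\<lambda>y. G (x + y))" for x
    using G by (intro Q.integrable_bounded[OF Gm, where B=L]) (auto simp: abs_of_nonneg)
  have "0 \<le> H x" "H x \<le> L" for x
    unfolding H_def using G int by (auto intro!: integral_nonneg_AE Q.integral_le_const)
  then have HL: "\<bar>H x\<bar> \<le> L" for x using abs_of_nonneg by metis
  have Hm: "H \<in> borel_measurable borel" unfolding H_def[abs_def] using Gm by measurable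
  \<comment> \<open>The smoothing error is uniform in the starting point, so one rate
    \<open>q\<close> works for all optional times. Two such errors and the distance of the smoothed
    expectations add up to less than e.\<close>
  have close: "\<bar>expected_disc r U H - expected_disc r U G\<bar> \<le> e / 4" if U: "optional_time U" for U
  proof -
    have "expected_disc r U H - expected_disc r U G = (LINT \<omega>|M. disc r (U \<omega>) * H (XS U \<omega>) - disc r (U \<omega>) * G (XS U \<omega>))"
      unfolding expected_disc_def
      by (rule Bochner_Integration.integral_diff[symmetric]) (rule integrable_disc[OF U r Hm HL] integrable_disc[OF U r Gm GL])+
    also have "\<bar>\<dots>\<bar> \<le> (LINT \<omega>|M. \<bar>disc r (U \<omega>) * H (XS U \<omega>) - disc r (U \<omega>) * G (XS U \<omega>)\<bar>)"
      by (rule integral_abs_bound)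
    also have "\<dots> \<le> e / 4"
    proof (rule integral_le_const)
      show "integrable M (\<lambda>\<omega>. \<bar>disc r (U \<omega>) * H (XS U \<omega>) - disc r (U \<omega>) * G (XS U \<omega>)\<bar>)"
        by (intro integrable_abs Bochner_Integration.integrable_diff integrable_disc[OF U r Hm HL] integrable_disc[OF U r Gm GL])
      show "AE \<omega> in M. \<bar>disc r (U \<omega>) * H (XS U \<omega>) - disc r (U \<omega>) * G (XS U \<omega>)\<bar> \<le> e / 4"
      proof (rule AE_I2)
        fix \<omega>
        have "\<bar>H (XS U \<omega>) - G (XS U \<omega>)\<bar> \<le> e / 4"
          using Q.average_diff_le[OF Gm GL lip1, of "XS U \<omega>"] m by (simp add: H_def q_def)
        then have "disc r (U \<omega>) * \<bar>H (XS U \<omega>) - G (XS U \<omega>)\<bar> \<le> 1 * (e / 4)"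
          using r by (intro mult_mono) (auto simp: disc_le_1)
        then show "\<bar>disc r (U \<omega>) * H (XS U \<omega>) - disc r (U \<omega>) * G (XS U \<omega>)\<bar> \<le> e / 4"
          by (simp add: abs_mult flip: right_diff_distrib)
      qed
    qed
    finally show ?thesis .
  qed
  have "(\<lambda>n. expected_disc r (S n) H) \<longlonglongrightarrow> expected_disc r T H"
    unfolding H_def[abs_def] by (rule expected_disc_exp_law_tendsto[OF S lim r q Gm G])
  then obtain N where N: "\<And>n. n \<ge> N \<Longrightarrow> \<bar>expected_disc r (S n) H - expected_disc r T H\<bar> < e / 4"
    using e by (metis LIMSEQ_D real_norm_def zero_less_divide_iff zero_less_numeral)
  have "norm (expected_disc r (S n) G - expected_disc r T G) < e" if "n \<ge> N" for n
    using N[OF that] close[OF S(1)[of n]] close[OF S(2)] unfolding real_norm_def by linarith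
  then show "\<exists>N. \<forall>n\<ge>N. norm (expected_disc r (S n) G - expected_disc r T G) < e" by blast
qed

lemma optional_crossing:
  assumes "countable D" "D \<subseteq> {0..}"
  shows "optional_time (crossing_time X D a)"
  by (rule stopping_time_crossing[OF filt assms adapted])

text \<open>The excess over \<open>a\<close>, clipped to [0, 1], is Lipschitz and vanishes at the
  crossing times of finite parts of \<open>D\<close>. Its discounted expectation therefore vanishes
  in the limit as well; of the strict inequality only \<le> survives.\<close>

lemma crossing_level:
  assumes D: "countable D" "D \<subseteq> {0..}" "D \<noteq> {}"
  shows "AE \<omega> in M. crossing_time X D a \<omega> < \<infinity> \<longrightarrow> XS (crossing_time X D a) \<omega> \<le> a"
proof -
  let ?D = "\<lambda>m. from_nat_into D ` {..m}"
  have Dm: "countable (?D m)" "?D m \<subseteq> {0..}" for m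
    using from_nat_into[OF D(3)] D(2) by auto
  define H where "H y = min 1 (max 0 (y - a))" for y
  have H: "0 \<le> H y" "H y \<le> 1" "\<bar>H y - H z\<bar> \<le> 1 * \<bar>y - z\<bar>" for y z
    unfolding H_def by (simp_all add: min_def max_def abs_if)
  have "(\<lambda>m. expected_disc 1 (crossing_time X (?D m) a) H) \<longlonglongrightarrow> expected_disc 1 (crossing_time X D a) H"
    by (rule expected_disc_tendsto[where L=1, OF optional_crossing[OF Dm] optional_crossing[OF D(1,2)]
          crossing_time_finite_approx[OF D(1,3)]])
      (use H in auto)
  moreover have "expected_disc 1 (crossing_time X (?D m) a) H = 0" for m
  proof -
    have *: "disc 1 (crossing_time X (?D m) a \<omega>) * H (XS (crossing_time X (?D m) a) \<omega>) = 0" for \<omega>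
      using crossing_time_attained[of "?D m" X a \<omega>] Dm
      by (auto simp: disc_def H_def XS_def less_top)
    show ?thesis unfolding expected_disc_def * by simp
  qed
  ultimately have "expected_disc 1 (crossing_time X D a) H = 0"
    by (simp add: LIMSEQ_const_iff)
  then have "AE \<omega> in M. crossing_time X D a \<omega> < \<infinity> \<longrightarrow> H (XS (crossing_time X D a) \<omega>) = 0"
    by (intro expected_disc_eq_0D[where B=1 and r=1] optional_crossing D)
      (use H borel_measurable_lipschitz[OF H(3)] in auto)
  then show ?thesis
    by (rule AE_mp) (auto simp: H_def)
qed

end

section \<open>The value function as a limit of penalized problems\<close>

context strong_levy
begin

text \<open>Averages over two laws on the line commute by Fubini, hence the two forms. The first
  identifies a penalized value as a potential, the second compares different penalty rates.\<close>

lemma exp_law_resolvent_real: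
  assumes r: "r > 0" and l: "l > 0" and G: "g \<in> borel_measurable borel" "\<And>x. 0 \<le> g x" "\<And>x. g x \<le> B"
  shows "l * (LINT y|exp_law r. (LINT z|exp_law (r + l). g (y + z))) + r * (LINT y|exp_law (r + l). g y)
      = (r + l) * (LINT y|exp_law r. g y)"
    and "l * (LINT z|exp_law (r + l). (LINT y|exp_law r. g (z + y))) + r * (LINT y|exp_law (r + l). g y)
      = (r + l) * (LINT y|exp_law r. g y)"
proof -
  note [measurable] = G(1)
  have q: "r + l > 0" using r l by simp
  interpret R: real_law "exp_law r" by (rule real_law_exp_law[OF r])
  interpret Q: real_law "exp_law (r + l)" by (rule real_law_exp_law[OF q])
  interpret P: pair_prob_space "exp_law r" "exp_law (r + l)" ..
  have nn: "(\<integral>\<^sup>+y. ennreal (h (x + y)) \<partial>exp_law a) = ennreal (LINT y|exp_law a. h (x + y))"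
    and le: "(LINT y|exp_law a. h (x + y)) \<le> B" and ge: "0 \<le> (LINT y|exp_law a. h (x + y))"
    if a: "a > 0" and h: "h \<in> borel_measurable borel" "\<And>x. 0 \<le> h x" "\<And>x. h x \<le> B" for a x h
  proof -
    interpret A: real_law "exp_law a" by (rule real_law_exp_law[OF a])
    have int: "integrable (exp_law a) (\<lambda>y. h (x + y))"
      using h by (intro A.integrable_bounded[where B=B]) (auto simp: abs_of_nonneg)
    then show "(\<integral>\<^sup>+y. ennreal (h (x + y)) \<partial>exp_law a) = ennreal (LINT y|exp_law a. h (x + y))"
      using h by (intro nn_integral_eq_integral) auto
    show "(LINT y|exp_law a. h (x + y)) \<le> B" using h int by (intro A.integral_le_const) auto
    show "0 \<le> (LINT y|exp_law a. h (x + y))" using h by (intro integral_nonneg_AE) auto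
  qed
  have nn0: "(\<integral>\<^sup>+y. ennreal (h y) \<partial>exp_law a) = ennreal (LINT y|exp_law a. h y)"
    if "a > 0" "h \<in> borel_measurable borel" "\<And>x. 0 \<le> h x" "\<And>x. h x \<le> B" for a h
    using nn[OF that, of 0] by simp
  let ?q = "\<lambda>y. LINT z|exp_law (r + l). g (y + z)" and ?r = "\<lambda>z. LINT y|exp_law r. g (z + y)"
  have [measurable]: "?q \<in> borel_measurable borel" "?r \<in> borel_measurable borel" by measurable
  have qr: "(\<integral>\<^sup>+y. (\<integral>\<^sup>+z. ennreal (g (y + z)) \<partial>exp_law (r + l)) \<partial>exp_law r) = ennreal (LINT y|exp_law r. ?q y)"
    using le[OF q G] ge[OF q G] by (simp add: nn[OF q G] nn0[OF r])
  have rq: "(\<integral>\<^sup>+z. (\<integral>\<^sup>+y. ennreal (g (z + y)) \<partial>exp_law r) \<partial>exp_law (r + l)) = ennreal (LINT z|exp_law (r + l). ?r z)"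
    using le[OF r G] ge[OF r G] by (simp add: nn[OF r G] nn0[OF q])
  have swap: "(\<integral>\<^sup>+y. (\<integral>\<^sup>+z. ennreal (g (y + z)) \<partial>exp_law (r + l)) \<partial>exp_law r)
      = (\<integral>\<^sup>+z. (\<integral>\<^sup>+y. ennreal (g (z + y)) \<partial>exp_law r) \<partial>exp_law (r + l))"
    by (subst P.Fubini') (auto simp: add.commute)
  have I0: "0 \<le> (LINT y|exp_law r. ?q y)" "0 \<le> (LINT z|exp_law (r + l). ?r z)"
    "0 \<le> (LINT y|exp_law (r + l). g y)" "0 \<le> (LINT y|exp_law r. g y)"
    using ge[OF q G] ge[OF r G] G by (auto intro!: integral_nonneg_AE)
  have "ennreal (l * (LINT y|exp_law r. ?q y) + r * (LINT y|exp_law (r + l). g y))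
      = ennreal ((r + l) * (LINT y|exp_law r. g y))"
    using exp_law_resolvent[OF r l, of "\<lambda>x. ennreal (g x)"] I0 r l
    by (simp add: qr nn0[OF q G] nn0[OF r G] ennreal_mult)
  then show eq: "l * (LINT y|exp_law r. ?q y) + r * (LINT y|exp_law (r + l). g y) = (r + l) * (LINT y|exp_law r. g y)"
    using I0 r l by (subst (asm) ennreal_inj) auto
  have "(LINT y|exp_law r. ?q y) = (LINT z|exp_law (r + l). ?r z)"
    using swap I0 unfolding qr rq by (subst (asm) ennreal_inj) auto
  then show "l * (LINT z|exp_law (r + l). ?r z) + r * (LINT y|exp_law (r + l). g y) = (r + l) * (LINT y|exp_law r. g y)"
    using eq by simp
qed

text \<open>One separating set is fixed for all levels. It is required to be nonempty so that it can
  be enumerated by \<open>from_nat_into\<close>; adding time 0 arranges this.\<close>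

definition separant :: "real set" where
  "separant = (SOME D. countable D \<and> D \<subseteq> {0..} \<and> D \<noteq> {} \<and>
     (AE \<omega> in M. \<forall>t\<ge>0. \<forall>e>0. \<exists>s\<in>D. \<bar>s - t\<bar> < e \<and> \<bar>X s \<omega> - X t \<omega>\<bar> < e))"

lemma separant: "countable separant" "separant \<subseteq> {0..}" "separant \<noteq> {}"
  "AE \<omega> in M. \<forall>t\<ge>0. \<forall>e>0. \<exists>s\<in>separant. \<bar>s - t\<bar> < e \<and> \<bar>X s \<omega> - X t \<omega>\<bar> < e"
proof -
  obtain D where D: "countable D" "D \<subseteq> {0..}"
    "AE \<omega> in M. \<forall>t\<ge>0. \<forall>e>0. \<exists>s\<in>D. \<bar>s - t\<bar> < e \<and> \<bar>X s \<omega> - X t \<omega>\<bar> < e"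
    using strong_markov unfolding strong_markov_process_def separable_process_def by blast
  have "AE \<omega> in M. \<forall>t\<ge>0. \<forall>e>0. \<exists>s\<in>insert 0 D. \<bar>s - t\<bar> < e \<and> \<bar>X s \<omega> - X t \<omega>\<bar> < e"
    using D(3) by (rule AE_mp) (auto 0 3)
  then have "\<exists>D. countable D \<and> D \<subseteq> {0..} \<and> D \<noteq> {} \<and>
     (AE \<omega> in M. \<forall>t\<ge>0. \<forall>e>0. \<exists>s\<in>D. \<bar>s - t\<bar> < e \<and> \<bar>X s \<omega> - X t \<omega>\<bar> < e)"
    using D by (intro exI[of _ "insert 0 D"]) auto
  from someI_ex[OF this]
  show "countable separant" "separant \<subseteq> {0..}" "separant \<noteq> {}"
    "AE \<omega> in M. \<forall>t\<ge>0. \<forall>e>0. \<exists>s\<in>separant. \<bar>s - t\<bar> < e \<and> \<bar>X s \<omega> - X t \<omega>\<bar> < e"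
    unfolding separant_def by blast+
qed

abbreviation crossing :: "real \<Rightarrow> 'a \<Rightarrow> ennreal" where
  "crossing \<equiv> crossing_time X separant"

text \<open>If \<open>X u\<close> lies strictly below \<open>a\<close>, separability yields a time
  of \<open>separant\<close> close to \<open>u\<close>, hence still before the crossing, with a
  value still below \<open>a\<close>. The exceptional set is that of separability, so it serves all
  levels at once.\<close>

lemma before_crossing: "AE \<omega> in M. \<forall>a. \<forall>u\<ge>0. ennreal u < crossing a \<omega> \<longrightarrow> a \<le> X u \<omega>"
  using separant(4)
proof eventually_elim
  case (elim \<omega>)
  show ?case
  proof (intro allI impI)
    fix a u :: real assume u: "0 \<le> u" "ennreal u < crossing a \<omega>"
    show "a \<le> X u \<omega>"
    proof (rule ccontr)
      assume "\<not> a \<le> X u \<omega>"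
      obtain d where d: "d > 0" "ennreal (u + d) \<le> crossing a \<omega>"
      proof (cases "crossing a \<omega>" rule: ennreal_cases)
        case (real s)
        then have "u < s" using u by (simp add: ennreal_less_iff)
        then show ?thesis using that[of "s - u"] real by simp
      qed (use that[of 1] in auto)
      have "min d (a - X u \<omega>) > 0" using d \<open>\<not> a \<le> X u \<omega>\<close> by simp
      with elim u(1) obtain s where s: "s \<in> separant" "\<bar>s - u\<bar> < min d (a - X u \<omega>)"
        "\<bar>X s \<omega> - X u \<omega>\<bar> < min d (a - X u \<omega>)" by blast
      then have "X s \<omega> < a" "s < u + d" by linarith+
      moreover have "0 \<le> s" using s(1) separant(2) by auto
      ultimately have "crossing a \<omega> \<le> ennreal s" "ennreal s < ennreal (u + d)"
        using s(1) unfolding crossing_time_def by (auto intro!: INF_lower simp: ennreal_less_iff)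
      then show False using d(2) by (meson leD le_less_trans order_trans)
    qed
  qed
qed

end

section \<open>Penalized values of the put and their limit\<close>

locale put_problem = strong_levy M F X
  for M :: "'a measure" and F :: "ennreal \<Rightarrow> 'a measure" and X :: "real \<Rightarrow> 'a \<Rightarrow> real" +
  fixes r c \<alpha> :: real
  assumes r: "r > 0" and c: "c > 0" and alpha: "\<alpha> > 0"
    and supp: "\<And>t. t > 0 \<Longrightarrow> measure_support (distr M borel (X t)) = UNIV"
begin

definition payoff :: "real \<Rightarrow> real" where
  "payoff x = max 0 (c - \<alpha> * exp x)"

lemma payoff_class: "payoff_class c payoff"
  unfolding payoff_def[abs_def] using c alpha by (rule payoff_class_put)

text \<open>Index \<open>n\<close> stands for the Poisson rate n + 1, so that the rate is never 0.
  The prefactor is the probability that a Poisson point arrives before an independent killing time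
  of rate \<open>r\<close>.\<close>

definition pen_value :: "nat \<Rightarrow> real \<Rightarrow> real" where
  "pen_value n = (SOME w. payoff_class c w \<and>
     (\<forall>x. w x = (real n + 1) / (r + (real n + 1)) *
        (LINT y|exp_law (r + (real n + 1)). max (w (x + y)) (payoff (x + y)))))"

lemma rate_pos: "r + (real n + 1) > 0"
  using r by simp

lemma pen_value_class: "payoff_class c (pen_value n)"
  and pen_value_eq: "pen_value n x = (real n + 1) / (r + (real n + 1)) *
        (LINT y|exp_law (r + (real n + 1)). max (pen_value n (x + y)) (payoff (x + y)))"
proof -
  interpret Q: real_law "exp_law (r + (real n + 1))" by (rule real_law_exp_law[OF rate_pos])
  have "0 \<le> (real n + 1) / (r + (real n + 1))" "(real n + 1) / (r + (real n + 1)) \<le> 1"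
    using r by auto
  from someI_ex[OF Q.penalized_value_exists[OF payoff_class this]]
  show "payoff_class c (pen_value n)" "pen_value n x = (real n + 1) / (r + (real n + 1)) *
        (LINT y|exp_law (r + (real n + 1)). max (pen_value n (x + y)) (payoff (x + y)))"
    unfolding pen_value_def by blast+
qed

definition penalty :: "nat \<Rightarrow> real \<Rightarrow> real" where
  "penalty n x = (real n + 1) * max 0 (payoff x - pen_value n x)"

lemma penalty_measurable: "penalty n \<in> borel_measurable borel"
  unfolding penalty_def[abs_def]
  using payoff_class_measurable[OF payoff_class] payoff_class_measurable[OF pen_value_class] by measurable

lemma penalty_nonneg: "0 \<le> penalty n x" and penalty_le: "penalty n x \<le> (real n + 1) * c"
proof -
  show "0 \<le> penalty n x" by (simp add: penalty_def)
  have "max 0 (payoff x - pen_value n x) \<le> c"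
    using payoff_classD(1)[OF pen_value_class, of n x] payoff_classD(2)[OF payoff_class, of x] c by simp
  then show "penalty n x \<le> (real n + 1) * c"
    unfolding penalty_def by (intro mult_left_mono) auto
qed

text \<open>Let l = n + 1, g = max (w, p), and let R, Q be the averages at rates r and r + l. The
  equation for w reads Q g = (r + l) / l w; inserted into l R Q g + r Q g = (r + l) R g it gives r w
  = R (l (g - w)), and l (g - w) is the penalty.\<close>

lemma pen_value_potential: "pen_value n x = (LINT y|exp_law r. penalty n (x + y)) / r"
proof -
  define l where "l = real n + 1"
  have l: "l > 0" by (simp add: l_def)
  interpret R: real_law "exp_law r" by (rule real_law_exp_law[OF r])
  define g where "g y = max (pen_value n (x + y)) (payoff (x + y))" for y
  note gc = payoff_class_max[OF pen_value_class payoff_class]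
  have [measurable]: "g \<in> borel_measurable borel"
    unfolding g_def[abs_def] using payoff_class_measurable[OF gc] by measurable
  have g: "0 \<le> g y" "g y \<le> c" for y
    unfolding g_def using payoff_classD(1,2)[OF gc] by auto
  have w: "(LINT z|exp_law (r + l). g (y + z)) = (r + l) / l * pen_value n (x + y)" for y
    using pen_value_eq[of n "x + y"] l r by (simp add: g_def l_def add.assoc field_simps)
  have int: "integrable (exp_law r) (\<lambda>y. pen_value n (x + y))" "integrable (exp_law r) g"
    using R.integrable_class[OF pen_value_class] R.integrable_class[OF gc] by (auto simp: g_def[abs_def])
  define I J where "I = (LINT y|exp_law r. pen_value n (x + y))" and "J = (LINT y|exp_law r. g y)"
  define k where "k = (r + l) / l"
  have k: "r + l = k * l" "k \<noteq> 0" using r l by (auto simp: k_def)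
  have "l * (k * I) + r * (k * pen_value n x) = (r + l) * J"
    using exp_law_resolvent_real(1)[OF r l, of g c] g w[of 0] by (simp add: w I_def J_def flip: k_def)
  then have "k * (l * I + r * pen_value n x) = k * (l * J)"
    unfolding k(1) by (simp add: algebra_simps)
  then have "l * I + r * pen_value n x = l * J" using k(2) by simp
  then have "r * pen_value n x = l * ((LINT y|exp_law r. g y) - (LINT y|exp_law r. pen_value n (x + y)))"
    by (simp add: I_def J_def algebra_simps)
  also have "\<dots> = (LINT y|exp_law r. l * (g y - pen_value n (x + y)))"
    using int by simp
  also have "\<dots> = (LINT y|exp_law r. penalty n (x + y))"
    by (intro Bochner_Integration.integral_cong) (auto simp: g_def penalty_def l_def max_def)
  finally show ?thesis using r by (simp add: field_simps)
qed

text \<open>The value w for the smaller rate is a subsolution of the equation for the larger rate l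
  = m + 1: the resolvent equation for its penalty gives (r + l) w = Q (l w + penalty), and n \<le> m
  bounds the integrand by l max (w, p). Comparison then concludes.\<close>

lemma pen_value_mono: "n \<le> m \<Longrightarrow> pen_value n x \<le> pen_value m x"
proof -
  assume nm: "n \<le> m"
  define l where "l = real m + 1"
  have l: "l > 0" by (simp add: l_def)
  have q: "r + l > 0" using r l by simp
  interpret R: real_law "exp_law r" by (rule real_law_exp_law[OF r])
  interpret Q: real_law "exp_law (r + l)" by (rule real_law_exp_law[OF q])
  note gc = payoff_class_max[OF pen_value_class payoff_class]
  have sub: "pen_value n x \<le> l / (r + l) * (LINT y|exp_law (r + l). max (pen_value n (x + y)) (payoff (x + y)))" for x
  proof -
    have [measurable]: "(\<lambda>y. penalty n (x + y)) \<in> borel_measurable borel"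
      using penalty_measurable by measurable
    have int: "integrable (exp_law (r + l)) (\<lambda>y. penalty n (x + y))"
      using penalty_nonneg penalty_le by (intro Q.integrable_bounded[OF penalty_measurable]) (auto simp: abs_of_nonneg)
    have w: "(LINT y|exp_law r. penalty n (x + (z + y))) = r * pen_value n (x + z)" for z
      using pen_value_potential[of n "x + z"] r by (simp add: add.assoc)
    have "l * (LINT z|exp_law (r + l). r * pen_value n (x + z)) + r * (LINT y|exp_law (r + l). penalty n (x + y))
        = (r + l) * (r * pen_value n x)"
      using exp_law_resolvent_real(2)[OF r l, of "\<lambda>y. penalty n (x + y)" "(real n + 1) * c"]
        penalty_nonneg penalty_le w[of 0] by (simp add: w)
    then have "r * ((r + l) * pen_value n x)
        = r * (l * (LINT z|exp_law (r + l). pen_value n (x + z)) + (LINT y|exp_law (r + l). penalty n (x + y)))"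
      by (simp add: algebra_simps)
    then have "(r + l) * pen_value n x
        = l * (LINT z|exp_law (r + l). pen_value n (x + z)) + (LINT y|exp_law (r + l). penalty n (x + y))"
      using r by simp
    also have "\<dots> = (LINT y|exp_law (r + l). l * pen_value n (x + y) + penalty n (x + y))"
      using int Q.integrable_class[OF pen_value_class, of n x] by simp
    also have "\<dots> \<le> (LINT y|exp_law (r + l). l * max (pen_value n (x + y)) (payoff (x + y)))"
    proof (rule integral_mono)
      fix y
      have "penalty n (x + y) \<le> l * max 0 (payoff (x + y) - pen_value n (x + y))"
        unfolding penalty_def l_def using nm by (intro mult_right_mono) auto
      also have "\<dots> = l * max (pen_value n (x + y)) (payoff (x + y)) - l * pen_value n (x + y)"
        by (simp add: max_def algebra_simps)
      finally show "l * pen_value n (x + y) + penalty n (x + y) \<le> l * max (pen_value n (x + y)) (payoff (x + y))"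
        by simp
    qed (use int Q.integrable_class[OF pen_value_class, of n x] Q.integrable_class[OF gc, of n x] in auto)
    also have "\<dots> = l * (LINT y|exp_law (r + l). max (pen_value n (x + y)) (payoff (x + y)))"
      by simp
    finally show ?thesis using q by (simp add: field_simps)
  qed
  have sup: "l / (r + l) * (LINT y|exp_law (r + l). max (pen_value m (x + y)) (payoff (x + y))) \<le> pen_value m x" for x
    unfolding l_def by (rule eq_refl[OF pen_value_eq[symmetric]])
  show ?thesis
    by (rule Q.average_max_le[OF pen_value_class pen_value_class payoff_class sub sup]) (use r l in auto)
qed

definition val :: "real \<Rightarrow> real" where
  "val x = lim (\<lambda>n. pen_value n x)"

lemma pen_value_tendsto: "(\<lambda>n. pen_value n x) \<longlonglongrightarrow> val x"
proof -
  have "convergent (\<lambda>n. pen_value n x)"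
  proof (rule Bseq_mono_convergent)
    show "Bseq (\<lambda>n. pen_value n x)"
      using payoff_classD(1,2)[OF pen_value_class] by (intro BseqI'[where K=c]) simp
  qed (use pen_value_mono in auto)
  then show ?thesis by (simp add: val_def convergent_LIMSEQ_iff)
qed

lemma val_class: "payoff_class c val"
  by (rule payoff_class_lim[OF pen_value_class pen_value_tendsto])

lemma val_measurable [measurable]: "val \<in> borel_measurable borel"
  by (rule payoff_class_measurable[OF val_class])

lemma pen_value_le_val: "pen_value n x \<le> val x"
  by (rule LIMSEQ_le_const[OF pen_value_tendsto]) (use pen_value_mono in auto)

lemma payoff_average_le_pen_value:
  "(real n + 1) / (r + (real n + 1)) * (LINT y|exp_law (r + (real n + 1)). payoff (x + y)) \<le> pen_value n x"
proof -
  interpret Q: real_law "exp_law (r + (real n + 1))" by (rule real_law_exp_law[OF rate_pos])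
  have "(LINT y|exp_law (r + (real n + 1)). payoff (x + y))
      \<le> (LINT y|exp_law (r + (real n + 1)). max (pen_value n (x + y)) (payoff (x + y)))"
    using Q.integrable_class[OF payoff_class] Q.integrable_class[OF payoff_class_max[OF pen_value_class payoff_class]]
    by (intro integral_mono) auto
  then show ?thesis
    using r by (subst pen_value_eq) (intro mult_left_mono, auto)
qed

text \<open>Stopping at the first Poisson point earns nearly p(x), because at high rates this point
  comes almost at once and X has hardly moved.\<close>

lemma payoff_le_val: "payoff x \<le> val x"
proof -
  let ?q = "\<lambda>n. r + (real n + 1)"
  have lip: "\<bar>payoff x - payoff y\<bar> \<le> c * min 1 \<bar>x - y\<bar>" for x y
    using payoff_classD(3)[OF payoff_class, of x y] payoff_classD(1,2)[OF payoff_class, of x]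
      payoff_classD(1,2)[OF payoff_class, of y] by (auto simp: min_def)
  have "(\<lambda>n. (LINT y|exp_law (?q n). payoff (x + y)) - payoff x) \<longlonglongrightarrow> 0"
  proof (rule Lim_null_comparison)
    show "eventually (\<lambda>n. norm ((LINT y|exp_law (?q n). payoff (x + y)) - payoff x)
        \<le> c * (LINT y|exp_law (?q n). min 1 \<bar>y\<bar>)) sequentially"
    proof (intro always_eventually allI)
      fix n
      interpret Q: real_law "exp_law (?q n)" by (rule real_law_exp_law[OF rate_pos])
      show "norm ((LINT y|exp_law (?q n). payoff (x + y)) - payoff x) \<le> c * (LINT y|exp_law (?q n). min 1 \<bar>y\<bar>)"
        using Q.average_diff_le[OF payoff_class_measurable[OF payoff_class] _ lip] payoff_classD(1,2)[OF payoff_class]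
        by simp
    qed
    have "filterlim ?q at_top sequentially" by real_asymp
    then have "(\<lambda>n. c * (LINT y|exp_law (?q n). min 1 \<bar>y\<bar>)) \<longlonglongrightarrow> c * 0"
      by (intro tendsto_mult_left exp_law_concentrates rate_pos)
    then show "(\<lambda>n. c * (LINT y|exp_law (?q n). min 1 \<bar>y\<bar>)) \<longlonglongrightarrow> 0" by simp
  qed
  then have "(\<lambda>n. LINT y|exp_law (?q n). payoff (x + y)) \<longlonglongrightarrow> payoff x"
    by (rule LIM_zero_cancel)
  moreover have "(\<lambda>n. (real n + 1) / ?q n) \<longlonglongrightarrow> 1" by real_asymp
  ultimately have "(\<lambda>n. (real n + 1) / ?q n * (LINT y|exp_law (?q n). payoff (x + y))) \<longlonglongrightarrow> 1 * payoff x"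
    by (intro tendsto_mult)
  from LIMSEQ_le[OF this pen_value_tendsto[of x]] show ?thesis
    using payoff_average_le_pen_value by auto
qed

text \<open>Already the value for rate 1 is positive: the payoff is positive below ln (c /
  \<alpha>), and X at an exponential time falls below any level with positive probability.\<close>

lemma val_pos: "0 < val x"
proof -
  interpret Q: real_law "exp_law (r + (real 0 + 1))" by (rule real_law_exp_law[OF rate_pos])
  have "(LINT y|exp_law (r + (real 0 + 1)). payoff (x + y)) \<noteq> 0"
  proof
    assume "(LINT y|exp_law (r + (real 0 + 1)). payoff (x + y)) = 0"
    then have "AE y in exp_law (r + (real 0 + 1)). payoff (x + y) = 0"
      by (subst (asm) integral_nonneg_eq_0_iff_AE)
        (use Q.integrable_class[OF payoff_class] payoff_classD(1)[OF payoff_class] in auto)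
    then have "AE y in exp_law (r + (real 0 + 1)). y \<notin> {..<ln (c / \<alpha>) - x}"
    proof (rule AE_mp, intro AE_I2 impI notI)
      fix y assume "payoff (x + y) = 0" "y \<in> {..<ln (c / \<alpha>) - x}"
      moreover then have "exp (x + y) < c / \<alpha>"
        using c alpha by (metis add.commute divide_pos_pos exp_less_mono exp_ln lessThan_iff less_diff_eq)
      ultimately show False using alpha by (simp add: payoff_def field_simps max_def split: if_splits)
    qed
    then have "emeasure (exp_law (r + (real 0 + 1))) {..<ln (c / \<alpha>) - x} = 0"
      by (subst (asm) AE_iff_measurable[of "{..<ln (c / \<alpha>) - x}"]) auto
    moreover have "emeasure (exp_law (r + (real 0 + 1))) {..<ln (c / \<alpha>) - x} > 0"
      by (rule exp_law_neg[OF supp rate_pos])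
    ultimately show False by simp
  qed
  moreover have "0 \<le> (LINT y|exp_law (r + (real 0 + 1)). payoff (x + y))"
    using payoff_classD(1)[OF payoff_class] by (intro integral_nonneg_AE) auto
  ultimately have "0 < (real 0 + 1) / (r + (real 0 + 1)) * (LINT y|exp_law (r + (real 0 + 1)). payoff (x + y))"
    using r by simp
  also have "\<dots> \<le> pen_value 0 x" by (rule payoff_average_le_pen_value)
  also have "\<dots> \<le> val x" by (rule pen_value_le_val)
  finally show ?thesis .
qed

lemma expected_pen_value_tendsto:
  assumes S: "optional_time S"
  shows "(\<lambda>n. expected_disc r S (\<lambda>y. pen_value n (x + y))) \<longlonglongrightarrow> expected_disc r S (\<lambda>y. val (x + y))"
  unfolding expected_disc_def
proof (rule integral_dominated_convergence[where w="\<lambda>_. c"])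
  note [measurable] = optional_measurable[OF S] XS_measurable[OF S] payoff_class_measurable[OF pen_value_class]
  show "(\<lambda>\<omega>. disc r (S \<omega>) * val (x + XS S \<omega>)) \<in> borel_measurable M" by measurable
  show "(\<lambda>\<omega>. disc r (S \<omega>) * pen_value n (x + XS S \<omega>)) \<in> borel_measurable M" for n by measurable
  have "disc r s * pen_value n y \<le> 1 * c" for s n y
    using r payoff_classD(1,2)[OF pen_value_class] by (intro mult_mono) (auto simp: disc_le_1)
  then show "AE \<omega> in M. norm (disc r (S \<omega>) * pen_value n (x + XS S \<omega>)) \<le> c" for n
    using payoff_classD(1)[OF pen_value_class] by (simp add: abs_mult)
qed (auto intro!: tendsto_mult_left pen_value_tendsto)

lemma expected_val_le:
  assumes S: "optional_time S"
  shows "expected_disc r S (\<lambda>y. val (x + y)) \<le> val x"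
proof (rule LIMSEQ_le_const2[OF expected_pen_value_tendsto[OF S]], intro exI allI impI)
  fix n :: nat
  have "expected_disc r S (\<lambda>y. pen_value n (x + y)) \<le> pen_value n x"
    by (rule expected_disc_potential_le[OF S r penalty_measurable[of n] penalty_nonneg penalty_le
        pen_value_potential[of n]])
  then show "expected_disc r S (\<lambda>y. pen_value n (x + y)) \<le> val x"
    by (rule order_trans[OF _ pen_value_le_val])
qed

text \<open>Strictness at the single point \<open>b\<close> suffices: the exponential inequality of
  \<open>payoff_class\<close> carries the bound by \<alpha> e^b on c - \<open>pen_value n b\<close>
  over to every y \<ge> b, with \<alpha> e^y in place of \<alpha> e^b. Hence one \<open>N\<close>
  serves the whole half-line.\<close>

lemma penalty_vanishes:
  assumes b: "c - \<alpha> * exp b < val b"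
  shows "\<exists>N. \<forall>n\<ge>N. \<forall>y\<ge>b. penalty n y = 0"
proof -
  have "eventually (\<lambda>n. c - \<alpha> * exp b < pen_value n b) sequentially"
    by (rule order_tendstoD(1)[OF pen_value_tendsto b])
  then obtain N where N: "\<And>n. n \<ge> N \<Longrightarrow> c - \<alpha> * exp b < pen_value n b"
    by (auto simp: eventually_sequentially)
  have "payoff y \<le> pen_value n y" if "n \<ge> N" "y \<ge> b" for n y
  proof -
    have "c - pen_value n y \<le> exp (y - b) * (c - pen_value n b)"
      by (rule payoff_classD(4)[OF pen_value_class that(2)])
    also have "\<dots> \<le> exp (y - b) * (\<alpha> * exp b)"
      using N[OF that(1)] by (intro mult_left_mono) auto
    also have "\<dots> = \<alpha> * exp y" by (simp add: exp_diff)
    finally show ?thesis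
      using payoff_classD(1)[OF pen_value_class, of n y] by (simp add: payoff_def)
  qed
  then show ?thesis by (intro exI[of _ N]) (auto simp: penalty_def)
qed

text \<open>Started from \<open>x\<close>, the path stays at or above \<open>b\<close> until X
  crosses b - x. For large \<open>n\<close> the penalties vanish there, so the penalized values are
  preserved in expectation, and \<open>n\<close> tends to infinity.\<close>

lemma val_le_expected_crossing:
  assumes b: "c - \<alpha> * exp b < val b"
  shows "val x \<le> expected_disc r (crossing (b - x)) (\<lambda>y. val (x + y))"
proof -
  let ?S = "crossing (b - x)"
  have S: "optional_time ?S" by (rule optional_crossing[OF separant(1,2)])
  obtain N where N: "\<And>n y. n \<ge> N \<Longrightarrow> y \<ge> b \<Longrightarrow> penalty n y = 0"
    using penalty_vanishes[OF b] by blast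
  have "expected_disc r ?S (\<lambda>y. pen_value n (x + y)) = pen_value n x" if n: "n \<ge> N" for n
  proof (rule expected_disc_potential_eq[OF S r penalty_measurable[of n] penalty_nonneg penalty_le
        pen_value_potential[of n]])
    show "AE \<omega> in M. \<forall>u\<ge>0. ennreal u < ?S \<omega> \<longrightarrow> penalty n (x + X u \<omega>) = 0"
      using before_crossing by (rule AE_mp) (use N[OF n] in \<open>fastforce simp: algebra_simps\<close>)
  qed
  then show ?thesis
    by (intro LIMSEQ_le[OF pen_value_tendsto expected_pen_value_tendsto[OF S]] exI[of _ N]) simp
qed

lemma expected_val_tendsto:
  assumes S: "\<And>n. optional_time (S n)" "optional_time T" and lim: "\<And>\<omega>. \<omega> \<in> space M \<Longrightarrow> (\<lambda>n. S n \<omega>) \<longlonglongrightarrow> T \<omega>"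
  shows "(\<lambda>n. expected_disc r (S n) (\<lambda>y. val (x + y))) \<longlonglongrightarrow> expected_disc r T (\<lambda>y. val (x + y))"
  by (rule expected_disc_tendsto[OF S lim r, where L=c])
    (use payoff_classD[OF val_class, of "x + y" for y] in \<open>auto intro: order_trans[OF payoff_classD(3)[OF val_class]]\<close>)

lemma stopping_point_exists: "\<exists>x. val x \<le> c - \<alpha> * exp x"
proof (rule ccontr)
  assume "\<not> ?thesis"
  then have b: "c - \<alpha> * exp b < val b" for b by (simp add: not_le)
  define S where "S k = crossing (- real k)" for k
  define T where "T \<omega> = (SUP k. S k \<omega>)" for \<omega>
  have S: "optional_time (S k)" for k
    unfolding S_def by (rule optional_crossing[OF separant(1,2)])
  have T: "optional_time T"
    unfolding T_def[abs_def] by (rule stopping_time_SUP[OF S])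
  have lim: "(\<lambda>k. S k \<omega>) \<longlonglongrightarrow> T \<omega>" for \<omega>
    unfolding T_def S_def by (intro LIMSEQ_SUP incseq_SucI) (auto simp: crossing_time_def intro!: INF_superset_mono)
  \<comment> \<open>\<open>H j\<close> is 1 below -j - 1, hence at X after crossing -k as soon as k
    \<ge> j + 1, and it is 0 above -j. Letting k grow for fixed j leaves a fixed amount of
    discounted mass where X at \<open>T\<close> is below -j; letting j grow then contradicts that X
    at \<open>T\<close> is a real number.\<close>
  define H where "H j y = min 1 (max 0 (- y - real j))" for j y
  have H: "0 \<le> H j y" "H j y \<le> 1" "\<bar>H j y - H j z\<bar> \<le> 1 * \<bar>y - z\<bar>" for j y z
    unfolding H_def by (simp_all add: min_def max_def abs_if)
  have Hm: "H j \<in> borel_measurable borel" for j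
    by (rule borel_measurable_lipschitz[OF H(3)])
  have ge: "val 0 / c \<le> expected_disc r T (H j)" for j
  proof (rule LIMSEQ_le_const[OF expected_disc_tendsto[OF S T lim r H]], intro exI allI impI)
    fix k assume k: "Suc j \<le> k"
    have "val 0 \<le> expected_disc r (S k) (\<lambda>y. val (0 + y))"
      using val_le_expected_crossing[OF b, of 0 "- real k"] by (simp add: S_def)
    also have "\<dots> \<le> expected_disc r (S k) (\<lambda>y. c * H j y)"
    proof (rule expected_disc_mono[OF S r, where B=c and B'=c])
      show "AE \<omega> in M. S k \<omega> < \<infinity> \<longrightarrow> val (0 + XS (S k) \<omega>) \<le> c * H j (XS (S k) \<omega>)"
        using crossing_level[OF separant(1,2,3), of "- real k"]
      proof (rule AE_mp, intro AE_I2 impI)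
        fix \<omega> assume *: "crossing (- real k) \<omega> < \<infinity> \<longrightarrow> XS (crossing (- real k)) \<omega> \<le> - real k" "S k \<omega> < \<infinity>"
        then have "H j (XS (S k) \<omega>) = 1" using k by (simp add: S_def H_def)
        then show "val (0 + XS (S k) \<omega>) \<le> c * H j (XS (S k) \<omega>)" using payoff_classD(2)[OF val_class] by simp
      qed
      show "\<bar>c * H j x\<bar> \<le> c" for x
        using H(1,2)[of j x] c by (simp add: abs_mult)
    qed (use payoff_classD(1,2)[OF val_class] Hm in \<open>auto simp: abs_of_nonneg\<close>)
    also have "\<dots> = c * expected_disc r (S k) (H j)"
      by (simp add: expected_disc_def mult.left_commute)
    finally show "val 0 / c \<le> expected_disc r (S k) (H j)" using c by (simp add: field_simps)
  qed
  have "(\<lambda>j. expected_disc r T (H j)) \<longlonglongrightarrow> (LINT \<omega>|M. 0)"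
    unfolding expected_disc_def
  proof (rule integral_dominated_convergence[where w="\<lambda>_. 1"])
    note [measurable] = optional_measurable[OF T] XS_measurable[OF T] Hm
    show "(\<lambda>\<omega>. disc r (T \<omega>) * H j (XS T \<omega>)) \<in> borel_measurable M" for j by measurable
    show "AE \<omega> in M. norm (disc r (T \<omega>) * H j (XS T \<omega>)) \<le> 1" for j
      using H r by (auto simp: abs_mult disc_le_1 intro!: mult_le_one)
    show "AE \<omega> in M. (\<lambda>j. disc r (T \<omega>) * H j (XS T \<omega>)) \<longlonglongrightarrow> 0"
    proof (rule AE_I2)
      fix \<omega>
      obtain N :: nat where N: "- XS T \<omega> \<le> real N" using real_arch_simple by blast
      have "H j (XS T \<omega>) = 0" if "j \<ge> N" for j
      proof -
        have "- XS T \<omega> \<le> real j" using N that by (meson of_nat_le_iff order_trans)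
        then show ?thesis by (simp add: H_def)
      qed
      then show "(\<lambda>j. disc r (T \<omega>) * H j (XS T \<omega>)) \<longlonglongrightarrow> 0"
        by (intro tendsto_eventually eventually_sequentiallyI[of N]) simp
    qed
  qed auto
  then have "val 0 / c \<le> 0"
    by (intro LIMSEQ_le_const[where X="\<lambda>j. expected_disc r T (H j)"]) (use ge in auto)
  then show False using val_pos[of 0] c by (simp add: divide_le_0_iff)
qed

text \<open>Positivity of the value bounds the set from above and continuity closes it, so its
  supremum belongs to it and is the threshold.\<close>

lemma stopping_threshold_exists: "\<exists>b. \<forall>x. val x \<le> c - \<alpha> * exp x \<longleftrightarrow> x \<le> b"
proof -
  let ?B = "{x. val x \<le> c - \<alpha> * exp x}"
  have cont: "continuous_on UNIV val"
  proof -
    have "c-lipschitz_on UNIV val"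
      using payoff_classD(3)[OF val_class] c by (auto simp: lipschitz_on_def dist_real_def)
    then show ?thesis by (rule lipschitz_on_continuous_on)
  qed
  have closed: "closed ?B"
    by (intro closed_Collect_le cont continuous_intros)
  have bdd: "bdd_above ?B"
  proof (rule bdd_aboveI)
    fix x assume "x \<in> ?B"
    then have "\<alpha> * exp x < c" using val_pos[of x] by simp
    then have "exp x < c / \<alpha>" using alpha by (simp add: field_simps)
    then have "ln (exp x) < ln (c / \<alpha>)" using c alpha by (subst ln_less_cancel_iff) auto
    then show "x \<le> ln (c / \<alpha>)" by simp
  qed
  have ne: "?B \<noteq> {}" using stopping_point_exists by auto
  have Sup: "Sup ?B \<in> ?B" by (rule closed_contains_Sup[OF ne bdd closed])
  have down: "y \<in> ?B" if x: "x \<in> ?B" and "y \<le> x" for x y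
  proof -
    have "exp (x - y) * (\<alpha> * exp y) = \<alpha> * exp x" by (simp add: exp_diff)
    also have "\<dots> \<le> c - val x" using x by simp
    also have "\<dots> \<le> exp (x - y) * (c - val y)" by (rule payoff_classD(4)[OF val_class \<open>y \<le> x\<close>])
    finally have "\<alpha> * exp y \<le> c - val y" by simp
    then show ?thesis by simp
  qed
  have "val x \<le> c - \<alpha> * exp x \<longleftrightarrow> x \<le> Sup ?B" for x
    using cSup_upper[OF _ bdd, of x] down[OF Sup, of x] by auto
  then show ?thesis by blast
qed

end

section \<open>Reduction to optional times and verification\<close>

text \<open>For the last part: the events that agree a.s. with an event of \<open>F s\<close> are
  closed under complements and countable unions, and they include the generators, a null set
  agreeing a.s. with the empty set.\<close>

lemma (in prob_space) completed_natural_filtration: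
  assumes Z: "\<forall>t\<ge>0. Z t \<in> borel_measurable M"
  shows filtration_completed_natural: "filtration (space M) (completed_natural_filtration M Z)"
    and adapted_completed_natural: "t \<ge> 0 \<Longrightarrow> Z t \<in> borel_measurable (completed_natural_filtration M Z (ennreal t))"
    and null_completed_natural: "N \<in> null_sets (completion M) \<Longrightarrow> N \<in> sets (completed_natural_filtration M Z s)"
    and sets_completed_natural_subset: "sets (completed_natural_filtration M Z s) \<subseteq> sets (completion M)"
    and sets_completed_natural_approx: "\<lbrakk>filtration (space M) F; \<forall>t\<ge>0. Z t \<in> borel_measurable (F (ennreal t));
        E \<in> sets (completed_natural_filtration M Z s)\<rbrakk> \<Longrightarrow> \<exists>A\<in>sets (F s). AE \<omega> in M. \<omega> \<in> E \<longleftrightarrow> \<omega> \<in> A"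
proof -
  let ?C = "completed_natural_filtration M Z"
  let ?G = "\<lambda>t. {Z s -` B \<inter> space M | s B. 0 \<le> s \<and> ennreal s \<le> t \<and> B \<in> sets borel} \<union> null_sets (completion M)"
  have G: "?G t \<subseteq> sets (completion M)" for t
    using Z by (auto simp: null_sets_def intro: measurable_sets)
  then have G_Pow: "?G t \<subseteq> Pow (space M)" for t
    using sets.space_closed[of "completion M"] by fastforce
  have space_C: "space (?C t) = space M" for t
    unfolding completed_natural_filtration_def using G_Pow by (rule space_measure_of)
  have sets_C: "sets (?C t) = sigma_sets (space M) (?G t)" for t
    unfolding completed_natural_filtration_def using G_Pow by (rule sets_measure_of)
  show "filtration (space M) ?C"
  proof
    fix i j :: ennreal assume "i \<le> j"
    then show "sets (?C i) \<subseteq> sets (?C j)"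
      unfolding sets_C by (intro sigma_sets_mono') (auto intro: order_trans)
  qed (rule space_C)
  show "Z t \<in> borel_measurable (?C (ennreal t))" if "t \<ge> 0" for t
  proof (rule measurableI)
    fix B assume "B \<in> sets (borel :: real measure)"
    then show "Z t -` B \<inter> space (?C (ennreal t)) \<in> sets (?C (ennreal t))"
      unfolding sets_C space_C using that by (intro sigma_sets.Basic) auto
  qed simp
  show "N \<in> null_sets (completion M) \<Longrightarrow> N \<in> sets (?C s)" for N s
    unfolding sets_C by (intro sigma_sets.Basic) auto
  show "sets (?C s) \<subseteq> sets (completion M)" for s
    unfolding sets_C using sets.sigma_sets_subset[OF G[of s]] by simp
  assume F: "filtration (space M) F" and ad: "\<forall>t\<ge>0. Z t \<in> borel_measurable (F (ennreal t))"
    and E: "E \<in> sets (?C s)"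
  interpret F: filtration "space M" F by fact
  from E show "\<exists>A\<in>sets (F s). AE \<omega> in M. \<omega> \<in> E \<longleftrightarrow> \<omega> \<in> A"
    unfolding sets_C
  proof induction
    case (Basic a)
    then consider t B where "a = Z t -` B \<inter> space M" "0 \<le> t" "ennreal t \<le> s" "B \<in> sets borel"
      | "a \<in> null_sets (completion M)" by auto
    then show ?case
    proof cases
      case 1
      then have "a \<in> sets (F (ennreal t))"
        using measurable_sets[OF ad[rule_format], of t B] by (simp add: F.space_F)
      then show ?thesis using F.sets_F_mono[OF 1(3)] by (intro bexI[of _ a]) auto
    next
      case 2
      then obtain N where "N \<in> null_sets M" "a \<subseteq> N" unfolding null_sets_completion_iff2 by auto
      then have "AE \<omega> in M. \<omega> \<in> a \<longleftrightarrow> \<omega> \<in> {}" using AE_not_in[of N M] by (auto elim!: AE_mp)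
      then show ?thesis by (intro bexI[of _ "{}"]) auto
    qed
  next
    case Empty
    then show ?case by (intro bexI[of _ "{}"]) auto
  next
    case (Compl a)
    then obtain A where A: "A \<in> sets (F s)" "AE \<omega> in M. \<omega> \<in> a \<longleftrightarrow> \<omega> \<in> A" by blast
    then have "AE \<omega> in M. \<omega> \<in> space M - a \<longleftrightarrow> \<omega> \<in> space M - A" by (auto elim!: AE_mp)
    then show ?case
      using sets.compl_sets[OF A(1)] by (intro bexI[of _ "space M - A"]) (auto simp: F.space_F)
  next
    case (Union a)
    then have "\<forall>i. \<exists>A. A \<in> sets (F s) \<and> (AE \<omega> in M. \<omega> \<in> a i \<longleftrightarrow> \<omega> \<in> A)" by blast
    then obtain A where A: "\<And>i. A i \<in> sets (F s)" "\<And>i. AE \<omega> in M. \<omega> \<in> a i \<longleftrightarrow> \<omega> \<in> A i" by metis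
    have "AE \<omega> in M. \<forall>i. \<omega> \<in> a i \<longleftrightarrow> \<omega> \<in> A i" using A(2) by (simp add: AE_all_countable)
    then have "AE \<omega> in M. \<omega> \<in> (\<Union>i. a i) \<longleftrightarrow> \<omega> \<in> (\<Union>i. A i)" by (auto elim!: AE_mp)
    then show ?case using A(1) by (intro bexI[of _ "\<Union>i. A i"]) auto
  qed
qed

text \<open>Every null set belongs to every member of the filtration. This serves the passage time,
  which is identified with a supremum of crossing times only up to a null set.\<close>

lemma (in prob_space) stopping_time_usual_cong_AE:
  assumes Z: "\<forall>t\<ge>0. Z t \<in> borel_measurable M"
    and S: "stopping_time (usual_natural_filtration M Z) S" and eq: "AE \<omega> in M. S \<omega> = T \<omega>"
  shows "stopping_time (usual_natural_filtration M Z) T"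
proof
  let ?C = "completed_natural_filtration M Z"
  note filt = filtration_completed_natural[OF Z]
  interpret C: filtration "space M" ?C by (rule filt)
  define N where "N = {\<omega>\<in>space M. S \<omega> \<noteq> T \<omega>}"
  obtain N' where "N' \<in> null_sets M" "N \<subseteq> N'"
    using eq unfolding N_def eventually_ae_filter by auto
  then have sub: "A \<subseteq> N \<Longrightarrow> A \<in> null_sets (completion M)" for A
    unfolding null_sets_completion_iff2 by blast
  fix t
  have "{\<omega>\<in>space M. S \<omega> \<le> t} \<in> sets (right_limit_filtration (space M) ?C t)"
    using S unfolding stopping_time_def usual_natural_filtration_def
    by (auto simp: pred_def space_right_limit_filtration[OF filt])
  moreover have "{\<omega>\<in>space M. T \<omega> \<le> t} \<in> sets (?C s)" if "{\<omega>\<in>space M. S \<omega> \<le> t} \<in> sets (?C s)" for s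
  proof -
    have eq: "{\<omega>\<in>space M. T \<omega> \<le> t} = ({\<omega>\<in>space M. S \<omega> \<le> t} - N) \<union> ({\<omega>\<in>space M. T \<omega> \<le> t} \<inter> N)"
      by (auto simp: N_def)
    have "N \<in> sets (?C s)" "{\<omega>\<in>space M. T \<omega> \<le> t} \<inter> N \<in> sets (?C s)"
      by (auto intro!: null_completed_natural[OF Z sub])
    with that have "({\<omega>\<in>space M. S \<omega> \<le> t} - N) \<union> ({\<omega>\<in>space M. T \<omega> \<le> t} \<inter> N) \<in> sets (?C s)"
      by (intro sets.Un sets.Diff)
    then show ?thesis by (rule ssubst[OF eq])
  qed
  ultimately have "{\<omega>\<in>space M. T \<omega> \<le> t} \<in> sets (right_limit_filtration (space M) ?C t)"
    unfolding sets_right_limit_filtration[OF filt] by blast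
  then show "Measurable.pred (usual_natural_filtration M Z t) (\<lambda>x. T x \<le> t)"
    by (simp add: pred_def usual_natural_filtration_def space_right_limit_filtration[OF filt])
qed

lemma (in prob_space) stopping_time_usual_measurable:
  assumes Z: "\<forall>t\<ge>0. Z t \<in> borel_measurable M"
    and S: "stopping_time (usual_natural_filtration M Z) S"
  shows "S \<in> borel_measurable (completion M)"
proof (rule measurable_stopping_time[OF S])
  note filt = filtration_completed_natural[OF Z]
  show "sets (usual_natural_filtration M Z t) \<subseteq> sets (completion M)" for t
    unfolding usual_natural_filtration_def sets_right_limit_filtration[OF filt]
    using sets_completed_natural_subset[where s=\<infinity>, OF Z] by auto
  show "space (usual_natural_filtration M Z t) = space (completion M)" for t
    by (simp add: usual_natural_filtration_def space_right_limit_filtration[OF filt])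
qed

text \<open>Each event {S < p}, \<open>p\<close> rational, is replaced by an a.s. equal event
  \<open>A p\<close> of \<open>F\<close> at time \<open>p\<close>, and \<open>T\<close> is the
  infimum of the \<open>p\<close> whose \<open>A p\<close> occurs. Only countably many null sets are
  discarded.\<close>

lemma (in prob_space) stopping_time_usual_AE_optional:
  assumes Z: "\<forall>t\<ge>0. Z t \<in> borel_measurable M"
    and F: "filtration (space M) F" and ad: "\<forall>t\<ge>0. Z t \<in> borel_measurable (F (ennreal t))"
    and S: "stopping_time (usual_natural_filtration M Z) S"
  shows "\<exists>T. stopping_time (right_limit_filtration (space M) F) T \<and> (AE \<omega> in M. S \<omega> = T \<omega>)"
proof -
  let ?C = "completed_natural_filtration M Z"
  note filt = filtration_completed_natural[OF Z]
  interpret C: filtration "space M" ?C by (rule filt)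
  interpret F: filtration "space M" F by (rule F)
  have le: "{\<omega>\<in>space M. S \<omega> \<le> ennreal u} \<in> sets (?C s)" if "ennreal u < s" for u s
  proof -
    have "{\<omega>\<in>space M. S \<omega> \<le> ennreal u} \<in> sets (right_limit_filtration (space M) ?C (ennreal u))"
      using S unfolding stopping_time_def usual_natural_filtration_def
      by (auto simp: pred_def space_right_limit_filtration[OF filt])
    then have "{\<omega>\<in>space M. S \<omega> \<le> ennreal u} \<in> (\<Inter>s\<in>{ennreal u<..}. sets (?C s))"
      by (simp add: sets_right_limit_filtration[OF filt])
    then show ?thesis using that by blast
  qed
  have dense: "\<exists>q::rat. 0 < q \<and> a < ennreal (of_rat q) \<and> ennreal (of_rat q) < b" if "a < b" for a b :: ennreal
  proof -
    from ennreal_rat_dense[OF that] obtain q :: rat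
      where q: "a < ennreal (of_rat q)" "ennreal (of_rat q) < b" by blast
    then have "0 < q" by (metis ennreal_neg not_less_zero not_le of_rat_le_0_iff)
    then show ?thesis using q by blast
  qed
  have lt: "{\<omega>\<in>space M. S \<omega> < ennreal p} \<in> sets (?C (ennreal p))" for p
  proof -
    have "{\<omega>\<in>space M. S \<omega> < ennreal p}
        = (\<Union>q\<in>{q::rat. ennreal (of_rat q) < ennreal p}. {\<omega>\<in>space M. S \<omega> \<le> ennreal (of_rat q)})"
    proof (intro set_eqI iffI)
      fix \<omega> assume "\<omega> \<in> {\<omega>\<in>space M. S \<omega> < ennreal p}"
      then obtain q :: rat where "S \<omega> < ennreal (of_rat q)" "ennreal (of_rat q) < ennreal p" "\<omega> \<in> space M"
        using dense by blast
      then show "\<omega> \<in> (\<Union>q\<in>{q::rat. ennreal (of_rat q) < ennreal p}. {\<omega>\<in>space M. S \<omega> \<le> ennreal (of_rat q)})"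
        using less_imp_le by blast
    qed (auto intro: le_less_trans)
    also have "\<dots> \<in> sets (?C (ennreal p))"
      by (intro sets.countable_UN'') (auto intro: le)
    finally show ?thesis .
  qed
  have "\<exists>A\<in>sets (F (ennreal (of_rat p))).
      AE \<omega> in M. \<omega> \<in> {\<omega>\<in>space M. S \<omega> < ennreal (of_rat p)} \<longleftrightarrow> \<omega> \<in> A" for p :: rat
    by (rule sets_completed_natural_approx[OF Z F ad lt])
  then obtain A where A: "\<And>p::rat. A p \<in> sets (F (ennreal (of_rat p)))"
    "\<And>p. AE \<omega> in M. \<omega> \<in> {\<omega>\<in>space M. S \<omega> < ennreal (of_rat p)} \<longleftrightarrow> \<omega> \<in> A p" by metis
  define T where "T \<omega> = (INF p\<in>{p. 0 < p \<and> \<omega> \<in> A p}. ennreal (of_rat p))" for \<omega>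
  have "stopping_time (right_limit_filtration (space M) F) T"
  proof (rule stopping_time_right_limitI[OF F])
    fix q :: real assume "q > 0"
    have "{\<omega>\<in>space M. T \<omega> < ennreal q} = (\<Union>p\<in>{p. 0 < p \<and> ennreal (of_rat p) < ennreal q}. A p)"
      using sets.sets_into_space[OF A(1)] unfolding T_def INF_less_iff by (auto simp: F.space_F)
    also have "\<dots> \<in> sets (F (ennreal q))"
      using A(1) F.sets_F_mono[OF less_imp_le] by (intro sets.countable_UN'') auto
    finally show "{\<omega>\<in>space M. T \<omega> < ennreal q} \<in> sets (F (ennreal q))" .
  qed
  moreover have "AE \<omega> in M. \<forall>p. \<omega> \<in> {\<omega>\<in>space M. S \<omega> < ennreal (of_rat p)} \<longleftrightarrow> \<omega> \<in> A p"
    using A(2) by (simp add: AE_all_countable)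
  then have "AE \<omega> in M. S \<omega> = T \<omega>"
  proof (rule AE_mp, intro AE_I2 impI)
    fix \<omega> assume \<omega>: "\<omega> \<in> space M"
      and *: "\<forall>p. \<omega> \<in> {\<omega>\<in>space M. S \<omega> < ennreal (of_rat p)} \<longleftrightarrow> \<omega> \<in> A p"
    then have iff: "\<omega> \<in> A p \<longleftrightarrow> S \<omega> < ennreal (of_rat p)" for p by auto
    show "S \<omega> = T \<omega>"
    proof (rule antisym)
      show "S \<omega> \<le> T \<omega>" unfolding T_def iff by (rule INF_greatest) auto
      show "T \<omega> \<le> S \<omega>"
      proof (rule dense_ge)
        fix y assume "S \<omega> < y"
        from dense[OF this] obtain p where p: "0 < p" "S \<omega> < ennreal (of_rat p)" "ennreal (of_rat p) < y" by blast
        then have "T \<omega> \<le> ennreal (of_rat p)" unfolding T_def iff by (intro INF_lower) auto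
        then show "T \<omega> \<le> y" using p(3) by simp
      qed
    qed
  qed
  ultimately show ?thesis by blast
qed

section \<open>Verification: the affine reward against the value function\<close>

context put_problem
begin

abbreviation price :: "real \<Rightarrow> real \<Rightarrow> 'a \<Rightarrow> real" where
  "price x \<equiv> exp_process X (exp x)"

lemma price_measurable: "\<forall>t\<ge>0. price x t \<in> borel_measurable M"
  unfolding exp_process_def[abs_def] using X_measurable by simp

lemma price_adapted: "\<forall>t\<ge>0. price x t \<in> borel_measurable (F (ennreal t))"
  unfolding exp_process_def[abs_def] using adapted by simp

lemma expected_reward_eq:
  "expected_reward M r (affine_payoff \<alpha> c) (price x) S
    = (LINT \<omega>|completion M. disc r (S \<omega>) * (c - \<alpha> * exp (x + XS S \<omega>)))"
  unfolding expected_reward_def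
  by (intro Bochner_Integration.integral_cong)
    (auto simp: disc_def affine_payoff_def exp_process_def XS_def exp_add)

lemma reward_measurable_completion:
  assumes "S \<in> admissible_times M (price x)"
  shows "(\<lambda>\<omega>. disc r (S \<omega>) * (c - \<alpha> * exp (x + XS S \<omega>))) \<in> borel_measurable (completion M)"
proof -
  have S [measurable]: "S \<in> borel_measurable (completion M)"
    using assms unfolding admissible_times_def
    by (intro stopping_time_usual_measurable[OF price_measurable]) auto
  have "(\<lambda>\<omega>. X (max 0 (enn2real (S \<omega>))) \<omega>) \<in> borel_measurable (completion M)"
    by (rule X_compose_measurable) (auto intro: measurable_completion)
  then have [measurable]: "XS S \<in> borel_measurable (completion M)" by (simp add: XS_def[abs_def])
  show ?thesis by measurable
qed

lemma expected_reward_optional: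
  assumes adm: "S \<in> admissible_times M (price x)" and T: "optional_time T" and eq: "AE \<omega> in M. S \<omega> = T \<omega>"
  shows "expected_reward M r (affine_payoff \<alpha> c) (price x) S
      = (LINT \<omega>|M. disc r (T \<omega>) * (c - \<alpha> * exp (x + XS T \<omega>)))"
proof -
  note [measurable] = optional_measurable[OF T] XS_measurable[OF T]
  have m: "(\<lambda>\<omega>. disc r (T \<omega>) * (c - \<alpha> * exp (x + XS T \<omega>))) \<in> borel_measurable M" by measurable
  have "AE \<omega> in completion M. disc r (S \<omega>) * (c - \<alpha> * exp (x + XS S \<omega>)) = disc r (T \<omega>) * (c - \<alpha> * exp (x + XS T \<omega>))"
    using AE_completion[OF eq] by eventually_elim (simp add: XS_def)
  then show ?thesis
    unfolding expected_reward_eq integral_completion[OF m, symmetric]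
    by (intro integral_cong_AE reward_measurable_completion[OF adm] measurable_completion[OF m])
qed

lemma affine_le_val: "c - \<alpha> * exp y \<le> val y"
  using payoff_le_val[of y] by (simp add: payoff_def)

text \<open>The reward is dominated pointwise by the discounted value function, whose expectation is
  at most \<open>val x\<close>. Attaining \<open>val x\<close> forces a.s. equality, so an optimal
  time stops only inside the stopping region.\<close>

lemma
  assumes T: "optional_time T"
  shows reward_le_val: "(LINT \<omega>|M. disc r (T \<omega>) * (c - \<alpha> * exp (x + XS T \<omega>))) \<le> val x"
    and reward_eq_valD: "(LINT \<omega>|M. disc r (T \<omega>) * (c - \<alpha> * exp (x + XS T \<omega>))) = val x \<Longrightarrow>
      AE \<omega> in M. T \<omega> < \<infinity> \<longrightarrow> val (x + XS T \<omega>) \<le> c - \<alpha> * exp (x + XS T \<omega>)"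
proof -
  let ?R = "\<lambda>\<omega>. disc r (T \<omega>) * (c - \<alpha> * exp (x + XS T \<omega>))"
  let ?W = "\<lambda>\<omega>. disc r (T \<omega>) * val (x + XS T \<omega>)"
  have W: "integrable M ?W"
    using payoff_classD(1,2)[OF val_class] by (intro integrable_disc[OF T r, where B=c]) (auto simp: abs_of_nonneg)
  have W_le: "integral\<^sup>L M ?W \<le> val x"
    using expected_val_le[OF T, of x] by (simp add: expected_disc_def)
  have R_le: "?R \<omega> \<le> ?W \<omega>" for \<omega>
    by (intro mult_left_mono affine_le_val) simp
  \<comment> \<open>A non-integrable reward has the junk integral \<open>0\<close>, which is below the value as well.\<close>
  have nonint: "integral\<^sup>L M ?R < val x" if "\<not> integrable M ?R"
    using val_pos[of x] that by (simp add: not_integrable_integral_eq)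
  have int: "integral\<^sup>L M ?R \<le> integral\<^sup>L M ?W" if "integrable M ?R"
    by (rule integral_mono[OF that W R_le])
  show "integral\<^sup>L M ?R \<le> val x"
    using nonint int W_le by (cases "integrable M ?R") auto
  assume eq: "integral\<^sup>L M ?R = val x"
  then have R: "integrable M ?R" using nonint by force
  have "integral\<^sup>L M (\<lambda>\<omega>. ?W \<omega> - ?R \<omega>) = 0"
    using W R eq W_le int[OF R] by simp
  then have "AE \<omega> in M. ?W \<omega> - ?R \<omega> = 0"
    using W R R_le by (subst (asm) integral_nonneg_eq_0_iff_AE) auto
  then show "AE \<omega> in M. T \<omega> < \<infinity> \<longrightarrow> val (x + XS T \<omega>) \<le> c - \<alpha> * exp (x + XS T \<omega>)"
    by (rule AE_mp) (auto simp: disc_def)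
qed

lemma passage_time_smallest_optimal:
  assumes b: "\<And>y. val y \<le> c - \<alpha> * exp y \<longleftrightarrow> y \<le> b"
  shows "smallest_optimal_time M r (affine_payoff \<alpha> c) (price x) (passage_time (price x) (exp b))"
proof -
  let ?\<tau> = "passage_time (price x) (exp b)"
  \<comment> \<open>Levels strictly above the threshold: there the value strictly exceeds the
    reward, as \<open>val_le_expected_crossing\<close> demands. The crossing time of b - x itself
    asks for a strict inequality and could come too late.\<close>
  define a where "a k = b + 1 / (real k + 1) - x" for k
  define S where "S k = crossing (a k)" for k
  define T where "T \<omega> = (SUP k. S k \<omega>)" for \<omega>
  have S: "optional_time (S k)" for k
    unfolding S_def by (rule optional_crossing[OF separant(1,2)])
  have T: "optional_time T"
    unfolding T_def[abs_def] by (rule stopping_time_SUP[OF S])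
  have a_dec: "a (Suc k) \<le> a k" for k
    unfolding a_def by (simp add: frac_le)
  have lim: "(\<lambda>k. S k \<omega>) \<longlonglongrightarrow> T \<omega>" for \<omega>
    unfolding T_def S_def
    by (intro LIMSEQ_SUP incseq_SucI) (auto simp: crossing_time_def intro!: INF_superset_mono intro: less_le_trans[OF _ a_dec])
  \<comment> \<open>At \<open>S k\<close> the process exceeds b - x by at most 1 / (k + 1). The
    clipped excess carries this to \<open>T\<close> without any claim that X at \<open>S k\<close>
    converges.\<close>
  have level: "AE \<omega> in M. T \<omega> < \<infinity> \<longrightarrow> XS T \<omega> \<le> b - x"
  proof -
    define H where "H y = min 1 (max 0 (y - (b - x)))" for y
    have H: "0 \<le> H y" "H y \<le> 1" "\<bar>H y - H z\<bar> \<le> 1 * \<bar>y - z\<bar>" for y z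
      unfolding H_def by (simp_all add: min_def max_def abs_if)
    have Hm: "H \<in> borel_measurable borel" by (rule borel_measurable_lipschitz[OF H(3)])
    have "expected_disc r (S k) H \<le> 1 / (real k + 1)" for k
    proof (rule expected_disc_le[OF S r Hm, where B=1])
      show "AE \<omega> in M. S k \<omega> < \<infinity> \<longrightarrow> H (XS (S k) \<omega>) \<le> 1 / (real k + 1)"
        unfolding S_def using crossing_level[OF separant(1,2,3), of "a k"]
      proof (rule AE_mp, intro AE_I2 impI)
        fix \<omega> assume "crossing (a k) \<omega> < \<infinity> \<longrightarrow> XS (crossing (a k)) \<omega> \<le> a k" "crossing (a k) \<omega> < \<infinity>"
        then have "XS (crossing (a k)) \<omega> - (b - x) \<le> 1 / (real k + 1)" by (simp add: a_def)
        then show "H (XS (crossing (a k)) \<omega>) \<le> 1 / (real k + 1)" by (simp add: H_def min_le_iff_disj)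
      qed
    qed (use H in auto)
    moreover have "(\<lambda>k. 1 / (real k + 1)) \<longlonglongrightarrow> 0" by real_asymp
    ultimately have "expected_disc r T H \<le> 0"
      by (intro LIMSEQ_le[OF expected_disc_tendsto[OF S T lim r H]]) auto
    then have "expected_disc r T H = 0" using expected_disc_nonneg[where G=H, OF H(1)] by (intro antisym)
    then have "AE \<omega> in M. T \<omega> < \<infinity> \<longrightarrow> H (XS T \<omega>) = 0"
      by (rule expected_disc_eq_0D[OF T r Hm H(1,2)])
    then show ?thesis by (rule AE_mp) (auto simp: H_def)
  qed
  have below: "price x t \<omega> \<le> exp b \<longleftrightarrow> X t \<omega> \<le> b - x" for t \<omega>
  proof -
    have "price x t \<omega> = exp (x + X t \<omega>)" by (simp add: exp_process_def exp_add)
    then show ?thesis by auto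
  qed
  \<comment> \<open>Before \<open>S k\<close> the path stays at or above \<open>a k\<close>, so the
    threshold cannot be reached before \<open>T\<close>; conversely, by \<open>level\<close>, a
    finite \<open>T\<close> is itself a time at which it is reached.\<close>
  have T_eq: "AE \<omega> in M. T \<omega> = ?\<tau> \<omega>"
    using level before_crossing
  proof eventually_elim
    case (elim \<omega>)
    show ?case
    proof (rule antisym)
      show "T \<omega> \<le> ?\<tau> \<omega>"
        unfolding passage_time_def
      proof (rule Inf_greatest)
        fix s assume "s \<in> {ennreal t |t. 0 \<le> t \<and> price x t \<omega> \<le> exp b}"
        then obtain t where t: "s = ennreal t" "0 \<le> t" "X t \<omega> \<le> b - x" using below by auto
        show "T \<omega> \<le> s"
          unfolding T_def
        proof (rule SUP_least)
          fix k
          have "b - x < a k" by (simp add: a_def)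
          then show "S k \<omega> \<le> s" using elim(2) t unfolding S_def by (meson leD leI order_trans)
        qed
      qed
      show "?\<tau> \<omega> \<le> T \<omega>"
      proof (cases "T \<omega> = \<infinity>")
        case False
        then have fin: "T \<omega> < \<infinity>" by (simp add: less_top)
        then have "T \<omega> = ennreal (enn2real (T \<omega>))" by (simp add: less_top)
        moreover have "price x (enn2real (T \<omega>)) \<omega> \<le> exp b"
          using elim(1) fin by (simp add: below XS_def)
        ultimately show ?thesis
          unfolding passage_time_def by (intro Inf_lower) (metis (mono_tags, lifting) enn2real_nonneg mem_Collect_eq)
      qed simp
    qed
  qed
  have adm: "?\<tau> \<in> admissible_times M (price x)"
  proof -
    let ?C = "completed_natural_filtration M (price x)"
    \<comment> \<open>Logarithms recover X from the price, so the crossing times of X are stopping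
      times of the price's own filtration.\<close>
    have X_C: "X t \<in> borel_measurable (?C (ennreal t))" if "t \<ge> 0" for t
    proof -
      note [measurable] = adapted_completed_natural[OF price_measurable that]
      have "(\<lambda>\<omega>. ln (price x t \<omega>) - x) \<in> borel_measurable (?C (ennreal t))" by measurable
      then show ?thesis by (simp add: exp_process_def ln_mult)
    qed
    have "stopping_time (usual_natural_filtration M (price x)) T"
      unfolding T_def[abs_def] S_def usual_natural_filtration_def
      by (intro stopping_time_SUP stopping_time_crossing separant(1,2) X_C
          filtration_completed_natural[OF price_measurable])
    then have "stopping_time (usual_natural_filtration M (price x)) ?\<tau>"
      by (rule stopping_time_usual_cong_AE[OF price_measurable _ T_eq])
    then show ?thesis by (simp add: admissible_times_def)
  qed
  have reward: "expected_reward M r (affine_payoff \<alpha> c) (price x) ?\<tau> = val x"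
  proof (rule antisym)
    have *: "expected_reward M r (affine_payoff \<alpha> c) (price x) ?\<tau>
        = (LINT \<omega>|M. disc r (T \<omega>) * (c - \<alpha> * exp (x + XS T \<omega>)))"
      by (rule expected_reward_optional[OF adm T]) (use T_eq in eventually_elim, simp)
    show "expected_reward M r (affine_payoff \<alpha> c) (price x) ?\<tau> \<le> val x"
      unfolding * by (rule reward_le_val[OF T])
    note [measurable] = optional_measurable[OF T] XS_measurable[OF T]
    have "val x \<le> expected_disc r T (\<lambda>y. val (x + y))"
    proof (rule LIMSEQ_le_const[OF expected_val_tendsto[OF S T lim]], intro exI allI impI)
      fix k
      have "c - \<alpha> * exp (b + 1 / (real k + 1)) < val (b + 1 / (real k + 1))"
        using b[of "b + 1 / (real k + 1)"] by (simp add: not_le[symmetric])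
      from val_le_expected_crossing[OF this] show "val x \<le> expected_disc r (S k) (\<lambda>y. val (x + y))"
        by (simp add: S_def a_def)
    qed
    also have "\<dots> = (LINT \<omega>|M. disc r (T \<omega>) * (c - \<alpha> * exp (x + XS T \<omega>)))"
      unfolding expected_disc_def
    proof (rule integral_cong_AE)
      show "AE \<omega> in M. disc r (T \<omega>) * val (x + XS T \<omega>) = disc r (T \<omega>) * (c - \<alpha> * exp (x + XS T \<omega>))"
        using level
      proof eventually_elim
        case (elim \<omega>)
        show ?case
        proof (cases "T \<omega> = \<infinity>")
          case False
          then have "x + XS T \<omega> \<le> b" using elim by (simp add: less_top)
          then have "val (x + XS T \<omega>) = c - \<alpha> * exp (x + XS T \<omega>)"
            using b affine_le_val by (intro antisym) auto
          then show ?thesis by simp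
        qed (simp add: disc_def)
      qed
    qed measurable
    finally show "val x \<le> expected_reward M r (affine_payoff \<alpha> c) (price x) ?\<tau>"
      unfolding * .
  qed
  have approx: "\<exists>\<sigma>'. optional_time \<sigma>' \<and> (AE \<omega> in M. \<sigma> \<omega> = \<sigma>' \<omega>)" if "\<sigma> \<in> admissible_times M (price x)" for \<sigma>
    using that unfolding admissible_times_def
    by (intro stopping_time_usual_AE_optional[OF price_measurable filt price_adapted]) auto
  have problem_value: "value_of_problem M r (affine_payoff \<alpha> c) (price x) = ereal (val x)"
    unfolding value_of_problem_def
  proof (rule antisym)
    show "(SUP \<sigma>\<in>admissible_times M (price x). ereal (expected_reward M r (affine_payoff \<alpha> c) (price x) \<sigma>)) \<le> ereal (val x)"
    proof (rule SUP_least)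
      fix \<sigma> assume \<sigma>: "\<sigma> \<in> admissible_times M (price x)"
      obtain \<sigma>' where \<sigma>': "optional_time \<sigma>'" "AE \<omega> in M. \<sigma> \<omega> = \<sigma>' \<omega>" using approx[OF \<sigma>] by blast
      show "ereal (expected_reward M r (affine_payoff \<alpha> c) (price x) \<sigma>) \<le> ereal (val x)"
        unfolding expected_reward_optional[OF \<sigma> \<sigma>'] using reward_le_val[OF \<sigma>'(1)] by simp
    qed
    show "ereal (val x) \<le> (SUP \<sigma>\<in>admissible_times M (price x). ereal (expected_reward M r (affine_payoff \<alpha> c) (price x) \<sigma>))"
      using reward by (intro SUP_upper2[OF adm]) simp
  qed
  \<comment> \<open>An optimal time that is finite stops at or below the threshold, so it is one of
    the times over which the passage time takes its infimum.\<close>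
  have "AE \<omega> in M. ?\<tau> \<omega> \<le> \<sigma> \<omega>" if opt: "optimal_time M r (affine_payoff \<alpha> c) (price x) \<sigma>" for \<sigma>
  proof -
    have \<sigma>: "\<sigma> \<in> admissible_times M (price x)"
      and eq: "expected_reward M r (affine_payoff \<alpha> c) (price x) \<sigma> = val x"
      using opt unfolding optimal_time_def problem_value by auto
    obtain \<sigma>' where \<sigma>': "optional_time \<sigma>'" "AE \<omega> in M. \<sigma> \<omega> = \<sigma>' \<omega>" using approx[OF \<sigma>] by blast
    have "AE \<omega> in M. \<sigma>' \<omega> < \<infinity> \<longrightarrow> val (x + XS \<sigma>' \<omega>) \<le> c - \<alpha> * exp (x + XS \<sigma>' \<omega>)"
      using eq unfolding expected_reward_optional[OF \<sigma> \<sigma>'] by (rule reward_eq_valD[OF \<sigma>'(1)])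
    then show ?thesis
      using \<sigma>'(2)
    proof eventually_elim
      case (elim \<omega>)
      show ?case
      proof (cases "\<sigma>' \<omega> = \<infinity>")
        case False
        then have fin: "\<sigma>' \<omega> < \<infinity>" by (simp add: less_top)
        then have "\<sigma>' \<omega> = ennreal (enn2real (\<sigma>' \<omega>))" by (simp add: less_top)
        moreover have "price x (enn2real (\<sigma>' \<omega>)) \<omega> \<le> exp b"
          using elim(1) fin by (simp add: below XS_def b)
        ultimately show ?thesis
          unfolding passage_time_def elim(2)
          by (intro Inf_lower) (metis (mono_tags, lifting) enn2real_nonneg mem_Collect_eq)
      qed (simp add: elim)
    qed
  qed
  then show ?thesis
    unfolding smallest_optimal_time_def optimal_time_def[of _ _ _ _ ?\<tau>] using adm reward problem_value by simp
qed

end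

theorem mainTheorem1:
  fixes M :: "'a measure" and F :: "ennreal \<Rightarrow> 'a measure"
    and X :: "real \<Rightarrow> 'a \<Rightarrow> real" and r \<alpha> :: real
  assumes "prob_space M"
    and "filtration (space M) F" and "\<And>t. sets (F t) \<subseteq> sets M"
    and "strong_markov_process M F (shifted_law M X) X"
    and "AE \<omega> in M. X 0 \<omega> = 0"
    and "r > 0" and "\<alpha> > 0"
    and right_continuous_at_0: "AE \<omega> in M. ((\<lambda>t. X t \<omega>) \<longlongrightarrow> X 0 \<omega>) (at_right 0)"
    and class_D: "class_D M (usual_natural_filtration M X) (\<lambda>t \<omega>. exp (- r * t + X t \<omega>))"
    and inf_zero: "(INF t\<in>{0..}. exp (- r * t) * (LINT \<omega>|M. exp (X t \<omega>))) = 0"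
    and full_support: "\<And>t. t > 0 \<Longrightarrow> measure_support (distr M borel (X t)) = UNIV"
  shows "(\<forall>c>0. \<forall>v>0. \<exists>\<tau>. optimal_time M r (affine_payoff \<alpha> c) (exp_process X v) \<tau>) \<and>
    (\<forall>c>0. \<exists>b>0. \<forall>v>0. smallest_optimal_time M r (affine_payoff \<alpha> c) (exp_process X v)
       (passage_time (exp_process X v) b))"
proof -
  have L: "strong_levy M F X"
    using assms(1-5) right_continuous_at_0
    by (intro strong_levy.intro strong_levy_axioms.intro)
  have main: "\<exists>b>0. \<forall>v>0. smallest_optimal_time M r (affine_payoff \<alpha> c) (exp_process X v)
       (passage_time (exp_process X v) b)" if c: "c > 0" for c
  proof -
    interpret put_problem M F X r c \<alpha>
      using \<open>r > 0\<close> \<open>\<alpha> > 0\<close> c full_support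
      by (intro put_problem.intro L put_problem_axioms.intro)
    \<comment> \<open>\<open>val\<close> is one function for all starting points, so a single
      threshold serves every v = e^x; on the price scale it is e^b, which is positive.\<close>
    obtain b where b: "\<And>y. val y \<le> c - \<alpha> * exp y \<longleftrightarrow> y \<le> b" using stopping_threshold_exists by blast
    have "smallest_optimal_time M r (affine_payoff \<alpha> c) (exp_process X v) (passage_time (exp_process X v) (exp b))"
      if "v > 0" for v
      using passage_time_smallest_optimal[OF b, of "ln v"] that by simp
    then show ?thesis by (intro exI[of _ "exp b"]) auto
  qed
  then have "\<exists>\<tau>. optimal_time M r (affine_payoff \<alpha> c) (exp_process X v) \<tau>" if "c > 0" "v > 0" for c v
    using that unfolding smallest_optimal_time_def by blast
  with main show ?thesis by blast
qed

end
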